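(* For every real $\lambda>0$ there exists $c=c(\lambda)>0$ such that for all integers $n\ge 1$, $$c\;\le\;\mathbb{P}_{p_c}\big[\text{there exists a horizontal crossing of an } n \text{ by } \lambda n \text{ box}\big]\;\le\;1-c,$$ where $\mathbb{P}_{p_c}$ denotes critical site percolation on $\mathbb{Z}^2$, and an $n$ by $\lambda n$ box means a translate by a vector of $\mathbb{Z}^2$ of the rectangle $[0,n]\times[0,\lambda n]$ (the probability being the same for all such translates).
   Context: Site percolation on $\mathbb{Z}^2$ (nearest-neighbour square lattice) with parameter $p\in[0,1]$: each site is independently occupied with probability $p$ and vacant with probability $1-p$; $\mathbb{P}_p$ is the corresponding product measure. Let $\theta(p)=\mathbb{P}_p[\text{the origin is contained in an infinite occupied cluster}]$, and let the critical value be $p_c=\sup\{p:\theta(p)=0\}$. A horizontal crossing of a rectangle is a path of occupied sites (consecutive sites adjacent in the graph), staying inside the rectangle, which connects the left side of the rectangle to its right side. *)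

theory Defs
  imports "HOL-Probability.Probability"
begin

type_synonym site = "int \<times> int"

text \<open>\<open>\<omega> x\<close> means that the site \<open>x\<close> is occupied.\<close>

type_synonym config = "site \<Rightarrow> bool"

definition site_adj :: "site \<Rightarrow> site \<Rightarrow> bool" where
  "site_adj x y \<longleftrightarrow> \<bar>fst x - fst y\<bar> + \<bar>snd x - snd y\<bar> = 1"

definition site_percolation :: "real \<Rightarrow> config measure" where
  "site_percolation p = PiM UNIV (\<lambda>_. measure_pmf (bernoulli_pmf p))"

definition occupied_path :: "config \<Rightarrow> site list \<Rightarrow> bool" where
  "occupied_path \<omega> xs \<longleftrightarrow> xs \<noteq> [] \<and> successively site_adj xs \<and> (\<forall>x\<in>set xs. \<omega> x)"

text \<open>The cluster of a vacant site is empty.\<close>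

definition occupied_cluster :: "config \<Rightarrow> site \<Rightarrow> site set" where
  "occupied_cluster \<omega> x = {y. \<exists>xs. occupied_path \<omega> xs \<and> hd xs = x \<and> last xs = y}"

definition percolation_prob :: "real \<Rightarrow> real" where
  "percolation_prob p =
    measure (site_percolation p)
      {\<omega> \<in> space (site_percolation p). infinite (occupied_cluster \<omega> (0, 0))}"

text \<open>
  The restriction to \<open>{0..1}\<close> matters: \<^const>\<open>bernoulli_pmf\<close> is also defined, but
  meaningless, for other parameters.
\<close>

definition p_crit :: real where
  "p_crit = Sup {p \<in> {0..1}. percolation_prob p = 0}"

text \<open>
  The lattice sites of \<open>v + [0, n] \<times> [0, h]\<close>; the height \<open>h\<close> need not be an integer.
\<close>

definition rect :: "site \<Rightarrow> int \<Rightarrow> real \<Rightarrow> site set" where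
  "rect v n h = {x. fst v \<le> fst x \<and> fst x \<le> fst v + n \<and>
                    snd v \<le> snd x \<and> real_of_int (snd x) \<le> real_of_int (snd v) + h}"

definition horizontal_crossing :: "config \<Rightarrow> site \<Rightarrow> int \<Rightarrow> real \<Rightarrow> site list \<Rightarrow> bool" where
  "horizontal_crossing \<omega> v n h xs \<longleftrightarrow>
    occupied_path \<omega> xs \<and> set xs \<subseteq> rect v n h \<and>
    fst (hd xs) = fst v \<and> fst (last xs) = fst v + n"

definition crossing_event :: "site \<Rightarrow> int \<Rightarrow> real \<Rightarrow> config set" where
  "crossing_event v n h = {\<omega>. \<exists>xs. horizontal_crossing \<omega> v n h xs}"

end

theory Submission
  imports Defs
begin

text \<open>
  Let \<open>h(w, h)\<close> be the probability of an occupied crossing of a \<open>w\<close> by \<open>h\<close> rectangle in the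
  direction of \<open>w\<close>, and \<open>h*(w, h)\<close> the corresponding probability for vacant star-connected paths.
  Exactly one of an occupied horizontal crossing and a vacant vertical star crossing exists, so
  \<open>h(w, h) = 1 - h*(h, w)\<close>.

  If \<open>h(n, 3n)\<close> is below a universal constant for a single \<open>n\<close>, then a renormalisation inequality
  \<open>h(3n, 9n) \<le> (16 h(n, 3n))\<^sup>2\<close> makes it decay along \<open>3\<^sup>k n\<close>, so that \<open>\<theta> = 0\<close>; if \<open>h*(n, 3n)\<close> is
  that small, the same argument gives \<open>\<theta> > 0\<close>. Both conditions are open in \<open>p\<close>, hence neither holds
  at \<open>p\<^sub>c\<close> for any \<open>n\<close>.

  The Russo-Seymour-Welsh argument bounds the crossing probability of a \<open>3l\<close> by \<open>2l\<close> rectangle from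
  below by \<open>(1 - \<surd>(1 - t))\<^sup>3\<close>, where \<open>t\<close> is that of the square of side \<open>2l\<close>. The bound tends to one with
  \<open>t\<close>. So if \<open>h(2l, 2l)\<close> were close to zero, \<open>h*\<close> of a \<open>6l\<close> by \<open>2l\<close> rectangle would be close to one,
  which contradicts the lower bound on \<open>h(2l, 6l)\<close>. Therefore \<open>h(2l, 2l)\<close>, and with it \<open>h(3l, 2l)\<close>,
  stays away from zero; so does \<open>h*\<close> by symmetry, and positive association gives all aspect ratios.
\<close>

section \<open>Planar connectivity\<close>

text \<open>The obstacle is the lack of self-duality: vacant star paths are dual to occupied
  nearest-neighbour paths, so no square is crossed with probability 1/2 for free, and the value of
  \<open>p_crit\<close> is unknown. Most of the geometry and all crossing estimates are therefore
  proved for an abstract pair \<open>T\<close>, \<open>T'\<close> of \<open>matching\<close> graphs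
  at a free parameter, and used for either order of the pair. The symmetries involved are
  translations, reflections and the exchange of coordinates, which both graphs share. A further
  difficulty is that two star paths may cross diagonally without a common site. Crossings in the
  same graph are only shown to come within one step of each other, which is enough to connect them.

  The three factors \<open>1 - \<surd>(1 - t)\<close> stem from three pairs of mirror-image
  increasing events; a crossing of a square, or of a rectangle one column wider, forces one event of
  the pair. The threshold 1/512 used later comes from \<open>16\<^sup>2 = 256\<close>:
  renormalisation replaces 256 times the probability by at most its square, so this quantity has to
  start at 1/2 or below.\<close>

definition star_adj :: "site \<Rightarrow> site \<Rightarrow> bool" where
  "star_adj x y \<longleftrightarrow> x \<noteq> y \<and> \<bar>fst x - fst y\<bar> \<le> 1 \<and> \<bar>snd x - snd y\<bar> \<le> 1"

definition matching :: "(site \<Rightarrow> site \<Rightarrow> bool) \<Rightarrow> (site \<Rightarrow> site \<Rightarrow> bool) \<Rightarrow> bool" where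
  "matching T T' \<longleftrightarrow> T = site_adj \<and> T' = star_adj \<or> T = star_adj \<and> T' = site_adj"

lemma matching_sym: "matching T T' \<Longrightarrow> matching T' T"
  by (auto simp: matching_def)

lemma matching_symp: "matching T T' \<Longrightarrow> T u v \<Longrightarrow> T v u"
  by (auto simp: matching_def site_adj_def star_adj_def)

lemma matching_steps:
  assumes "matching T T'" "T u v"
  shows "\<bar>fst v - fst u\<bar> \<le> 1" "\<bar>snd v - snd u\<bar> \<le> 1"
  using assms by (auto simp: matching_def site_adj_def star_adj_def)

lemma matching_site_adj: "matching T T' \<Longrightarrow> site_adj u v \<Longrightarrow> T u v"
  by (auto simp: matching_def site_adj_def star_adj_def prod_eq_iff)

definition rbox :: "int \<Rightarrow> int \<Rightarrow> int \<Rightarrow> int \<Rightarrow> site set" where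
  "rbox a b c d = {a..b} \<times> {c..d}"

lemma mem_rbox: "x \<in> rbox a b c d \<longleftrightarrow> a \<le> fst x \<and> fst x \<le> b \<and> c \<le> snd x \<and> snd x \<le> d"
  by (cases x) (auto simp: rbox_def)

lemma finite_rbox [simp, intro]: "finite (rbox a b c d)"
  by (simp add: rbox_def)

section \<open>Connectivity inside a set of sites\<close>

text \<open>Paths are handled through the set they run in: events depend on that set only, and
  enlarging it by \<open>conn_mono\<close> replaces surgery on lists. The list form used by the
  basic definitions is recovered in \<open>conn_iff_walk\<close>.\<close>

inductive conn :: "(site \<Rightarrow> site \<Rightarrow> bool) \<Rightarrow> site set \<Rightarrow> site \<Rightarrow> site \<Rightarrow> bool"
  for T S x where
  start: "x \<in> S \<Longrightarrow> conn T S x x"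
| step: "conn T S x u \<Longrightarrow> T u v \<Longrightarrow> v \<in> S \<Longrightarrow> conn T S x v"

lemma conn_mem: assumes "conn T S x y" shows "x \<in> S" "y \<in> S"
  using assms by (induction) auto

lemma conn_mono: "conn T S x y \<Longrightarrow> S \<subseteq> S' \<Longrightarrow> conn T S' x y"
  by (induction rule: conn.induct) (auto intro: conn.intros)

lemma conn_trans: assumes "conn T S y z" "conn T S x y" shows "conn T S x z"
  using assms by (induction) (auto intro: conn.intros)

lemma conn_trans': "conn T S x y \<Longrightarrow> conn T S y z \<Longrightarrow> conn T S x z"
  by (rule conn_trans)

lemma conn_edge: "T u v \<Longrightarrow> u \<in> S \<Longrightarrow> v \<in> S \<Longrightarrow> conn T S u v"
  by (blast intro: conn.intros)

lemma conn_sym: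
  assumes "\<And>u v. T u v \<Longrightarrow> T v u" "conn T S x y" shows "conn T S y x"
  using assms(2)
proof induction
  case (step u v)
  have "u \<in> S" using step conn_mem by blast
  with step assms(1) have "conn T S v u" by (intro conn_edge) auto
  with step show ?case using conn_trans' by blast
qed (auto intro: conn.start)

lemma matching_conn_sym: "matching T T' \<Longrightarrow> conn T S x y \<Longrightarrow> conn T S y x"
  using conn_sym matching_symp by metis

lemma conn_map:
  assumes "\<And>u v. T u v \<Longrightarrow> T' (\<phi> u) (\<phi> v)" "conn T S x y"
  shows "conn T' (\<phi> ` S) (\<phi> x) (\<phi> y)"
  using assms(2) by induction (auto intro: conn.intros assms(1))

text \<open>A set \<open>P\<close> that is reachable from \<open>x\<close> within itself plays the
  role of a path: any of its sites can be chosen as a turning point without leaving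
  \<open>P\<close>.\<close>

lemma conn_path_set:
  assumes "conn T S x y"
  obtains P where "P \<subseteq> S" "conn T P x y" "\<And>z. z \<in> P \<Longrightarrow> conn T P x z"
proof -
  have "\<exists>P\<subseteq>S. conn T P x y \<and> (\<forall>z\<in>P. conn T P x z)"
    using assms
  proof induction
    case start
    then show ?case by (intro exI[of _ "{x}"]) (auto intro: conn.start)
  next
    case (step u v)
    then obtain P where P: "P \<subseteq> S" "conn T P x u" "\<forall>z\<in>P. conn T P x z" by blast
    have *: "conn T (insert v P) x z" if "z \<in> P" for z
      using P(3) that conn_mono[of T P x z "insert v P"] by blast
    moreover have "conn T (insert v P) x v"
      using *[of u] P(2) conn_mem step by (blast intro: conn.step)
    ultimately show ?case using P step by (intro exI[of _ "insert v P"]) auto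
  qed
  then show thesis using that by blast
qed

lemma conn_first_hit:
  assumes "conn T S x y" "y \<in> Z"
  obtains z where "z \<in> Z" "z \<in> S" "conn T (insert z (S - Z)) x z"
proof -
  have "conn T (S - Z) x y \<or> (\<exists>z\<in>Z \<inter> S. conn T (insert z (S - Z)) x z)"
    using assms(1)
  proof induction
    case start
    then show ?case by (auto intro: conn.start)
  next
    case (step u v)
    show ?case
    proof (cases "conn T (S - Z) x u")
      case True
      show ?thesis
      proof (cases "v \<in> Z")
        case True
        have "conn T (insert v (S - Z)) x u" using \<open>conn T (S - Z) x u\<close> conn_mono by blast
        then have "conn T (insert v (S - Z)) x v" using step by (blast intro: conn.step)
        then show ?thesis using True step by blast
      next
        case False
        then show ?thesis using True step by (blast intro: conn.step)
      qed
    qed (use step in blast)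
  qed
  then show thesis using that assms(2) conn_mem by blast
qed

text \<open>A discrete intermediate value theorem: a function that grows by at most 1 per step
  cannot jump over the level \<open>k\<close>. Stopping at the first visit keeps the earlier part
  strictly below \<open>k\<close>.\<close>

lemma conn_first_level:
  fixes f :: "site \<Rightarrow> int"
  assumes "\<And>u v. T u v \<Longrightarrow> f v \<le> f u + 1" "conn T S x y" "f x \<le> k" "k \<le> f y"
  obtains z where "z \<in> S" "f z = k" "conn T (insert z {u \<in> S. f u < k}) x z"
proof -
  let ?B = "{u \<in> S. f u < k}"
  have "conn T ?B x y \<or> (\<exists>z\<in>S. f z = k \<and> conn T (insert z ?B) x z)"
    using assms(2)
  proof induction
    case start
    then show ?case using assms(3) by (cases "f x = k") (auto intro: conn.start)
  next
    case (step u v)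
    show ?case
    proof (cases "conn T ?B x u")
      case True
      then have "u \<in> ?B" by (rule conn_mem(2))
      then have fv: "f v \<le> k" using assms(1)[OF step(2)] by auto
      have "conn T (insert v ?B) x u" using True conn_mono by blast
      then have *: "conn T (insert v ?B) x v" using step(2) by (blast intro: conn.step)
      show ?thesis
      proof (cases "f v = k")
        case False
        then have "insert v ?B = ?B" using fv step(3) by auto
        then show ?thesis using * by simp
      qed (use * step(3) in blast)
    qed (use step in blast)
  qed
  moreover have "\<not> conn T ?B x y" using conn_mem(2)[of T ?B x y] assms(4) by auto
  ultimately show thesis using that by blast
qed

text \<open>Reversing the path and replacing \<open>f\<close> by \<open>- f\<close> turns the first
  visit to a level into the last one.\<close>

lemma conn_last_level:
  fixes f :: "site \<Rightarrow> int"
  assumes "\<And>u v. T u v \<Longrightarrow> T v u" "\<And>u v. T u v \<Longrightarrow> f v \<le> f u + 1"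
    and "conn T S x y" "f x \<le> k" "k \<le> f y"
  obtains z where "z \<in> S" "f z = k" "conn T S x z" "conn T (insert z {u \<in> S. k < f u}) z y"
proof -
  have yx: "conn T S y x" using conn_sym assms by metis
  have "- f v \<le> - f u + 1" if "T u v" for u v
    using assms(2)[OF assms(1)[OF that]] by simp
  moreover have "- f y \<le> - k" "- k \<le> - f x" using assms by auto
  ultimately obtain z where z: "z \<in> S" "- f z = - k" "conn T (insert z {u \<in> S. - f u < - k}) y z"
    using conn_first_level[of T "\<lambda>u. - f u", OF _ yx] by blast
  have "conn T (insert z {u \<in> S. k < f u}) z y"
    using conn_sym[OF assms(1) z(3)] by simp
  moreover have "conn T S z y" using conn_mono[OF calculation] z by blast
  then have "conn T S y z" using conn_sym assms by metis
  then have "conn T S x z" using assms(3) conn_trans' by metis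
  ultimately show thesis using that z by auto
qed

lemma conn_iff_walk:
  "conn T S x y \<longleftrightarrow> (\<exists>xs. xs \<noteq> [] \<and> successively T xs \<and> set xs \<subseteq> S \<and> hd xs = x \<and> last xs = y)"
proof
  assume "conn T S x y"
  then show "\<exists>xs. xs \<noteq> [] \<and> successively T xs \<and> set xs \<subseteq> S \<and> hd xs = x \<and> last xs = y"
  proof induction
    case start
    then show ?case by (intro exI[of _ "[x]"]) auto
  next
    case (step u v)
    then obtain xs where "xs \<noteq> []" "successively T xs" "set xs \<subseteq> S" "hd xs = x" "last xs = u" by blast
    then show ?case using step
      by (intro exI[of _ "xs @ [v]"]) (auto simp: successively_append_iff)
  qed
next
  assume "\<exists>xs. xs \<noteq> [] \<and> successively T xs \<and> set xs \<subseteq> S \<and> hd xs = x \<and> last xs = y"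
  then obtain xs where "xs \<noteq> []" "successively T xs" "set xs \<subseteq> S" "hd xs = x" "last xs = y" by blast
  then show "conn T S x y"
  proof (induction xs arbitrary: y rule: rev_induct)
    case (snoc v xs)
    show ?case
    proof (cases "xs = []")
      case True
      then show ?thesis using snoc by (auto intro: conn.start)
    next
      case False
      then have "conn T S x (last xs)" using snoc by (auto simp: successively_append_iff)
      then show ?thesis using snoc False by (auto simp: successively_append_iff intro: conn.step)
    qed
  qed auto
qed

section \<open>Transversal crossings in matching graphs must meet\<close>

lemma even_card_changes:
  "even (card {k. k < N \<and> P k \<noteq> P (Suc k)}) \<longleftrightarrow> (P 0 = P N)" for P :: "nat \<Rightarrow> bool"
proof (induction N)
  case (Suc N)
  have eq: "{k. k < Suc N \<and> P k \<noteq> P (Suc k)} =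
      (if P N \<noteq> P (Suc N) then insert N else id) {k. k < N \<and> P k \<noteq> P (Suc k)}"
    by (auto simp: less_Suc_eq)
  have "finite {k. k < N \<and> P k \<noteq> P (Suc k)}" by auto
  with Suc show ?case unfolding eq by (auto)
qed auto

text \<open>
  The number of steps of the star path leaving row \<open>j\<close> upwards strictly to the left of \<open>(i, j)\<close>
  keeps its parity along any nearest-neighbour path that avoids the star path.
\<close>

lemma crossing_site_star:
  assumes X: "X \<subseteq> rbox a b c d" "conn site_adj X x1 x2" "fst x1 = a" "fst x2 = b"
    and Y: "Y \<subseteq> rbox a b c d" "conn star_adj Y y1 y2" "snd y1 = c" "snd y2 = d"
  shows "X \<inter> Y \<noteq> {}"
proof
  assume disj: "X \<inter> Y = {}"
  obtain ys where ys: "ys \<noteq> []" "successively star_adj ys" "set ys \<subseteq> Y" "hd ys = y1" "last ys = y2"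
    using Y(2) unfolding conn_iff_walk by blast
  \<comment> \<open>The star path is prolonged by one site above the box, so that it also leaves the
    top row \<open>d\<close> upwards.\<close>
  define g where "g k = (if k < length ys then ys ! k else (fst y2, d + 1))" for k
  define N where "N = length ys"
  have g0: "g 0 = y1" using ys by (simp add: g_def hd_conv_nth)
  have gN: "g N = (fst y2, d + 1)" by (simp add: g_def N_def)
  have gY: "g k \<in> Y" if "k < N" for k using that ys by (auto simp: g_def N_def)
  have gstar: "star_adj (g k) (g (Suc k))" if "k < N" for k
  proof (cases "Suc k < N")
    case True
    then show ?thesis using ys successively_nth[of star_adj ys k] by (auto simp: g_def N_def)
  next
    case False
    then have "k = N - 1" using that by simp
    then show ?thesis using that ys Y(4) False
      by (auto simp: g_def N_def last_conv_nth star_adj_def prod_eq_iff)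
  qed
  have gbox: "a \<le> fst (g k) \<and> fst (g k) \<le> b \<and> c \<le> snd (g k)" if "k \<le> N" for k
  proof (cases "k < N")
    case True then show ?thesis using gY Y(1) mem_rbox by blast
  next
    case False
    have "y2 \<in> rbox a b c d" using Y conn_mem by blast
    then show ?thesis using False that gN by (auto simp: mem_rbox)
  qed
  have gX: "g k \<noteq> u" if "u \<in> X" "k \<le> N" for u k
  proof (cases "k < N")
    case True then show ?thesis using that gY disj by blast
  next
    case False
    then have "g k = (fst y2, d + 1)" using that gN by simp
    then show ?thesis using that X(1) mem_rbox by fastforce
  qed
  \<comment> \<open>These are the steps between the row of \<open>u\<close> and the next row, in
    either direction, whose end in the row of \<open>u\<close> lies to the left of \<open>u\<close>:
    the intersections with a leftward ray drawn just above that row.\<close>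
  define F where "F u = {k. k < N \<and>
      (snd (g k) = snd u \<and> snd (g (Suc k)) = snd u + 1 \<and> fst (g k) < fst u \<or>
       snd (g (Suc k)) = snd u \<and> snd (g k) = snd u + 1 \<and> fst (g (Suc k)) < fst u)}" for u :: site
  have finF: "finite (F u)" for u by (simp add: F_def)
  have vert: "even (card (F (i, j))) \<longleftrightarrow> even (card (F (i, j + 1)))"
    if u: "(i, j) \<in> X" "(i, j + 1) \<in> X" for i j
  proof -
    \<comment> \<open>Row \<open>j + 1\<close> to the left of column \<open>i\<close> is entered and
      left only through the steps counted for \<open>(i, j)\<close> and \<open>(i, j + 1)\<close>,
      since neither of these sites is on the star path. Both ends of the path lie in other rows, so
      the total number of such steps is even.\<close>
    define L where "L k \<longleftrightarrow> snd (g k) = j + 1 \<and> fst (g k) < i" for k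
    have "c \<le> j" "j + 1 \<le> d"
      using subsetD[OF X(1) u(1)] subsetD[OF X(1) u(2)] by (auto simp: mem_rbox)
    then have "L 0 = L N" using g0 gN Y(3) by (auto simp: L_def)
    then have "even (card {k. k < N \<and> L k \<noteq> L (Suc k)})" using even_card_changes by blast
    moreover have "{k. k < N \<and> L k \<noteq> L (Suc k)} = F (i, j) \<union> F (i, j + 1)"
    proof -
      have "L k \<noteq> L (Suc k) \<longleftrightarrow> k \<in> F (i, j) \<union> F (i, j + 1)" if k: "k < N" for k
      proof -
        have st: "\<bar>fst (g k) - fst (g (Suc k))\<bar> \<le> 1" "\<bar>snd (g k) - snd (g (Suc k))\<bar> \<le> 1"
          using gstar[OF k] by (auto simp: star_adj_def)
        have ne: "g k \<noteq> (i, j)" "g k \<noteq> (i, j + 1)" "g (Suc k) \<noteq> (i, j)" "g (Suc k) \<noteq> (i, j + 1)"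
          using gX u k by auto
        obtain p q p' q' where gk: "g k = (p, q)" "g (Suc k) = (p', q')" by fastforce
        have "(q = j + 1 \<and> p < i) \<noteq> (q' = j + 1 \<and> p' < i) \<longleftrightarrow>
            (q = j \<and> q' = j + 1 \<and> p < i \<or> q' = j \<and> q = j + 1 \<and> p' < i) \<or>
            (q = j + 1 \<and> q' = j + 1 + 1 \<and> p < i \<or> q' = j + 1 \<and> q = j + 1 + 1 \<and> p' < i)"
          using st ne unfolding gk by (smt (verit) fst_conv snd_conv)
        then show ?thesis using k
          unfolding L_def F_def by (simp only: gk fst_conv snd_conv mem_Collect_eq Un_iff simp_thms)
      qed
      moreover have "F (i, j) \<union> F (i, j + 1) \<subseteq> {k. k < N}" by (auto simp: F_def)
      ultimately show ?thesis by blast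
    qed
    moreover have "F (i, j) \<inter> F (i, j + 1) = {}" by (auto simp: F_def)
    ultimately show ?thesis using finF by (simp add: card_Un_disjoint)
  qed
  have horiz: "F (i, j) = F (i + 1, j)" if "(i, j) \<in> X" for i j
  proof -
    have "g k \<noteq> (i, j) \<and> g (Suc k) \<noteq> (i, j)" if "k < N" for k
      using gX \<open>(i, j) \<in> X\<close> that by auto
    then show ?thesis unfolding F_def prod_eq_iff by force
  qed
  have inv: "even (card (F x2)) \<longleftrightarrow> even (card (F x1))"
    using X(2)
  proof induction
    case (step u v)
    obtain i j where u: "u = (i, j)" by (cases u)
    have uX: "(i, j) \<in> X" using step conn_mem u by blast
    obtain i' j' where v: "v = (i', j')" by (cases v)
    have "\<bar>i - i'\<bar> + \<bar>j - j'\<bar> = 1" using step u v by (simp add: site_adj_def)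
    then consider "i' = i + 1 \<and> j' = j" | "i = i' + 1 \<and> j' = j" | "i = i' \<and> j' = j + 1" | "i = i' \<and> j = j' + 1"
      by linarith
    then have "even (card (F v)) \<longleftrightarrow> even (card (F u))"
    proof cases
      case 1 then show ?thesis using horiz uX u v by simp
    next
      case 2 then show ?thesis using horiz[of i' j'] step(3) u v by simp
    next
      case 3 then show ?thesis using vert[of i j] step(3) uX u v by simp
    next
      case 4 then show ?thesis using vert[of i' j'] step(3) uX u v by simp
    qed
    then show ?case using step by simp
  qed auto
  have "\<not> fst (g k) < fst x1" if "k \<le> N" for k using gbox[OF that] X(3) by simp
  then have "k \<notin> F x1" for k by (cases "k < N") (auto simp: F_def)
  then have "F x1 = {}" by blast
  then have "even (card (F x2))" using inv by simp
  have x2: "x2 \<in> X" using X conn_mem by blast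
  \<comment> \<open>In the last column the whole row lies to the left, so the count at
    \<open>x2\<close> is the number of all changes between rows up to \<open>snd x2\<close> and rows
    above. The star path starts below and ends above, hence this number is odd, whereas it was zero
    in the first column.\<close>
  define R where "R k \<longleftrightarrow> snd (g k) \<le> snd x2" for k
  have "c \<le> snd x2" "snd x2 \<le> d" using subsetD[OF X(1) x2] by (auto simp: mem_rbox)
  then have "R 0 \<noteq> R N" using g0 gN Y(3) by (auto simp: R_def)
  then have "odd (card {k. k < N \<and> R k \<noteq> R (Suc k)})" using even_card_changes by blast
  moreover have "R k \<noteq> R (Suc k) \<longleftrightarrow> k \<in> F x2" if k: "k < N" for k
  proof -
    have st: "\<bar>snd (g k) - snd (g (Suc k))\<bar> \<le> 1" using gstar[OF k] by (auto simp: star_adj_def)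
    have ne: "g k \<noteq> x2" "g (Suc k) \<noteq> x2" using gX x2 k by auto
    have "fst (g k) \<le> fst x2" "fst (g (Suc k)) \<le> fst x2" using gbox k X(4) by auto
    then show ?thesis using st ne k unfolding R_def F_def prod_eq_iff by auto
  qed
  then have "{k. k < N \<and> R k \<noteq> R (Suc k)} = F x2" by (auto simp: F_def)
  ultimately show False using \<open>even (card (F x2))\<close> by simp
qed

lemma conn_swap:
  assumes "matching T T'" "conn T S x y"
  shows "conn T (prod.swap ` S) (prod.swap x) (prod.swap y)"
  by (rule conn_map[OF _ assms(2)])
    (use assms(1) in \<open>auto simp: matching_def site_adj_def star_adj_def add.commute\<close>)

lemma swap_rbox: "prod.swap ` rbox a b c d = rbox c d a b"
  by (simp add: rbox_def product_swap)

lemma crossing_meets: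
  assumes m: "matching T T'"
    and X: "X \<subseteq> rbox a b c d" "conn T X x1 x2" "fst x1 = a" "fst x2 = b"
    and Y: "Y \<subseteq> rbox a b c d" "conn T' Y y1 y2" "snd y1 = c" "snd y2 = d"
  shows "X \<inter> Y \<noteq> {}"
proof (cases "T = site_adj")
  case True
  then have "T' = star_adj" using m by (auto simp: matching_def fun_eq_iff star_adj_def site_adj_def)
  then show ?thesis using crossing_site_star X Y True by blast
next
  case False
  then have T: "T = star_adj" "T' = site_adj" using m by (auto simp: matching_def)
  have "prod.swap ` Y \<inter> prod.swap ` X \<noteq> {}"
  proof (rule crossing_site_star)
    show "prod.swap ` Y \<subseteq> rbox c d a b" "prod.swap ` X \<subseteq> rbox c d a b"
      using image_mono[OF Y(1), of prod.swap] image_mono[OF X(1), of prod.swap] swap_rbox by auto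
    show "conn site_adj (prod.swap ` Y) (prod.swap y1) (prod.swap y2)"
      "conn star_adj (prod.swap ` X) (prod.swap x1) (prod.swap x2)"
      using conn_swap[OF m X(2)] conn_swap[OF matching_sym[OF m] Y(2)] T by auto
  qed (use X Y in auto)
  then show ?thesis by auto
qed

lemma conn_column:
  assumes "matching T T'" "\<And>k. i \<le> k \<Longrightarrow> k \<le> j \<Longrightarrow> (x, k) \<in> S" "i \<le> j"
  shows "conn T S (x, i) (x, j)"
  using assms(3,2)
proof (induction j rule: int_ge_induct)
  case base
  then show ?case by (auto intro: conn.start)
next
  case (step j)
  then have "conn T S (x, i) (x, j)" by simp
  moreover have "T (x, j) (x, j + 1)"
    using matching_site_adj[OF assms(1)] by (simp add: site_adj_def)
  moreover have "(x, j + 1) \<in> S" using step by simp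
  ultimately show ?case by (rule conn.step)
qed

text \<open>The box is widened by one column on each side. There \<open>X\<close> is prolonged
  horizontally by one site, and \<open>Y\<close> vertically to the bottom or the top where
  necessary; the position of the ends keeps the prolongations disjoint, which reduces the claim to
  \<open>crossing_meets\<close>.\<close>

lemma crossing_meets_ends:
  assumes m: "matching T T'"
    and X: "X \<subseteq> rbox a b c d" "conn T X x1 x2" "fst x1 = a" "fst x2 = b"
    and Y: "Y \<subseteq> rbox a b c d" "conn T' Y y1 y2"
    and s: "snd y1 = c \<or> fst y1 = a \<and> snd y1 < snd x1"
    and t: "snd y2 = d \<or> fst y2 = b \<and> snd x2 < snd y2"
  shows "X \<inter> Y \<noteq> {}"
proof
  assume disj: "X \<inter> Y = {}"
  have x: "x1 \<in> X" "x2 \<in> X" "y1 \<in> Y" "y2 \<in> Y" using X Y conn_mem by blast+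
  have m': "matching T' T" using m matching_sym by blast
  define X' where "X' = X \<union> {(a - 1, snd x1), (b + 1, snd x2)}"
  define L where "L = (if snd y1 = c then {} else {a - 1} \<times> {c..snd y1})"
  define R where "R = (if snd y2 = d then {} else {b + 1} \<times> {snd y2..d})"
  have "conn T X' x1 x2" using X(2) conn_mono X'_def by blast
  moreover have "conn T X' (a - 1, snd x1) x1"
    using x X m by (intro conn_edge matching_site_adj[OF m]) (auto simp: X'_def site_adj_def)
  moreover have "conn T X' x2 (b + 1, snd x2)"
    using x X m by (intro conn_edge matching_site_adj[OF m]) (auto simp: X'_def site_adj_def)
  ultimately have X'c: "conn T X' (a - 1, snd x1) (b + 1, snd x2)" using conn_trans' by metis
  define Y' where "Y' = Y \<union> L \<union> R"
  have Y'12: "conn T' Y' y1 y2" using Y(2) conn_mono Y'_def by blast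
  obtain z1 where z1: "snd z1 = c" "conn T' Y' z1 y1"
  proof (cases "snd y1 = c")
    case True
    then show ?thesis using that[of y1] Y'12 conn_mem conn.start by metis
  next
    case False
    then have L: "L = {a - 1} \<times> {c..snd y1}" by (simp add: L_def)
    have "c \<le> snd y1" using subsetD[OF Y(1) x(3)] by (simp add: mem_rbox)
    then have "conn T' Y' (a - 1, c) (a - 1, snd y1)"
      by (intro conn_column[OF m']) (auto simp: Y'_def L)
    moreover have "conn T' Y' (a - 1, snd y1) y1"
      using x s False \<open>c \<le> snd y1\<close>
      by (intro conn_edge matching_site_adj[OF m']) (auto simp: Y'_def L site_adj_def)
    ultimately show ?thesis using that[of "(a - 1, c)"] conn_trans' by (metis snd_conv)
  qed
  obtain z2 where z2: "snd z2 = d" "conn T' Y' y2 z2"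
  proof (cases "snd y2 = d")
    case True
    then show ?thesis using that[of y2] Y'12 conn_mem conn.start by metis
  next
    case False
    then have R: "R = {b + 1} \<times> {snd y2..d}" by (simp add: R_def)
    have "snd y2 \<le> d" using subsetD[OF Y(1) x(4)] by (simp add: mem_rbox)
    then have "conn T' Y' (b + 1, snd y2) (b + 1, d)"
      by (intro conn_column[OF m']) (auto simp: Y'_def R)
    moreover have "conn T' Y' y2 (b + 1, snd y2)"
      using x t False \<open>snd y2 \<le> d\<close>
      by (intro conn_edge matching_site_adj[OF m']) (auto simp: Y'_def R site_adj_def)
    ultimately show ?thesis using that[of "(b + 1, d)"] conn_trans' by (metis snd_conv)
  qed
  have "conn T' Y' z1 z2" using z1 z2 Y'12 conn_trans' by metis
  moreover have "X' \<subseteq> rbox (a - 1) (b + 1) c d"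
    using X(1) subsetD[OF X(1) x(1)] subsetD[OF X(1) x(2)]
    by (force simp: X'_def mem_rbox)
  moreover have "Y' \<subseteq> rbox (a - 1) (b + 1) c d"
    using subsetD[OF Y(1) x(3)] subsetD[OF Y(1) x(4)] subsetD[OF X(1) x(1)] subsetD[OF X(1) x(2)]
    using Y(1) by (force simp: Y'_def L_def R_def mem_rbox split: if_splits)
  ultimately have "X' \<inter> Y' \<noteq> {}"
    using crossing_meets[OF m _ X'c _ _ _ \<open>conn T' Y' z1 z2\<close>] z1 z2 by simp
  moreover have "X' \<inter> Y' = {}"
  proof -
    have in_box: "a \<le> fst u \<and> fst u \<le> b" if "u \<in> X \<union> Y" for u
      using that X(1) Y(1) mem_rbox by blast
    have "u \<notin> Y'" if "u \<in> X" for u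
      using in_box[of u] that disj by (auto simp: Y'_def L_def R_def split: if_splits)
    moreover have "(a - 1, snd x1) \<notin> Y'" "(b + 1, snd x2) \<notin> Y'"
      using in_box[of "(a - 1, snd x1)"] in_box[of "(b + 1, snd x2)"] s t in_box[of x1] in_box[of x2] x
      by (auto simp: Y'_def L_def R_def split: if_splits)
    ultimately show ?thesis by (auto simp: X'_def)
  qed
  ultimately show False by simp
qed

definition nbhd :: "(site \<Rightarrow> site \<Rightarrow> bool) \<Rightarrow> site set \<Rightarrow> site set" where
  "nbhd T S = {v. \<exists>u\<in>S. u = v \<or> T u v}"

lemma nbhd_superset: "S \<subseteq> nbhd T S"
  by (auto simp: nbhd_def)

lemma nbhd_mono: "S \<subseteq> S' \<Longrightarrow> nbhd T S \<subseteq> nbhd T S'"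
  by (auto simp: nbhd_def)

lemma matching_detour:
  assumes m: "matching T T'" and uv: "T u v" and box: "u \<in> rbox a b c d" "v \<in> rbox a b c d"
  shows "T' u v \<or> (\<exists>w\<in>rbox a b c d. T' u w \<and> T' w v \<and> T u w \<and> T w v)"
proof (cases "T' u v")
  case False
  then have T: "T = star_adj" "T' = site_adj"
    using m uv by (auto simp: matching_def site_adj_def star_adj_def)
  have "fst u \<noteq> fst v" "snd u \<noteq> snd v"
    "\<bar>fst u - fst v\<bar> = 1" "\<bar>snd u - snd v\<bar> = 1"
    using False uv unfolding T site_adj_def star_adj_def prod_eq_iff by linarith+
  then show ?thesis using box unfolding T
    by (intro disjI2 bexI[of _ "(fst u, snd v)"]) (auto simp: mem_rbox site_adj_def star_adj_def prod_eq_iff)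
qed auto

text \<open>A diagonal step can be replaced by two steps through a corner of the same unit square,
  and this corner is a neighbour of the starting site. So a \<open>T\<close> path thickened by one
  step contains a \<open>T'\<close> path.\<close>

lemma conn_nbhd:
  assumes m: "matching T T'" and S: "S \<subseteq> rbox a b c d" "conn T S x y"
  shows "conn T' (nbhd T S \<inter> rbox a b c d) x y"
  using S(2)
proof induction
  case start
  then show ?case using S nbhd_superset by (auto intro!: conn.start)
next
  case (step u v)
  let ?N = "nbhd T S \<inter> rbox a b c d"
  have u: "u \<in> S" using step conn_mem by blast
  then have uv: "u \<in> ?N" "v \<in> ?N" using step S nbhd_superset by blast+
  have "conn T' ?N u v"
    using matching_detour[OF m step(2), of a b c d]
  proof
    assume "\<exists>w\<in>rbox a b c d. T' u w \<and> T' w v \<and> T u w \<and> T w v"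
    then obtain w where w: "w \<in> rbox a b c d" "T' u w" "T' w v" "T u w" by blast
    then have "w \<in> ?N" using u by (auto simp: nbhd_def)
    then show ?thesis using w uv by (meson conn_edge conn_trans)
  qed (use uv in \<open>auto intro: conn_edge\<close>)
  then show ?case using step conn_trans' by metis
qed

text \<open>The thickened \<open>X\<close> contains a crossing in the other graph, which
  \<open>Y\<close> cannot avoid.\<close>

lemma crossing_near:
  assumes m: "matching T T'"
    and X: "X \<subseteq> rbox a b c d" "conn T X x1 x2" "fst x1 = a" "fst x2 = b"
    and Y: "Y \<subseteq> rbox a b c d" "conn T Y y1 y2"
    and s: "snd y1 = c \<or> fst y1 = a \<and> snd y1 < snd x1"
    and t: "snd y2 = d \<or> fst y2 = b \<and> snd x2 < snd y2"
  shows "nbhd T X \<inter> Y \<noteq> {}"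
proof -
  have "nbhd T X \<inter> rbox a b c d \<inter> Y \<noteq> {}"
    using s t by (intro crossing_meets_ends[OF matching_sym[OF m] _ conn_nbhd[OF m X(1,2)] X(3,4) Y]) auto
  then show ?thesis by blast
qed

text \<open>Coming within one step suffices to connect two paths of the same graph. This is the form
  in which crossings are glued together.\<close>

lemma crossing_conn:
  assumes m: "matching T T'"
    and X: "X \<subseteq> rbox a b c d" "conn T X x1 x2" "fst x1 = a" "fst x2 = b"
    and Y: "Y \<subseteq> rbox a b c d" "conn T Y y1 y2"
    and s: "snd y1 = c \<or> fst y1 = a \<and> snd y1 < snd x1"
    and t: "snd y2 = d \<or> fst y2 = b \<and> snd x2 < snd y2"
  shows "conn T (X \<union> Y) x1 y1"
proof -
  obtain P where P: "P \<subseteq> X" "conn T P x1 x2" "\<And>z. z \<in> P \<Longrightarrow> conn T P x1 z"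
    using conn_path_set[OF X(2)] by blast
  obtain Q where Q: "Q \<subseteq> Y" "conn T Q y1 y2" "\<And>z. z \<in> Q \<Longrightarrow> conn T Q y1 z"
    using conn_path_set[OF Y(2)] by blast
  have "nbhd T P \<inter> Q \<noteq> {}"
    using crossing_near[OF m _ P(2) X(3,4) _ Q(2) s t] P Q X Y by blast
  then obtain u v where uv: "u \<in> P" "v \<in> Q" "u = v \<or> T u v" by (auto simp: nbhd_def)
  have "conn T (X \<union> Y) x1 u" using P(3)[OF uv(1)] P(1) conn_mono by blast
  moreover have "conn T (X \<union> Y) u v"
    using uv P Q by (auto intro: conn_edge conn.start)
  moreover have "conn T (X \<union> Y) y1 v" using Q(3)[OF uv(2)] Q(1) conn_mono by blast
  ultimately show ?thesis using matching_conn_sym[OF m] conn_trans' by metis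
qed

section \<open>One of the two dual crossings exists\<close>

text \<open>
  Interior edges between \<open>A\<close> and \<open>C\<close> belong to two squares, so the number of such edges on the
  boundary is even; but the corner edge from \<open>(a, c)\<close> to \<open>(a + 1, c)\<close> is the only one.
\<close>

lemma sperner_parity:
  fixes A C :: "int \<Rightarrow> int \<Rightarrow> bool"
  assumes ab: "a \<le> b" "c \<le> d"
    and disj: "\<And>i j. \<not> (A i j \<and> C i j)"
    and square: "\<And>i j. a \<le> i \<Longrightarrow> i < b \<Longrightarrow> c \<le> j \<Longrightarrow> j < d \<Longrightarrow>
      even (of_bool (A i j \<and> C (i+1) j \<or> C i j \<and> A (i+1) j) +
            of_bool (A i (j+1) \<and> C (i+1) (j+1) \<or> C i (j+1) \<and> A (i+1) (j+1)) +
            of_bool (A i j \<and> C i (j+1) \<or> C i j \<and> A i (j+1)) +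
            (of_bool (A (i+1) j \<and> C (i+1) (j+1) \<or> C (i+1) j \<and> A (i+1) (j+1)) :: int))"
    and left: "\<And>j. c \<le> j \<Longrightarrow> j \<le> d \<Longrightarrow> \<not> A a j"
    and right: "\<And>j. c \<le> j \<Longrightarrow> j \<le> d \<Longrightarrow> \<not> C b j"
    and top: "\<And>i. a \<le> i \<Longrightarrow> i \<le> b \<Longrightarrow> \<not> A i d"
    and bottom: "\<And>i. a < i \<Longrightarrow> i \<le> b \<Longrightarrow> \<not> C i c" "A (a + 1) c" "C a c"
  shows False
proof -
  define h where "h i j = (of_bool (A i j \<and> C (i+1) j \<or> C i j \<and> A (i+1) j) :: int)" for i j
  define v where "v i j = (of_bool (A i j \<and> C i (j+1) \<or> C i j \<and> A i (j+1)) :: int)" for i j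
  have sq: "even (h i j + h i (j + 1) + v i j + v (i + 1) j)" if "a \<le> i" "i < b" "c \<le> j" "j < d" for i j
    using square[OF that] unfolding h_def v_def by simp
  have vsum: "even (h i c + h i k + (\<Sum>j\<in>{c..<k}. v i j) + (\<Sum>j\<in>{c..<k}. v (i + 1) j))"
    if "c \<le> k" "k \<le> d" "a \<le> i" "i < b" for i k
    using that(1,2)
  proof (induction k rule: int_ge_induct)
    case (step k)
    have "{c..<k + 1} = insert k {c..<k}" using step by auto
    then have s: "(\<Sum>j\<in>{c..<k+1}. v i' j) = v i' k + (\<Sum>j\<in>{c..<k}. v i' j)" for i' by simp
    show ?case using step sq[of i k] that unfolding s by simp presburger
  qed simp
  have hsum: "even ((\<Sum>i\<in>{a..<k}. h i c) + (\<Sum>i\<in>{a..<k}. h i d) + (\<Sum>j\<in>{c..<d}. v a j) + (\<Sum>j\<in>{c..<d}. v k j))"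
    if "a \<le> k" "k \<le> b" for k
    using that
  proof (induction k rule: int_ge_induct)
    case (step k)
    have "{a..<k + 1} = insert k {a..<k}" using step by auto
    then have s: "(\<Sum>i\<in>{a..<k+1}. h i j) = h k j + (\<Sum>i\<in>{a..<k}. h i j)" for j by simp
    show ?case using step vsum[of d k] ab unfolding s by simp presburger
  qed simp
  have "v a j = 0" if "j \<in> {c..<d}" for j using left that by (simp add: v_def)
  moreover have "v b j = 0" if "j \<in> {c..<d}" for j using right that by (simp add: v_def)
  moreover have "h i d = 0" if "i \<in> {a..<b}" for i using top that by (simp add: h_def)
  moreover have "(\<Sum>i\<in>{a..<b}. h i c) = 1"
  proof -
    have "\<not> C b c" using right ab by simp
    then have "a < b" using bottom(3) ab by (cases "a = b") auto
    then have "{a..<b} = insert a {a + 1..<b}" by auto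
    moreover have "h i c = 0" if "i \<in> {a + 1..<b}" for i using bottom(1) that by (simp add: h_def)
    moreover have "h a c = 1" using bottom(2,3) by (simp add: h_def)
    ultimately show ?thesis by simp
  qed
  ultimately show False using hsum[of b] ab by simp
qed

text \<open>The variables \<open>o\<close> mark the occupied corners of a unit square and
  \<open>c\<close> those reached by the occupied exploration. Around the square, every run of
  consecutive occupied corners is reached either entirely or not at all. A reached run bordered by
  vacant corners contributes its two ends, so the number of sides joining a reached corner to a
  vacant one is even.\<close>

lemma sperner_square:
  assumes "c1 \<longrightarrow> o1" "c2 \<longrightarrow> o2" "c3 \<longrightarrow> o3" "c4 \<longrightarrow> o4"
    and "c1 \<and> o2 \<longrightarrow> c2" "c2 \<and> o1 \<longrightarrow> c1" "c1 \<and> o3 \<longrightarrow> c3" "c3 \<and> o1 \<longrightarrow> c1"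
    and "c2 \<and> o4 \<longrightarrow> c4" "c4 \<and> o2 \<longrightarrow> c2" "c3 \<and> o4 \<longrightarrow> c4" "c4 \<and> o3 \<longrightarrow> c3"
  shows "even (of_bool (\<not> o1 \<and> c2 \<or> c1 \<and> \<not> o2) + of_bool (\<not> o3 \<and> c4 \<or> c3 \<and> \<not> o4) +
      of_bool (\<not> o1 \<and> c3 \<or> c1 \<and> \<not> o3) + (of_bool (\<not> o2 \<and> c4 \<or> c2 \<and> \<not> o4) :: int))"
proof -
  have parity: "even (of_bool p + of_bool q + of_bool r + (of_bool s :: int)) \<longleftrightarrow> ((p \<longleftrightarrow> q) \<longleftrightarrow> (r \<longleftrightarrow> s))"
    for p q r s by (cases p; cases q; cases r; cases s) simp_all
  show ?thesis unfolding parity using assms by argo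
qed

text \<open>Both explorations, of occupied sites from the left and of vacant sites from the bottom,
  are run at once. If neither reached the opposite side, the sides joining the two explored regions
  would violate \<open>sperner_parity\<close>.\<close>

lemma crossing_exists_site_star:
  assumes ab: "a \<le> b" "c \<le> d"
  obtains x y where "conn site_adj (S \<inter> rbox a b c d) x y" "fst x = a" "fst y = b"
  | x y where "conn star_adj (rbox a b c d - S) x y" "snd x = c" "snd y = d"
proof -
  let ?B = "rbox a b c d"
  \<comment> \<open>An additional occupied column on the left and an additional vacant row at the
    bottom are the seeds of the explorations. Their common corner belongs to the column, which
    produces the single boundary edge between the regions.\<close>
  define oc where "oc i j \<longleftrightarrow> i = a - 1 \<or> j \<noteq> c - 1 \<and> (i, j) \<in> S" for i j
  define C where "C i j \<longleftrightarrow> i = a - 1 \<or> (\<exists>x. fst x = a \<and> conn site_adj (S \<inter> ?B) x (i, j))" for i j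
  define A where "A i j \<longleftrightarrow> i \<ge> a \<and> (j = c - 1 \<or> (\<exists>x. snd x = c \<and> conn star_adj (?B - S) x (i, j)))" for i j
  have A_vac: "\<not> oc i j" if Aij: "A i j" for i j
  proof (cases "j = c - 1")
    case False
    then have "\<exists>x. conn star_adj (?B - S) x (i, j)" using Aij False unfolding A_def by blast
    then obtain x where "conn star_adj (?B - S) x (i, j)" ..
    then have "(i, j) \<in> ?B - S" by (rule conn_mem)
    then show ?thesis by (simp add: oc_def mem_rbox)
  qed (use Aij in \<open>simp add: oc_def A_def\<close>)
  have C_oc: "oc i j" if Cij: "C i j" for i j
  proof (cases "i = a - 1")
    case False
    then have "\<exists>x. conn site_adj (S \<inter> ?B) x (i, j)" using Cij False unfolding C_def by blast
    then obtain x where "conn site_adj (S \<inter> ?B) x (i, j)" ..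
    then have "(i, j) \<in> S \<inter> ?B" by (rule conn_mem)
    then show ?thesis by (simp add: oc_def mem_rbox)
  qed (simp add: oc_def)
  have C_step: "C i' j'" if Cij: "C i j" and that: "oc i' j'" "\<bar>i - i'\<bar> + \<bar>j - j'\<bar> = 1"
    "a - 1 \<le> i'" "i' \<le> b" "c - 1 \<le> j'" "j' \<le> d" for i j i' j'
  proof (cases "i' = a - 1")
    case False
    then have S: "(i', j') \<in> S \<inter> ?B" using that by (auto simp: oc_def mem_rbox)
    show ?thesis
    proof (cases "i = a - 1")
      case True
      then have "i' = a" using that False by auto
      then show ?thesis using S conn.start[of "(i', j')" "S \<inter> ?B" site_adj] by (force simp: C_def)
    next
      case False
      then obtain x where x: "fst x = a" "conn site_adj (S \<inter> ?B) x (i, j)" using Cij False unfolding C_def by blast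
      have "conn site_adj (S \<inter> ?B) x (i', j')"
        using x(2) by (rule conn.step) (use S that in \<open>auto simp: site_adj_def\<close>)
      then show ?thesis using x(1) unfolding C_def by blast
    qed
  qed (simp add: C_def)
  have A_step: "A i' j'" if Aij: "A i j" and that:  "\<not> oc i' j'" "\<bar>i - i'\<bar> \<le> 1" "\<bar>j - j'\<bar> \<le> 1"
    "a - 1 \<le> i'" "i' \<le> b" "c - 1 \<le> j'" "j' \<le> d" for i j i' j'
  proof (cases "j' = c - 1")
    case False
    then have S: "(i', j') \<in> ?B - S" "i' \<ge> a" using that by (auto simp: oc_def mem_rbox)
    show ?thesis
    proof (cases "j = c - 1")
      case True
      then have "j' = c" using that False by auto
      then show ?thesis using S conn.start[of "(i', j')" "?B - S" star_adj] by (force simp: A_def)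
    next
      case False
      then obtain x where x: "snd x = c" "conn star_adj (?B - S) x (i, j)" using Aij False unfolding A_def by blast
      have "conn star_adj (?B - S) x (i', j')"
      proof (cases "(i, j) = (i', j')")
        case False
        then show ?thesis using x(2) S that by (intro conn.step[OF x(2)]) (auto simp: star_adj_def)
      qed (use x in simp)
      then show ?thesis using x(1) S(2) unfolding A_def by blast
    qed
  qed (use Aij that in \<open>auto simp: A_def oc_def\<close>)
  have "\<exists>j. c - 1 \<le> j \<and> j \<le> d \<and> C b j \<or> (\<exists>i. a - 1 \<le> i \<and> i \<le> b \<and> A i d)"
  proof (rule ccontr)
    assume no: "\<not> ?thesis"
    have low: "\<not> C i (c - 1)" if "a - 1 < i" for i using C_oc[of i "c - 1"] that by (auto simp: oc_def)
    have left: "\<not> A (a - 1) j" for j by (simp add: A_def)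
    have corner: "A (a - 1 + 1) (c - 1)" "C (a - 1) (c - 1)" by (simp_all add: A_def C_def)
    have disj: "\<not> (A i j \<and> C i j)" for i j using A_vac C_oc by blast
    show False
    proof (rule sperner_parity[of "a - 1" b "c - 1" d A C])
      fix i j assume ij: "a - 1 \<le> i" "i < b" "c - 1 \<le> j" "j < d"
      have dj: "\<not> (A i j \<and> C i j)" for i j using A_vac C_oc by blast
      have c: "C p q \<and> oc p' q' \<longrightarrow> C p' q'"
        if "\<bar>p - p'\<bar> + \<bar>q - q'\<bar> = 1" "i \<le> p'" "p' \<le> i + 1" "j \<le> q'" "q' \<le> j + 1" for p q p' q'
      proof (intro impI, elim conjE, erule C_step, assumption)
        show "\<bar>p - p'\<bar> + \<bar>q - q'\<bar> = 1" using that by simp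
      qed (use that ij in linarith)+
      have a: "A p q \<Longrightarrow> \<not> oc p' q' \<Longrightarrow> A p' q'"
        if "\<bar>p - p'\<bar> \<le> 1" "\<bar>q - q'\<bar> \<le> 1" "i \<le> p'" "p' \<le> i + 1" "j \<le> q'" "q' \<le> j + 1" for p q p' q'
      proof (erule A_step, assumption)
        show "\<bar>p - p'\<bar> \<le> 1" "\<bar>q - q'\<bar> \<le> 1" using that by simp_all
      qed (use that ij in linarith)+
      show "even (of_bool (A i j \<and> C (i+1) j \<or> C i j \<and> A (i+1) j) +
            of_bool (A i (j+1) \<and> C (i+1) (j+1) \<or> C i (j+1) \<and> A (i+1) (j+1)) +
            of_bool (A i j \<and> C i (j+1) \<or> C i j \<and> A i (j+1)) +
            (of_bool (A (i+1) j \<and> C (i+1) (j+1) \<or> C (i+1) j \<and> A (i+1) (j+1)) :: int))"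
      proof (cases "A i j \<or> A (i+1) j \<or> A i (j+1) \<or> A (i+1) (j+1)")
        case True
        \<comment> \<open>Distinct corners of a unit square are always star adjacent, so a single
          reached vacant corner makes all vacant corners reached. This is where the diagonals
          enter.\<close>
        have Aoc: "A p q \<longleftrightarrow> \<not> oc p q" if pq: "i \<le> p" "p \<le> i + 1" "j \<le> q" "q \<le> j + 1" for p q
        proof -
          have "A p q" if "\<not> oc p q"
            using True a[of i p j q] a[of "i+1" p j q] a[of i p "j+1" q] a[of "i+1" p "j+1" q] pq that
            by fastforce
          then show ?thesis using A_vac by blast
        qed
        have A: "A i j \<longleftrightarrow> \<not> oc i j" "A (i+1) j \<longleftrightarrow> \<not> oc (i+1) j"
          "A i (j+1) \<longleftrightarrow> \<not> oc i (j+1)" "A (i+1) (j+1) \<longleftrightarrow> \<not> oc (i+1) (j+1)"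
          by (simp_all add: Aoc)
        have cs: "C i j \<and> oc (i+1) j \<longrightarrow> C (i+1) j" "C (i+1) j \<and> oc i j \<longrightarrow> C i j"
          "C i j \<and> oc i (j+1) \<longrightarrow> C i (j+1)" "C i (j+1) \<and> oc i j \<longrightarrow> C i j"
          "C (i+1) j \<and> oc (i+1) (j+1) \<longrightarrow> C (i+1) (j+1)" "C (i+1) (j+1) \<and> oc (i+1) j \<longrightarrow> C (i+1) j"
          "C i (j+1) \<and> oc (i+1) (j+1) \<longrightarrow> C (i+1) (j+1)" "C (i+1) (j+1) \<and> oc i (j+1) \<longrightarrow> C i (j+1)"
          by (rule c; simp)+
        show ?thesis unfolding A using C_oc by (intro sperner_square cs) blast+
      qed simp
    qed (use ab no low left corner disj in simp_all)
  qed
  then consider j where "C b j" | i where "A i d" by blast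
  then show thesis
  proof cases
    case 1
    then obtain x where "fst x = a" "conn site_adj (S \<inter> ?B) x (b, j)" using ab unfolding C_def by auto
    then show thesis using that(1) by simp
  next
    case 2
    then obtain x where "snd x = c" "conn star_adj (?B - S) x (i, d)" using ab unfolding A_def by auto
    then show thesis using that(2) by simp
  qed
qed

lemma crossing_exists:
  assumes m: "matching T T'" and ab: "a \<le> b" "c \<le> d"
  obtains x y where "conn T (S \<inter> rbox a b c d) x y" "fst x = a" "fst y = b"
  | x y where "conn T' (rbox a b c d - S) x y" "snd x = c" "snd y = d"
proof (cases "T = site_adj")
  case True
  then have "T' = star_adj" using m by (auto simp: matching_def fun_eq_iff star_adj_def site_adj_def)
  then show thesis using crossing_exists_site_star[OF ab, of S] that True by metis
next
  case False
  then have T: "T = star_adj" "T' = site_adj" using m by (auto simp: matching_def)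
  let ?S = "prod.swap ` (rbox a b c d - S)"
  have sw: "prod.swap ` (?S \<inter> rbox c d a b) \<subseteq> rbox a b c d - S"
    "prod.swap ` (rbox c d a b - ?S) \<subseteq> S \<inter> rbox a b c d"
    by (force simp: mem_rbox image_iff)+
  show thesis
  proof (rule crossing_exists_site_star[OF ab(2,1), of ?S])
    fix x y assume *: "conn site_adj (?S \<inter> rbox c d a b) x y" "fst x = c" "fst y = d"
    have "conn site_adj (prod.swap ` (?S \<inter> rbox c d a b)) (prod.swap x) (prod.swap y)"
      using conn_swap[OF matching_sym[OF m]] *(1) unfolding T .
    then have "conn T' (rbox a b c d - S) (prod.swap x) (prod.swap y)"
      unfolding T using sw(1) by (rule conn_mono)
    then show thesis using that(2)[of "prod.swap x" "prod.swap y"] * by simp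
  next
    fix x y assume *: "conn star_adj (rbox c d a b - ?S) x y" "snd x = a" "snd y = b"
    have "conn star_adj (prod.swap ` (rbox c d a b - ?S)) (prod.swap x) (prod.swap y)"
      using conn_swap[OF m] *(1) unfolding T .
    then have "conn T (S \<inter> rbox a b c d) (prod.swap x) (prod.swap y)"
      unfolding T using sw(2) by (rule conn_mono)
    then show thesis using that(1)[of "prod.swap x" "prod.swap y"] * by simp
  qed
qed

section \<open>Bernoulli percolation in a finite window\<close>

text \<open>
  A configuration in a finite window is encoded by its set \<open>S\<close> of occupied sites; a vacant path at
  parameter \<open>p\<close> is an occupied path of the complement, whose parameter is \<open>1 - p\<close>.
\<close>

definition weight :: "real \<Rightarrow> 'a set \<Rightarrow> 'a set \<Rightarrow> real" where
  "weight q L S = q ^ card S * (1 - q) ^ card (L - S)"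

definition pr :: "real \<Rightarrow> 'a set \<Rightarrow> ('a set \<Rightarrow> bool) \<Rightarrow> real" where
  "pr q L E = (\<Sum>S\<in>Pow L. weight q L S * of_bool (E S))"

definition incr_on :: "'a set \<Rightarrow> ('a set \<Rightarrow> bool) \<Rightarrow> bool" where
  "incr_on L E \<longleftrightarrow> (\<forall>S S'. S \<subseteq> S' \<longrightarrow> S' \<subseteq> L \<longrightarrow> E S \<longrightarrow> E S')"

lemma incr_onD: "incr_on L E \<Longrightarrow> S \<subseteq> S' \<Longrightarrow> S' \<subseteq> L \<Longrightarrow> E S \<Longrightarrow> E S'"
  by (auto simp: incr_on_def)

lemma weight_nonneg: "0 \<le> q \<Longrightarrow> q \<le> 1 \<Longrightarrow> 0 \<le> weight q L S"
  by (simp add: weight_def)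

lemma weight_mult:
  assumes "finite A" "finite B" "A \<inter> B = {}" "S \<subseteq> A" "R \<subseteq> B"
  shows "weight q (A \<union> B) (S \<union> R) = weight q A S * weight q B R"
proof -
  have "finite S" "finite R" using assms by (auto intro: finite_subset)
  moreover have "S \<inter> R = {}" "(A \<union> B) - (S \<union> R) = (A - S) \<union> (B - R)" "(A - S) \<inter> (B - R) = {}"
    using assms by auto
  ultimately have "card (S \<union> R) = card S + card R" "card ((A \<union> B) - (S \<union> R)) = card (A - S) + card (B - R)"
    using assms by (auto simp: card_Un_disjoint)
  then show ?thesis by (simp add: weight_def power_add)
qed

lemma Pow_Un_disjoint_bij:
  assumes "A \<inter> B = {}"
  shows "bij_betw (\<lambda>(S, R). S \<union> R) (Pow A \<times> Pow B) (Pow (A \<union> B))"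
proof (rule bij_betwI[where g = "\<lambda>S. (S \<inter> A, S \<inter> B)"])
qed (use assms in auto)

lemma pr_Un:
  assumes "finite A" "finite B" "A \<inter> B = {}"
  shows "pr q (A \<union> B) E = (\<Sum>S\<in>Pow A. weight q A S * pr q B (\<lambda>R. E (S \<union> R)))"
proof -
  have "pr q (A \<union> B) E = (\<Sum>(S, R)\<in>Pow A \<times> Pow B. weight q (A \<union> B) (S \<union> R) * of_bool (E (S \<union> R)))"
    unfolding pr_def
    by (subst sum.reindex_bij_betw[OF Pow_Un_disjoint_bij[OF assms(3)], symmetric])
      (simp add: case_prod_unfold)
  also have "\<dots> = (\<Sum>(S, R)\<in>Pow A \<times> Pow B. weight q A S * (weight q B R * of_bool (E (S \<union> R))))"
    by (intro sum.cong) (use weight_mult[OF assms] in auto)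
  also have "\<dots> = (\<Sum>S\<in>Pow A. weight q A S * pr q B (\<lambda>R. E (S \<union> R)))"
    by (simp add: sum.cartesian_product[symmetric] pr_def sum_distrib_left)
  finally show ?thesis .
qed

lemma pr_cong: "(\<And>S. S \<subseteq> L \<Longrightarrow> E S \<longleftrightarrow> F S) \<Longrightarrow> pr q L E = pr q L F"
  unfolding pr_def by (intro sum.cong) auto

lemma pr_insert:
  assumes "finite L" "x \<notin> L"
  shows "pr q (insert x L) E = q * pr q L (\<lambda>S. E (insert x S)) + (1 - q) * pr q L E"
proof -
  have "Pow {x} = {{}, {x}}" by auto
  then show ?thesis
    using pr_Un[of "{x}" L q E] assms by (simp add: weight_def)
qed

lemma pr_empty [simp]: "pr q {} E = of_bool (E {})"
  by (simp add: pr_def weight_def)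

lemma pr_True [simp]: "finite L \<Longrightarrow> pr q L (\<lambda>_. True) = 1"
  by (induction L rule: finite_induct) (auto simp: pr_insert)

lemma pr_nonneg: "0 \<le> q \<Longrightarrow> q \<le> 1 \<Longrightarrow> 0 \<le> pr q L E"
  unfolding pr_def by (intro sum_nonneg) (auto simp: weight_nonneg)

lemma pr_mono:
  assumes "0 \<le> q" "q \<le> 1" "\<And>S. S \<subseteq> L \<Longrightarrow> E S \<Longrightarrow> F S"
  shows "pr q L E \<le> pr q L F"
  unfolding pr_def using assms by (intro sum_mono mult_left_mono) (auto simp: weight_nonneg)

lemma pr_le_1: "0 \<le> q \<Longrightarrow> q \<le> 1 \<Longrightarrow> finite L \<Longrightarrow> pr q L E \<le> 1"
  using pr_mono[of q L E "\<lambda>_. True"] by simp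

lemma pr_not: "finite L \<Longrightarrow> pr q L (\<lambda>S. \<not> E S) = 1 - pr q L E"
proof -
  assume "finite L"
  have "pr q L E + pr q L (\<lambda>S. \<not> E S) = pr q L (\<lambda>_. True)"
    unfolding pr_def sum.distrib[symmetric] by (intro sum.cong) (auto simp: algebra_simps)
  then show ?thesis using \<open>finite L\<close> by simp
qed

lemma pr_disj_conj: "pr q L (\<lambda>S. E S \<or> F S) + pr q L (\<lambda>S. E S \<and> F S) = pr q L E + pr q L F"
  unfolding pr_def sum.distrib[symmetric] by (intro sum.cong) (auto simp: algebra_simps)

lemma pr_disj_le: "0 \<le> q \<Longrightarrow> q \<le> 1 \<Longrightarrow> pr q L (\<lambda>S. E S \<or> F S) \<le> pr q L E + pr q L F"
  using pr_disj_conj[of q L E F] pr_nonneg[of q L "\<lambda>S. E S \<and> F S"] by linarith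

lemma pr_Bex_le:
  assumes "finite I" "0 \<le> q" "q \<le> 1"
  shows "pr q L (\<lambda>S. \<exists>i\<in>I. E i S) \<le> (\<Sum>i\<in>I. pr q L (E i))"
  using assms(1)
proof (induction I rule: finite_induct)
  case empty
  then show ?case by (simp add: pr_def)
next
  case (insert i I)
  have "pr q L (\<lambda>S. \<exists>i\<in>insert i I. E i S) \<le> pr q L (E i) + pr q L (\<lambda>S. \<exists>i\<in>I. E i S)"
    using pr_disj_le[OF assms(2,3), of L "E i"] by simp
  then show ?case using insert by simp
qed

lemma pr_window:
  assumes "finite L" "L0 \<subseteq> L" "\<And>S. S \<subseteq> L \<Longrightarrow> E S \<longleftrightarrow> E (S \<inter> L0)"
  shows "pr q L E = pr q L0 E"
proof -
  have fin: "finite L0" "finite (L - L0)" using assms by (auto intro: finite_subset)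
  have "pr q ((L - L0) \<union> L0) E = (\<Sum>S\<in>Pow (L - L0). weight q (L - L0) S * pr q L0 (\<lambda>R. E (S \<union> R)))"
    using fin by (intro pr_Un) auto
  also have "\<dots> = (\<Sum>S\<in>Pow (L - L0). weight q (L - L0) S * pr q L0 E)"
  proof (intro sum.cong refl, rule arg_cong[of _ _ "\<lambda>x. _ * x"], rule pr_cong)
    fix S R assume "S \<in> Pow (L - L0)" "R \<subseteq> L0"
    then have "S \<union> R \<subseteq> L" "R \<subseteq> L" "(S \<union> R) \<inter> L0 = R" "R \<inter> L0 = R" using assms by auto
    then show "E (S \<union> R) \<longleftrightarrow> E R" using assms(3) by metis
  qed
  also have "\<dots> = pr q (L - L0) (\<lambda>_. True) * pr q L0 E"
    by (simp add: pr_def sum_distrib_right)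
  also have "\<dots> = pr q L0 E" using fin by simp
  also have "(L - L0) \<union> L0 = L" using assms by auto
  finally show ?thesis .
qed

lemma pr_indep:
  assumes "finite L" "A \<subseteq> L" "B \<subseteq> L" "A \<inter> B = {}"
    and "\<And>S. S \<subseteq> L \<Longrightarrow> E S \<longleftrightarrow> E (S \<inter> A)" "\<And>S. S \<subseteq> L \<Longrightarrow> F S \<longleftrightarrow> F (S \<inter> B)"
  shows "pr q L (\<lambda>S. E S \<and> F S) = pr q L E * pr q L F"
proof -
  have fin: "finite A" "finite B" using assms by (auto intro: finite_subset)
  have *: "S \<inter> (A \<union> B) \<inter> A = S \<inter> A" "S \<inter> (A \<union> B) \<inter> B = S \<inter> B" for S by auto
  have **: "S \<inter> (A \<union> B) \<subseteq> L" for S using assms by auto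
  have "pr q L (\<lambda>S. E S \<and> F S) = pr q (A \<union> B) (\<lambda>S. E S \<and> F S)"
  proof (rule pr_window)
    fix S assume S: "S \<subseteq> L"
    show "E S \<and> F S \<longleftrightarrow> E (S \<inter> (A \<union> B)) \<and> F (S \<inter> (A \<union> B))"
      using assms(5,6)[OF S] assms(5,6)[OF **[of S]] unfolding * by blast
  qed (use assms in auto)
  also have "\<dots> = (\<Sum>S\<in>Pow A. weight q A S * pr q B (\<lambda>R. E (S \<union> R) \<and> F (S \<union> R)))"
    using fin assms by (intro pr_Un) auto
  also have "\<dots> = (\<Sum>S\<in>Pow A. weight q A S * of_bool (E S) * pr q B F)"
  proof (intro sum.cong refl)
    fix S assume S: "S \<in> Pow A"
    have "pr q B (\<lambda>R. E (S \<union> R) \<and> F (S \<union> R)) = pr q B (\<lambda>R. E S \<and> F R)"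
    proof (rule pr_cong)
      fix R assume R: "R \<subseteq> B"
      then have s: "S \<union> R \<subseteq> L" "S \<subseteq> L" "R \<subseteq> L" "(S \<union> R) \<inter> A = S" "(S \<union> R) \<inter> B = R" "S \<inter> A = S" "R \<inter> B = R"
        using S assms by auto
      then show "E (S \<union> R) \<and> F (S \<union> R) \<longleftrightarrow> E S \<and> F R" using assms(5,6)[OF s(1)] by simp
    qed
    then show "weight q A S * pr q B (\<lambda>R. E (S \<union> R) \<and> F (S \<union> R)) = weight q A S * of_bool (E S) * pr q B F"
      by (cases "E S") (auto simp: pr_def)
  qed
  also have "\<dots> = pr q A E * pr q B F" by (simp add: pr_def sum_distrib_right)
  also have "pr q A E = pr q L E" using assms by (intro pr_window[symmetric]) auto
  also have "pr q B F = pr q L F" using assms by (intro pr_window[symmetric]) auto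
  finally show ?thesis .
qed

lemma pr_image:
  assumes "inj_on f L"
  shows "pr q (f ` L) E = pr q L (\<lambda>S. E (f ` S))"
proof -
  have "bij_betw (image f) (Pow L) (Pow (f ` L))"
    using assms by (intro bij_betw_Pow) (auto simp: bij_betw_def)
  then have "pr q (f ` L) E = (\<Sum>S\<in>Pow L. weight q (f ` L) (f ` S) * of_bool (E (f ` S)))"
    unfolding pr_def by (subst sum.reindex_bij_betw[symmetric]) auto
  also have "\<dots> = pr q L (\<lambda>S. E (f ` S))"
    unfolding pr_def
  proof (intro sum.cong refl)
    fix S assume "S \<in> Pow L"
    then have S: "S \<subseteq> L" by simp
    have "f ` L - f ` S = f ` (L - S)" using inj_on_image_set_diff[OF assms, of L S] S by simp
    moreover have "card (f ` S) = card S" "card (f ` (L - S)) = card (L - S)"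
      using assms S by (auto intro!: card_image elim: inj_on_subset)
    ultimately show "weight q (f ` L) (f ` S) * of_bool (E (f ` S)) = weight q L S * of_bool (E (f ` S))"
      by (simp add: weight_def)
  qed
  finally show ?thesis .
qed

lemma pr_complement:
  assumes "finite L"
  shows "pr q L (\<lambda>S. E (L - S)) = pr (1 - q) L E"
proof -
  have bij: "bij_betw (\<lambda>S. L - S) (Pow L) (Pow L)"
    by (rule bij_betwI[where g = "\<lambda>S. L - S"]) auto
  have "pr (1 - q) L E = (\<Sum>S\<in>Pow L. weight (1 - q) L (L - S) * of_bool (E (L - S)))"
    unfolding pr_def by (rule sum.reindex_bij_betw[OF bij, symmetric])
  also have "\<dots> = pr q L (\<lambda>S. E (L - S))"
    unfolding pr_def by (intro sum.cong) (auto simp: weight_def double_diff)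
  finally show ?thesis by simp
qed

text \<open>Induction over the window, conditioning on one site: both conditional probabilities are
  larger when the site is occupied, so they are positively correlated as functions of its
  state.\<close>

lemma harris:
  assumes "finite L" "0 \<le> q" "q \<le> 1" "incr_on L E" "incr_on L F"
  shows "pr q L E * pr q L F \<le> pr q L (\<lambda>S. E S \<and> F S)"
  using assms(1,4,5)
proof (induction L arbitrary: E F rule: finite_induct)
  case (insert x L)
  let ?E = "\<lambda>S. E (insert x S)" and ?F = "\<lambda>S. F (insert x S)"
  have i: "incr_on L E" "incr_on L F" "incr_on L ?E" "incr_on L ?F"
    unfolding incr_on_def
    by (intro allI impI; (rule incr_onD[OF insert.prems(1)] incr_onD[OF insert.prems(2)]; (assumption | blast)))+
  have "pr q L E \<le> pr q L ?E" "pr q L F \<le> pr q L ?F"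
    using insert.prems insert.hyps assms(2,3)
    by (auto intro!: pr_mono elim!: incr_onD)
  \<comment> \<open>This is the covariance of the two conditional probabilities.\<close>
  then have "0 \<le> q * (1 - q) * ((pr q L ?E - pr q L E) * (pr q L ?F - pr q L F))"
    using assms by simp
  then have "(q * pr q L ?E + (1 - q) * pr q L E) * (q * pr q L ?F + (1 - q) * pr q L F)
      \<le> q * (pr q L ?E * pr q L ?F) + (1 - q) * (pr q L E * pr q L F)"
    by (simp add: algebra_simps power2_eq_square)
  also have "\<dots> \<le> q * pr q L (\<lambda>S. ?E S \<and> ?F S) + (1 - q) * pr q L (\<lambda>S. E S \<and> F S)"
    using insert.IH i assms by (intro add_mono mult_left_mono) auto
  finally show ?case using insert.hyps by (simp add: pr_insert)
qed auto

lemma harris3: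
  assumes "finite L" "0 \<le> q" "q \<le> 1" "incr_on L E" "incr_on L F" "incr_on L G"
  shows "pr q L E * pr q L F * pr q L G \<le> pr q L (\<lambda>S. E S \<and> F S \<and> G S)"
proof -
  have "incr_on L (\<lambda>S. E S \<and> F S)" using assms by (auto simp: incr_on_def)
  then have "pr q L (\<lambda>S. E S \<and> F S) * pr q L G \<le> pr q L (\<lambda>S. E S \<and> F S \<and> G S)"
    using harris[of L q "\<lambda>S. E S \<and> F S" G] assms by (simp add: conj_assoc)
  moreover have "pr q L E * pr q L F * pr q L G \<le> pr q L (\<lambda>S. E S \<and> F S) * pr q L G"
    using harris[of L q E F] assms pr_nonneg by (intro mult_right_mono) auto
  ultimately show ?thesis by linarith
qed

text \<open>By positive association the failures of \<open>E\<close> and \<open>F\<close> are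
  positively correlated as well, so the square of the common failure probability is at most the
  probability that both fail, hence at most \<open>1 - t\<close>.\<close>

lemma square_root_trick:
  assumes "finite L" "0 \<le> q" "q \<le> 1" "incr_on L E" "incr_on L F" "pr q L E = pr q L F"
    and "t \<le> pr q L (\<lambda>S. E S \<or> F S)"
  shows "1 - sqrt (1 - t) \<le> pr q L E"
proof -
  have "(1 - pr q L E)\<^sup>2 = 1 - (pr q L E + pr q L F) + pr q L E * pr q L F"
    using assms(6) by (simp add: power2_eq_square algebra_simps)
  also have "\<dots> \<le> 1 - pr q L (\<lambda>S. E S \<or> F S)"
    using harris[OF assms(1-5)] pr_disj_conj[of q L E F] by linarith
  also have "\<dots> \<le> 1 - t" using assms by simp
  finally have "1 - pr q L E \<le> sqrt (1 - t)" by (rule real_le_rsqrt)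
  then show ?thesis by simp
qed

lemma continuous_pr: "isCont (\<lambda>q. pr q L E) x"
  unfolding pr_def weight_def by (intro continuous_intros)

text \<open>
  \<open>D S\<close> is the region revealed when exploring the configuration \<open>S\<close>; it is a stopping set by
  \<open>stop\<close>. Harris' inequality is applied to the unrevealed part of the configuration.
\<close>

lemma pr_explore:
  fixes N :: "'a set \<Rightarrow> bool" and F :: "'a set \<Rightarrow> 'a set \<Rightarrow> 'a set \<Rightarrow> bool"
  assumes fin: "finite L" and q: "0 \<le> q" "q \<le> 1"
    and D: "\<And>S. S \<subseteq> L \<Longrightarrow> D S \<subseteq> L"
    and stop: "\<And>S S'. S \<subseteq> L \<Longrightarrow> S' \<subseteq> L \<Longrightarrow> S \<inter> D S = S' \<inter> D S \<Longrightarrow> D S' = D S"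
    and N: "incr_on L N"
    and F: "\<And>S. S \<subseteq> L \<Longrightarrow> N S \<Longrightarrow> incr_on (L - D S) (F (D S) (S \<inter> D S))"
      "\<And>S. S \<subseteq> L \<Longrightarrow> N S \<Longrightarrow> r \<le> pr q (L - D S) (F (D S) (S \<inter> D S))"
  shows "pr q L N * r \<le> pr q L (\<lambda>S. N S \<and> F (D S) (S \<inter> D S) (S - D S))"
proof -
  \<comment> \<open>Configurations are grouped by the revealed region together with what has been
    seen in it; the inequality is proved in each group.\<close>
  define g where "g S = (D S, S \<inter> D S)" for S
  have finP: "finite (Pow L)" using fin by simp
  have *: "(\<Sum>S\<in>{S \<in> Pow L. g S = c}. weight q L S * of_bool (N S)) * r
      \<le> (\<Sum>S\<in>{S \<in> Pow L. g S = c}. weight q L S * of_bool (N S \<and> F (D S) (S \<inter> D S) (S - D S)))"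
    if c: "c \<in> g ` Pow L" for c
  proof -
    obtain S0 where S0: "S0 \<subseteq> L" "c = g S0" using c by auto
    define d e where "d = D S0" and "e = S0 \<inter> D S0"
    have d: "d \<subseteq> L" "e \<subseteq> d" using D S0 by (auto simp: d_def e_def)
    have fd: "finite d" "finite (L - d)" using d fin finite_subset by auto
    \<comment> \<open>The stopping property makes a group a full cylinder: with \<open>d\<close> and
      \<open>e\<close> fixed, every choice \<open>R\<close> of occupied sites outside
      \<open>d\<close> leads to the same revealed data.\<close>
    have DS: "D (e \<union> R) = d \<and> (e \<union> R) \<inter> d = e \<and> (e \<union> R) - d = R" if "R \<subseteq> L - d" for R
    proof -
      have "(e \<union> R) \<inter> d = e" "(e \<union> R) - d = R" using that d by auto
      moreover have "D (e \<union> R) = D S0"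
      proof (rule stop[OF S0(1)])
        show "e \<union> R \<subseteq> L" using that d by blast
        show "S0 \<inter> D S0 = (e \<union> R) \<inter> D S0" using \<open>(e \<union> R) \<inter> d = e\<close> unfolding d_def e_def by simp
      qed
      ultimately show ?thesis by (simp add: d_def)
    qed
    have cls: "bij_betw (\<lambda>R. e \<union> R) (Pow (L - d)) {S \<in> Pow L. g S = c}"
    proof (rule bij_betwI[where g = "\<lambda>S. S - d"])
      show "(\<union>) e \<in> Pow (L - d) \<rightarrow> {S \<in> Pow L. g S = c}"
      proof
        fix R assume R: "R \<in> Pow (L - d)"
        have "c = (d, e)" using S0(2) by (simp add: g_def d_def e_def)
        then have "g (e \<union> R) = c" using DS[of R] R unfolding g_def by simp
        then show "e \<union> R \<in> {S \<in> Pow L. g S = c}" using d R by auto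
      qed
      show "(\<lambda>S. S - d) \<in> {S \<in> Pow L. g S = c} \<rightarrow> Pow (L - d)" by auto
      show "e \<union> R - d = R" if "R \<in> Pow (L - d)" for R using DS that by auto
      show "e \<union> (S - d) = S" if "S \<in> {S \<in> Pow L. g S = c}" for S
      proof -
        have "S \<inter> D S = e" "D S = d" using that S0(2) by (auto simp: g_def d_def e_def)
        then show ?thesis by blast
      qed
    qed
    have sum: "(\<Sum>S\<in>{S \<in> Pow L. g S = c}. weight q L S * of_bool (H S))
        = weight q d e * pr q (L - d) (\<lambda>R. H (e \<union> R))" for H
    proof -
      have "(\<Sum>S\<in>{S \<in> Pow L. g S = c}. weight q L S * of_bool (H S))
        = (\<Sum>R\<in>Pow (L - d). weight q L (e \<union> R) * of_bool (H (e \<union> R)))"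
        by (rule sum.reindex_bij_betw[OF cls, symmetric])
      also have "\<dots> = (\<Sum>R\<in>Pow (L - d). weight q d e * (weight q (L - d) R * of_bool (H (e \<union> R))))"
      proof (intro sum.cong refl)
        fix R assume "R \<in> Pow (L - d)"
        then have "weight q (d \<union> (L - d)) (e \<union> R) = weight q d e * weight q (L - d) R"
          using fd d by (intro weight_mult) auto
        moreover have "d \<union> (L - d) = L" using d by auto
        ultimately show "weight q L (e \<union> R) * of_bool (H (e \<union> R)) = weight q d e * (weight q (L - d) R * of_bool (H (e \<union> R)))"
          by simp
      qed
      finally show ?thesis by (simp add: pr_def sum_distrib_left)
    qed
    \<comment> \<open>Within a group \<open>N\<close> remains increasing in the unrevealed part, so
      Harris' inequality applies there. The bound \<open>r\<close> is only available if
      \<open>N\<close> holds somewhere in the group; otherwise the left side vanishes.\<close>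
    have "pr q (L - d) (\<lambda>R. N (e \<union> R)) * r \<le> pr q (L - d) (\<lambda>R. N (e \<union> R) \<and> F d e R)"
    proof (cases "\<exists>R\<subseteq>L - d. N (e \<union> R)")
      case True
      then obtain R where R: "R \<subseteq> L - d" "N (e \<union> R)" by auto
      let ?S = "e \<union> R"
      have S: "?S \<subseteq> L" "D ?S = d" "?S \<inter> D ?S = e" using R d DS[of R] by auto
      have F': "incr_on (L - d) (F d e)" "r \<le> pr q (L - d) (F d e)"
        using F[OF S(1) R(2)] S by auto
      have "incr_on (L - d) (\<lambda>R. N (e \<union> R))"
        unfolding incr_on_def
      proof (intro allI impI)
        fix S S' assume "S \<subseteq> S'" "S' \<subseteq> L - d" "N (e \<union> S)"
        then show "N (e \<union> S')" using d by (intro incr_onD[OF N, of "e \<union> S" "e \<union> S'"]) auto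
      qed
      then have "pr q (L - d) (\<lambda>R. N (e \<union> R)) * pr q (L - d) (F d e) \<le> pr q (L - d) (\<lambda>R. N (e \<union> R) \<and> F d e R)"
        using harris[OF fd(2) q] F' by blast
      moreover have "pr q (L - d) (\<lambda>R. N (e \<union> R)) * r \<le> pr q (L - d) (\<lambda>R. N (e \<union> R)) * pr q (L - d) (F d e)"
        using F' q pr_nonneg by (intro mult_left_mono) auto
      ultimately show ?thesis by linarith
    next
      case False
      then have "pr q (L - d) (\<lambda>R. N (e \<union> R)) = 0" unfolding pr_def by (intro sum.neutral) auto
      then show ?thesis using pr_nonneg q by auto
    qed
    also have "\<dots> = pr q (L - d) (\<lambda>R. N (e \<union> R) \<and> F (D (e \<union> R)) ((e \<union> R) \<inter> D (e \<union> R)) ((e \<union> R) - D (e \<union> R)))"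
      by (rule pr_cong) (use DS in auto)
    finally show ?thesis
      using weight_nonneg[OF q, of d e] unfolding sum by (simp add: mult_left_mono mult.assoc)
  qed
  have "pr q L N * r = (\<Sum>c\<in>g ` Pow L. (\<Sum>S\<in>{S \<in> Pow L. g S = c}. weight q L S * of_bool (N S)) * r)"
    unfolding pr_def by (subst sum.image_gen[OF finP, of _ g]) (simp add: sum_distrib_right)
  also have "\<dots> \<le> (\<Sum>c\<in>g ` Pow L. \<Sum>S\<in>{S \<in> Pow L. g S = c}. weight q L S * of_bool (N S \<and> F (D S) (S \<inter> D S) (S - D S)))"
    by (intro sum_mono *)
  also have "\<dots> = pr q L (\<lambda>S. N S \<and> F (D S) (S \<inter> D S) (S - D S))"
    unfolding pr_def by (rule sum.image_gen[OF finP, of _ g, symmetric])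
  finally show ?thesis .
qed

section \<open>Replacing a path by one outside the explored region\<close>

definition hcross :: "(site \<Rightarrow> site \<Rightarrow> bool) \<Rightarrow> int \<Rightarrow> int \<Rightarrow> int \<Rightarrow> int \<Rightarrow> site set \<Rightarrow> bool" where
  "hcross T a b c d S \<longleftrightarrow> (\<exists>x y. conn T (S \<inter> rbox a b c d) x y \<and> fst x = a \<and> fst y = b)"

definition vcross :: "(site \<Rightarrow> site \<Rightarrow> bool) \<Rightarrow> int \<Rightarrow> int \<Rightarrow> int \<Rightarrow> int \<Rightarrow> site set \<Rightarrow> bool" where
  "vcross T a b c d S \<longleftrightarrow> (\<exists>x y. conn T (S \<inter> rbox a b c d) x y \<and> snd x = c \<and> snd y = d)"

text \<open>For \<open>k = 2*l+1\<close> the axis runs between the columns \<open>l\<close> and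
  \<open>l + 1\<close>. A path ending in column \<open>l\<close> is then disjoint from its image,
  while its end and the image of its end are adjacent.\<close>

definition mirror :: "int \<Rightarrow> site \<Rightarrow> site" where
  "mirror k v = (k - fst v, snd v)"

lemma mirror_simps [simp]: "fst (mirror k v) = k - fst v" "snd (mirror k v) = snd v"
  "mirror k (mirror k v) = v"
  by (simp_all add: mirror_def)

lemma mirror_image_iff: "v \<in> mirror k ` S \<longleftrightarrow> mirror k v \<in> S"
  by (metis imageE imageI mirror_simps(3))

lemma matching_mirror: "matching T T' \<Longrightarrow> T (mirror k u) (mirror k v) \<longleftrightarrow> T u v"
  by (auto simp: matching_def site_adj_def star_adj_def mirror_def prod_eq_iff)

text \<open>
  \<open>P\<close> is a horizontal crossing of \<open>[-l, l]\<^sup>2\<close> stopped when it first reaches the right side, at \<open>e\<close>,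
  and \<open>Q\<close> is its part from the last visit \<open>w\<close> to the column \<open>0\<close> onwards.
\<close>

definition crossing_split ::
  "(site \<Rightarrow> site \<Rightarrow> bool) \<Rightarrow> int \<Rightarrow> site set \<Rightarrow> site set \<Rightarrow> site set \<Rightarrow> site \<Rightarrow> site \<Rightarrow> bool" where
  "crossing_split T l S P Q w e \<longleftrightarrow> P \<subseteq> S \<and> Q \<subseteq> P \<and> (\<exists>u. fst u = - l \<and> conn T P u e) \<and>
     fst e = l \<and> (\<forall>v\<in>P. fst v = l \<longrightarrow> v = e) \<and>
     fst w = 0 \<and> conn T Q w e \<and> (\<forall>v\<in>Q. fst v \<le> 0 \<longrightarrow> v = w) \<and> (\<forall>v\<in>Q. conn T Q w v)"

lemma crossing_split_exists:
  assumes m: "matching T T'" and l: "0 < l" and S: "conn T S u v" "fst u = - l" "fst v = l"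
  obtains P Q w e where "crossing_split T l S P Q w e"
proof -
  have st: "\<And>u v. T u v \<Longrightarrow> T v u" "\<And>u v. T u v \<Longrightarrow> fst v \<le> fst u + 1"
    using matching_symp[OF m] matching_steps(1)[OF m] by (blast, fastforce)
  have le: "fst u \<le> l" "l \<le> fst v" "fst u \<le> 0" using S l by auto
  obtain e where e: "e \<in> S" "fst e = l" "conn T (insert e {v \<in> S. fst v < l}) u e"
    by (rule conn_first_level[of T fst, OF st(2) S(1) le(1,2)])
  obtain P where P: "P \<subseteq> insert e {v \<in> S. fst v < l}" "conn T P u e"
    by (rule conn_path_set[OF e(3)])
  have le': "0 \<le> fst e" using e l by simp
  obtain w where w: "w \<in> P" "fst w = 0" "conn T (insert w {v \<in> P. 0 < fst v}) w e"
    by (rule conn_last_level[of T fst, OF st P(2) le(3) le'])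
  obtain Q where Q: "Q \<subseteq> insert w {v \<in> P. 0 < fst v}" "conn T Q w e" "\<And>v. v \<in> Q \<Longrightarrow> conn T Q w v"
    using conn_path_set[OF w(3)] by blast
  have PS: "P \<subseteq> S" "Q \<subseteq> P" using P(1) Q(1) e(1) w(1) by auto
  have "\<exists>u. fst u = - l \<and> conn T P u e" using P(2) S(2) by blast
  moreover have "\<forall>v\<in>P. fst v = l \<longrightarrow> v = e" using P(1) by auto
  moreover have "\<forall>v\<in>Q. fst v \<le> 0 \<longrightarrow> v = w" using Q(1) by auto
  ultimately have "crossing_split T l S P Q w e"
    unfolding crossing_split_def using PS Q(2,3) w(2) e(2) by blast
  then show thesis using that by blast
qed

lemma nbhd_mirror:
  assumes m: "matching T T'" shows "nbhd T (mirror k ` S) = mirror k ` nbhd T S"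
proof -
  have 1: "v \<in> nbhd T (mirror k ` S)" if v: "mirror k v \<in> nbhd T S" for v
  proof -
    obtain u where "u \<in> S" "u = mirror k v \<or> T u (mirror k v)" using v by (auto simp: nbhd_def)
    then have "mirror k u \<in> mirror k ` S" "mirror k u = v \<or> T (mirror k u) v"
      using matching_mirror[OF m, of k u "mirror k v"] by auto
    then show ?thesis unfolding nbhd_def by blast
  qed
  have 2: "mirror k v \<in> nbhd T S" if v: "v \<in> nbhd T (mirror k ` S)" for v
  proof -
    obtain u where "u \<in> S" "mirror k u = v \<or> T (mirror k u) v" using v by (auto simp: nbhd_def)
    then have "u = mirror k v \<or> T u (mirror k v)"
      using matching_mirror[OF m, of k u "mirror k v"] by auto
    then show ?thesis using \<open>u \<in> S\<close> unfolding nbhd_def by blast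
  qed
  show ?thesis using 1 2 mirror_image_iff by blast
qed

lemma conn_mirror: "matching T T' \<Longrightarrow> conn T S x y \<Longrightarrow> conn T (mirror k ` S) (mirror k x) (mirror k y)"
  by (rule conn_map) (auto simp: matching_mirror)

lemma crossing_split_rbox:
  assumes cs: "crossing_split T l S P Q w e" and S: "S \<subseteq> rbox (-l) l (-l) l"
  shows "Q \<subseteq> rbox 0 l (-l) l"
proof
  fix v assume v: "v \<in> Q"
  then have "v \<in> rbox (-l) l (-l) l" using cs S unfolding crossing_split_def by blast
  moreover have "0 \<le> fst v" using cs v unfolding crossing_split_def by force
  ultimately show "v \<in> rbox 0 l (-l) l" by (simp add: mem_rbox)
qed

lemma mirror_crossing:
  assumes m: "matching T T'" and cs: "crossing_split T l S P Q w e" and S: "S \<subseteq> rbox (-l) l (-l) l"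
  shows "conn T (Q \<union> mirror (2*l+1) ` Q) w (mirror (2*l+1) w)"
    "Q \<union> mirror (2*l+1) ` Q \<subseteq> rbox 0 (2*l+1) (-l) l"
proof -
  let ?f = "mirror (2*l+1)"
  have Q: "conn T Q w e" "fst e = l" using cs by (auto simp: crossing_split_def)
  then have we: "w \<in> Q" "e \<in> Q" using conn_mem by blast+
  have "conn T (?f ` Q) (?f w) (?f e)" using conn_mirror[OF m Q(1)] .
  then have "conn T (?f ` Q) (?f e) (?f w)" using matching_conn_sym[OF m] by blast
  moreover have "T e (?f e)" using Q(2) by (intro matching_site_adj[OF m]) (simp add: site_adj_def)
  then have "conn T (Q \<union> ?f ` Q) e (?f e)" using we by (intro conn_edge) auto
  ultimately show "conn T (Q \<union> ?f ` Q) w (?f w)"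
    using conn_mono[OF Q(1), of "Q \<union> ?f ` Q"] conn_mono[of T "?f ` Q" "?f e" "?f w" "Q \<union> ?f ` Q"]
      conn_trans' by (metis Un_upper1 Un_upper2)
  have Qb: "Q \<subseteq> rbox 0 l (-l) l" by (rule crossing_split_rbox[OF cs S])
  have "v \<in> rbox 0 (2*l+1) (-l) l" if "v \<in> Q" for v
    using subsetD[OF Qb that] by (simp add: mem_rbox)
  moreover have "?f v \<in> rbox 0 (2*l+1) (-l) l" if "v \<in> Q" for v
    using subsetD[OF Qb that] by (simp add: mem_rbox)
  ultimately show "Q \<union> ?f ` Q \<subseteq> rbox 0 (2*l+1) (-l) l" by blast
qed

text \<open>
  \<open>A\<close> is the explored vacant region, \<open>G\<close> its occupied boundary and \<open>P\<close> a crossing inside \<open>G\<close>.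
  The path in \<open>R\<close> ignores what has been revealed, but it can be replaced by one that uses only
  \<open>P\<close> and unexplored sites: otherwise a dual path \<open>Z\<close> would separate \<open>Q\<close> from the top,
  and together with \<open>A\<close> it would pass from the bottom to the right side without meeting \<open>P\<close>.
\<close>

lemma explored_path:
  assumes m: "matching T T'" and l: "0 < l"
    and A: "A \<subseteq> rbox (-l) l (-l) l" "\<And>a. a \<in> A \<Longrightarrow> \<exists>u. snd u = - l \<and> conn T' A u a"
    and G: "G \<subseteq> rbox (-l) l (-l) l" "A \<inter> G = {}" "\<And>g. g \<in> G \<Longrightarrow> snd g = - l \<or> (\<exists>a\<in>A. T' a g)"
    and cs: "crossing_split T l G P Q w e"
    and R: "R \<subseteq> rbox 0 (2*l+1) (-l) l" "z \<in> R" "z \<in> nbhd T Q" "snd t = l"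
      "conn T (insert z {v \<in> R. v \<notin> nbhd T (Q \<union> mirror (2*l+1) ` Q)}) t z"
  shows "\<exists>t g. snd t = l \<and> g \<in> nbhd T Q \<and> conn T ((P \<union> (R - (A \<union> G))) \<inter> rbox 0 (2*l+1) (-l) l) t g"
proof (rule ccontr)
  assume neg: "\<not> ?thesis"
  have m': "matching T' T" using m matching_sym by blast
  have symT: "T u v \<Longrightarrow> T v u" for u v using matching_symp[OF m] .
  have symT': "T' u v \<Longrightarrow> T' v u" for u v using matching_symp[OF m'] .
  define B where "B = rbox (-l) l (-l) l"
  define B' where "B' = rbox 0 (2*l+1) (-l) l"
  define M where "M = mirror (2*l+1) ` Q"
  define O3 where "O3 = P \<union> (R - (A \<union> G))"
  have neg: "\<not> conn T (O3 \<inter> B') t g" if "snd t = l" "g \<in> nbhd T Q" for t g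
    using neg that unfolding O3_def B'_def by blast
  obtain u where u: "fst u = - l" "conn T P u e" using cs by (auto simp: crossing_split_def)
  have P: "P \<subseteq> G" "\<And>v. v \<in> P \<Longrightarrow> fst v = l \<Longrightarrow> v = e" "fst e = l"
    and Q: "Q \<subseteq> P" "fst w = 0" "conn T Q w e" "\<And>v. v \<in> Q \<Longrightarrow> fst v \<le> 0 \<Longrightarrow> v = w"
      "\<And>v. v \<in> Q \<Longrightarrow> conn T Q w v"
    using cs by (auto simp: crossing_split_def)
  have PB: "P \<subseteq> B" using P G B_def by auto
  have Qb: "0 \<le> fst v \<and> fst v \<le> l \<and> - l \<le> snd v \<and> snd v \<le> l" if v: "v \<in> Q" for v
  proof -
    have "v \<in> B" using v Q(1) PB by blast
    moreover have "0 \<le> fst v" using Q(4)[OF v] Q(2) by (cases "fst v \<le> 0") auto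
    ultimately show ?thesis by (simp add: B_def mem_rbox)
  qed
  have Mb: "l + 1 \<le> fst v \<and> fst v \<le> 2*l+1 \<and> - l \<le> snd v \<and> snd v \<le> l" if v: "v \<in> M" for v
  proof -
    obtain p where "p \<in> Q" "v = mirror (2*l+1) p" using v by (auto simp: M_def)
    then show ?thesis using Qb[of p] by simp
  qed
  have we: "w \<in> Q" "e \<in> Q" using Q(3) conn_mem by blast+
  have QM_conn: "conn T (Q \<union> M) w (mirror (2*l+1) w)" and QMB: "Q \<union> M \<subseteq> B'"
    using mirror_crossing[OF m cs G(1)] by (simp_all add: M_def B'_def)
  \<comment> \<open>The part of the wide box below the barrier formed by \<open>Q\<close> and its
    mirror image, as seen by dual paths from the bottom.\<close>
  define Low where "Low = {v. \<exists>u. snd u = - l \<and> conn T' (B' - (Q \<union> M)) u v}"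
  \<comment> \<open>The duality is applied to this auxiliary set. Adding \<open>Low\<close> and
    \<open>Q\<close> forces a separating dual path to stay above the barrier on the left; removing
    sites near the mirror image but not near \<open>Q\<close> makes contact with the image
    useless.\<close>
  define O2 where "O2 = Low \<union> Q \<union> (O3 - (nbhd T M - nbhd T Q))"
  have Low_top: "snd v \<noteq> l" if v: "v \<in> Low" for v
  proof
    assume "snd v = l"
    obtain u where "snd u = - l" "conn T' (B' - (Q \<union> M)) u v" using v by (auto simp: Low_def)
    then have "(Q \<union> M) \<inter> (B' - (Q \<union> M)) \<noteq> {}"
      using \<open>snd v = l\<close> Q(2) by (intro crossing_meets[OF m QMB[unfolded B'_def] QM_conn]) (auto simp: B'_def)
    then show False by blast
  qed
  have Low_step: "v' \<in> Low" if "v \<in> Low" "T' v v'" "v' \<in> B'" "v' \<notin> Q \<union> M" for v v'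
    using that unfolding Low_def by (blast intro: conn.step)
  have Low_B: "v \<in> B' - (Q \<union> M)" if "v \<in> Low" for v using that conn_mem(2) unfolding Low_def by blast
  show False
  proof (rule crossing_exists[OF m', of 0 "2*l+1" "-l" l "- O2"])
    fix u t assume ut: "conn T (rbox 0 (2*l+1) (-l) l - - O2) u t" "snd u = - l" "snd t = l"
    let ?X = "B' \<inter> O2"
    have "conn T ?X t u" using ut matching_conn_sym[OF m] by (simp add: B'_def Diff_Compl)
    \<comment> \<open>A downward \<open>T\<close> path in \<open>O2\<close> can never use the added
      sites: to enter \<open>Q\<close> it would first come near \<open>Q\<close>, against
      \<open>neg\<close>, and to enter \<open>Low\<close> it would have to pass the barrier. But its
      last site, in the bottom row, would belong to \<open>Low\<close>.\<close>
    then have "u \<notin> Low \<union> Q \<and> u \<notin> nbhd T Q \<and> u \<notin> nbhd T M \<and> conn T (O3 \<inter> B') t u \<and> u \<in> B'"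
    proof induction
      case start
      have "t \<notin> Q"
      proof
        assume tQ: "t \<in> Q"
        then have "conn T (O3 \<inter> B') t t" using start Q(1) by (intro conn.start) (auto simp: O3_def)
        then show False using neg[OF ut(3)] tQ nbhd_superset by blast
      qed
      moreover have "t \<notin> Low" using Low_top ut(3) by blast
      ultimately have "t \<in> O3 \<inter> B'" "t \<notin> nbhd T M - nbhd T Q" using start by (auto simp: O2_def)
      moreover from this(1) have "conn T (O3 \<inter> B') t t" by (rule conn.start)
      ultimately show ?case using neg[OF ut(3)] \<open>t \<notin> Q\<close> \<open>t \<notin> Low\<close> by blast
    next
      case (step u v)
      have uQM: "u \<notin> Q \<union> M" using step.IH nbhd_superset by blast
      have "v \<notin> Q" using step.IH symT[OF step.hyps(2)] by (auto simp: nbhd_def)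
      moreover have "v \<notin> Low"
      proof
        assume v: "v \<in> Low"
        have "T' u v \<or> (\<exists>w\<in>rbox 0 (2*l+1) (-l) l. T' u w \<and> T' w v \<and> T u w \<and> T w v)"
          using step by (intro matching_detour[OF m]) (auto simp: B'_def)
        then have "u \<in> Low"
        proof
          assume "T' u v"
          then show ?thesis using Low_step[OF v symT'] step.IH uQM by blast
        next
          assume "\<exists>w\<in>rbox 0 (2*l+1) (-l) l. T' u w \<and> T' w v \<and> T u w \<and> T w v"
          then obtain w where w: "w \<in> B'" "T' u w" "T' w v" "T w u" using B'_def symT by blast
          then have "w \<notin> Q \<union> M" using step.IH by (auto simp: nbhd_def)
          then have "w \<in> Low" using Low_step[OF v symT'] w by blast
          then show ?thesis using Low_step[OF _ symT'] w step.IH uQM by blast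
        qed
        then show False using step.IH by blast
      qed
      ultimately have v: "v \<in> O3 \<inter> B'" "v \<notin> nbhd T M - nbhd T Q" using step.hyps(3) by (auto simp: O2_def)
      then have "conn T (O3 \<inter> B') t v" using step by (blast intro: conn.step)
      then show ?case using neg[OF ut(3)] v \<open>v \<notin> Q\<close> \<open>v \<notin> Low\<close> by blast
    qed
    then have "u \<notin> Low" "u \<in> B'" "u \<notin> Q \<union> M" using nbhd_superset by blast+
    then show False using ut(2) unfolding Low_def by (blast intro: conn.start)
  next
    fix a b assume ab: "conn T' (- O2 \<inter> rbox 0 (2*l+1) (-l) l) a b" "fst a = 0" "fst b = 2*l+1"
    obtain Z where Z: "Z \<subseteq> - O2 \<inter> B'" "conn T' Z a b" "\<And>v. v \<in> Z \<Longrightarrow> conn T' Z a v"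
      using conn_path_set[OF ab(1)] unfolding B'_def by blast
    have aZ: "a \<in> Z" using Z(2) conn_mem by blast
    then have aB: "- l \<le> snd a" "snd a \<le> l" "a \<notin> O2" using Z(1) by (auto simp: B'_def mem_rbox)
    \<comment> \<open>A site of the left half with no site of \<open>Q\<close> below it in its
      column is reached from the bottom along that column.\<close>
    have col: "v \<in> Low" if v: "fst v = x" "- l \<le> snd v" "snd v \<le> l" "0 \<le> x" "x \<le> l"
      and free: "\<And>k. k \<le> snd v \<Longrightarrow> (x, k) \<notin> Q" for x v
    proof -
      have "(x, k) \<in> B' - (Q \<union> M)" if "- l \<le> k" "k \<le> snd v" for k
        using that v free[of k] Mb[of "(x, k)"] by (auto simp: B'_def mem_rbox)
      then have "conn T' (B' - (Q \<union> M)) (x, - l) (x, snd v)"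
        using v by (intro conn_column[OF m']) auto
      moreover have "(x, snd v) = v" using v(1) by (simp add: prod_eq_iff)
      ultimately show ?thesis unfolding Low_def by auto
    qed
    have "snd w < snd a"
    proof (rule ccontr)
      assume "\<not> snd w < snd a"
      moreover have "snd a \<noteq> snd w"
      proof
        assume "snd a = snd w"
        then have "a = w" using ab(2) Q(2) by (simp add: prod_eq_iff)
        then show False using aB we by (simp add: O2_def)
      qed
      ultimately have "(0, k) \<notin> Q" if "k \<le> snd a" for k using Q(4)[of "(0, k)"] that by auto
      then have "a \<in> Low" using aB ab(2) l by (intro col[of a 0]) auto
      then show False using aB by (simp add: O2_def)
    qed
    define X where "X = insert z {v \<in> R. v \<notin> nbhd T (Q \<union> M)}"
    have Xc: "conn T X t z" using R(5) by (simp add: X_def M_def)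
    obtain g where g: "g \<in> Q" "g = z \<or> T g z" using R(3) by (auto simp: nbhd_def)
    have "conn T (Q \<union> X) w t"
    proof -
      have "conn T (Q \<union> X) w g" using Q(5)[OF g(1)] by (rule conn_mono) auto
      moreover have "conn T (Q \<union> X) g z" using g by (auto intro: conn_edge conn.start simp: X_def)
      moreover have "conn T (Q \<union> X) z t"
        using conn_mono[OF matching_conn_sym[OF m Xc]] by blast
      ultimately show ?thesis using conn_trans' by metis
    qed
    moreover have "Q \<union> X \<subseteq> B'" using QMB R(1,2) by (auto simp: X_def B'_def)
    ultimately have "Z \<inter> (Q \<union> X) \<noteq> {}"
      using Z ab \<open>snd w < snd a\<close> Q(2) R(4) unfolding B'_def
      by (intro crossing_meets_ends[OF m', of Z 0 "2*l+1" "-l" l a b "Q \<union> X" w t]) auto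
    \<comment> \<open>The dual path starts above \<open>w\<close>, so it must meet \<open>Q\<close>
      joined with the given path. The meeting site \<open>s\<close> lies in \<open>R\<close> but not
      in \<open>O2\<close>, which is only possible because it was revealed and is not on
      \<open>P\<close>.\<close>
    then obtain s where s: "s \<in> Z" "s \<in> Q \<union> X" by blast
    then have sO2: "s \<notin> O2" "s \<in> B'" using Z(1) by auto
    then have sX: "s \<in> X" using s by (auto simp: O2_def)
    then have sR: "s \<in> R" using R(2) by (auto simp: X_def)
    have "s \<notin> nbhd T M - nbhd T Q"
      using sX R(3) nbhd_mono[of M "Q \<union> M" T] by (auto simp: X_def)
    then have "s \<notin> O3" using sO2 by (auto simp: O2_def)
    then have sAG: "s \<notin> P" "s \<in> A \<union> G" using sR by (auto simp: O3_def)
    then have sB: "s \<in> B" using A G B_def by auto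
    have "conn T' Z s b" using conn_trans' matching_conn_sym[OF m' Z(3)[OF s(1)]] Z(2) by metis
    moreover have "fst v \<le> fst u + 1" if "T' u v" for u v using matching_steps(1)[OF m' that] by simp
    moreover have "fst s \<le> l" "l \<le> fst b" using sB ab l by (auto simp: B_def mem_rbox)
    ultimately obtain u1 where u1: "u1 \<in> Z" "fst u1 = l" "conn T' (insert u1 {v \<in> Z. fst v < l}) s u1"
      using conn_first_level[of T' fst Z s b l] by blast
    obtain u0 where u0: "snd u0 = - l" "conn T' (insert s A) u0 s"
    proof (cases "s \<in> A")
      case True
      then show ?thesis using A(2)[OF True] that by (auto simp: insert_absorb)
    next
      case False
      then have "snd s = - l \<or> (\<exists>a\<in>A. T' a s)" using sAG G(3) by blast
      then show ?thesis
      proof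
        assume "\<exists>a\<in>A. T' a s"
        then obtain a u where "snd u = - l" "conn T' A u a" "T' a s" using A(2) by blast
        then show ?thesis using that[of u] conn_mono[of T' A u a "insert s A"] by (blast intro: conn.step)
      qed (use that[of s] in \<open>auto intro: conn.start\<close>)
    qed
    \<comment> \<open>From the bottom through the explored vacant region to \<open>s\<close>, then
      along \<open>Z\<close> up to its first visit to column \<open>l\<close>.\<close>
    define Y where "Y = insert s A \<union> insert u1 {v \<in> Z. fst v < l}"
    have "conn T' Y u0 s" using u0(2) by (rule conn_mono) (auto simp: Y_def)
    moreover have "conn T' Y s u1" using u1(3) by (rule conn_mono) (auto simp: Y_def)
    ultimately have Yc: "conn T' Y u0 u1" by (rule conn_trans')
    have "v \<in> B" if "v \<in> Z" "fst v \<le> l" for v using that Z(1) l by (auto simp: B_def B'_def mem_rbox)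
    then have YB: "Y \<subseteq> B" using A(1) sB u1 by (auto simp: Y_def B_def)
    \<comment> \<open>A site of \<open>P\<close> on \<open>Z\<close> would be near the mirror image
      but not near \<open>Q\<close>. Up to column \<open>l\<close> this is impossible: it would lie
      in column \<open>l\<close> next to the image of some site of \<open>Q\<close> in that same
      column, and hence be near that site itself.\<close>
    have ZP: "v \<notin> P" if v: "v \<in> Z" "fst v \<le> l" for v
    proof
      assume vP: "v \<in> P"
      then have "v \<in> nbhd T M" "v \<notin> nbhd T Q" using v(1) Z(1) by (auto simp: O2_def O3_def)
      then obtain p where p: "p \<in> Q" "mirror (2*l+1) p = v \<or> T (mirror (2*l+1) p) v"
        by (auto simp: nbhd_def M_def)
      have "fst p \<le> l" using Qb p(1) by blast
      then have t: "T (mirror (2*l+1) p) v" using p(2) v(2) by auto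
      have "fst p = l" "fst v = l" using matching_steps(1)[OF m t] v(2) \<open>fst p \<le> l\<close> by auto
      then have "p = v \<or> T p v"
        using t m by (auto simp: matching_def site_adj_def star_adj_def prod_eq_iff)
      then show False using p(1) \<open>v \<notin> nbhd T Q\<close> by (auto simp: nbhd_def)
    qed
    have YP: "P \<inter> Y = {}"
      using ZP u1 G(2) P(1) sAG by (auto simp: Y_def)
    \<comment> \<open>Above \<open>e\<close>, the end \<open>u1\<close> would make \<open>Y\<close>
      a dual path crossing \<open>P\<close>. Below \<open>e\<close>, nothing of \<open>Q\<close>
      lies beneath \<open>u1\<close>, because \<open>P\<close> meets column \<open>l\<close> only in
      \<open>e\<close>; then \<open>u1\<close> belongs to \<open>Low\<close>.\<close>
    have "\<not> snd e < snd u1"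
    proof
      assume "snd e < snd u1"
      then have "P \<inter> Y \<noteq> {}"
        using PB u P(3) YB Yc u0 u1(2) unfolding B_def
        by (intro crossing_meets_ends[OF m, of P "-l" l "-l" l u e Y u0 u1]) auto
      then show False using YP by blast
    qed
    moreover have "snd u1 \<noteq> snd e"
    proof
      assume "snd u1 = snd e"
      then have "u1 = e" using u1(2) P(3) by (simp add: prod_eq_iff)
      then show False using ZP[OF u1(1)] u1(2) we Q(1) by auto
    qed
    ultimately have "(l, k) \<notin> Q" if "k \<le> snd u1" for k using P(2)[of "(l, k)"] Q(1) that by auto
    moreover have "- l \<le> snd u1" "snd u1 \<le> l" "u1 \<notin> O2" using u1(1) Z(1) by (auto simp: B'_def mem_rbox)
    ultimately have "u1 \<in> Low" using u1(2) l by (intro col[of u1 l]) auto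
    then show False using \<open>u1 \<notin> O2\<close> by (simp add: O2_def)
  qed (use l in auto)
qed

lemma hcrossI: "conn T (S \<inter> rbox a b c d) x y \<Longrightarrow> fst x = a \<Longrightarrow> fst y = b \<Longrightarrow> hcross T a b c d S"
  unfolding hcross_def by blast

lemma vcrossI: "conn T (S \<inter> rbox a b c d) x y \<Longrightarrow> snd x = c \<Longrightarrow> snd y = d \<Longrightarrow> vcross T a b c d S"
  unfolding vcross_def by blast

lemma hcross_mono: "hcross T a b c d S \<Longrightarrow> S \<subseteq> S' \<Longrightarrow> hcross T a b c d S'"
  using conn_mono[of T "S \<inter> rbox a b c d" _ _ "S' \<inter> rbox a b c d"] unfolding hcross_def by blast

lemma vcross_mono: "vcross T a b c d S \<Longrightarrow> S \<subseteq> S' \<Longrightarrow> vcross T a b c d S'"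
  using conn_mono[of T "S \<inter> rbox a b c d" _ _ "S' \<inter> rbox a b c d"] unfolding vcross_def by blast

lemma incr_on_hcross: "incr_on L (hcross T a b c d)"
  unfolding incr_on_def using hcross_mono by blast

lemma incr_on_vcross: "incr_on L (vcross T a b c d)"
  unfolding incr_on_def using vcross_mono by blast

lemma hcross_Int: "rbox a b c d \<subseteq> L \<Longrightarrow> hcross T a b c d (S \<inter> L) \<longleftrightarrow> hcross T a b c d S"
  unfolding hcross_def by (simp add: Int_assoc Int_absorb1)

lemma vcross_Int: "rbox a b c d \<subseteq> L \<Longrightarrow> vcross T a b c d (S \<inter> L) \<longleftrightarrow> vcross T a b c d S"
  unfolding vcross_def by (simp add: Int_assoc Int_absorb1)

section \<open>Crossing probabilities\<close>

definition shift :: "int \<Rightarrow> int \<Rightarrow> site \<Rightarrow> site" where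
  "shift i j v = (fst v + i, snd v + j)"

lemma shift_simps [simp]: "fst (shift i j v) = fst v + i" "snd (shift i j v) = snd v + j"
  by (simp_all add: shift_def)

lemma inj_shift: "inj (shift i j)"
  by (auto simp: inj_on_def shift_def prod_eq_iff)

lemma shift_shift: "shift i j (shift i' j' v) = shift (i + i') (j + j') v"
  by (simp add: shift_def)

lemma shift_0: "shift 0 0 v = v"
  by (simp add: shift_def)

lemma matching_shift: "matching T T' \<Longrightarrow> T u v \<Longrightarrow> T (shift i j u) (shift i j v)"
  by (auto simp: matching_def site_adj_def star_adj_def shift_def prod_eq_iff)

lemma conn_image_Int:
  assumes "\<And>u v. T u v \<Longrightarrow> T (f u) (f v)" "conn T (S \<inter> B) x y" "f ` B \<subseteq> B'"
  shows "conn T (f ` S \<inter> B') (f x) (f y)"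
  by (rule conn_mono[OF conn_map[where \<phi> = f and T = T and T' = T and S = "S \<inter> B", OF assms(1,2)]]) (use assms(3) in auto)

lemma shift_rbox: "shift i j ` rbox a b c d = rbox (a + i) (b + i) (c + j) (d + j)"
proof
  show "rbox (a + i) (b + i) (c + j) (d + j) \<subseteq> shift i j ` rbox a b c d"
  proof
    fix v assume "v \<in> rbox (a + i) (b + i) (c + j) (d + j)"
    then show "v \<in> shift i j ` rbox a b c d"
      by (intro image_eqI[of _ _ "shift (-i) (-j) v"]) (auto simp: mem_rbox shift_def)
  qed
qed (auto simp: mem_rbox)

lemma hcross_shift:
  assumes m: "matching T T'"
  shows "hcross T (a + i) (b + i) (c + j) (d + j) (shift i j ` S) \<longleftrightarrow> hcross T a b c d S"
proof -
  have *: "hcross T (a + i) (b + i) (c + j) (d + j) (shift i j ` S)" if h: "hcross T a b c d S" for a b c d i j S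
  proof -
    obtain x y where xy: "conn T (S \<inter> rbox a b c d) x y" "fst x = a" "fst y = b"
      using h by (auto simp: hcross_def)
    have "conn T (shift i j ` S \<inter> rbox (a + i) (b + i) (c + j) (d + j)) (shift i j x) (shift i j y)"
      by (rule conn_image_Int[OF matching_shift[OF m] xy(1)]) (simp_all add: shift_rbox)
    then show ?thesis by (rule hcrossI) (use xy in simp_all)
  qed
  have "shift (-i) (-j) ` shift i j ` S = S"
    by (simp add: image_image shift_shift shift_0)
  then show ?thesis using *[of a b c d S i j] *[of "a+i" "b+i" "c+j" "d+j" "shift i j ` S" "-i" "-j"]
    by auto
qed

lemma vcross_swap:
  assumes m: "matching T T'"
  shows "vcross T a b c d (prod.swap ` S) \<longleftrightarrow> hcross T c d a b S"
proof
  assume "vcross T a b c d (prod.swap ` S)"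
  then obtain x y where xy: "conn T (prod.swap ` S \<inter> rbox a b c d) x y" "snd x = c" "snd y = d"
    by (auto simp: vcross_def)
  have "conn T (prod.swap ` (prod.swap ` S \<inter> rbox a b c d)) (prod.swap x) (prod.swap y)"
    by (rule conn_swap[OF m xy(1)])
  moreover have "prod.swap ` (prod.swap ` S \<inter> rbox a b c d) \<subseteq> S \<inter> rbox c d a b"
    by (auto simp: mem_rbox)
  ultimately have "conn T (S \<inter> rbox c d a b) (prod.swap x) (prod.swap y)" by (rule conn_mono)
  then show "hcross T c d a b S" by (rule hcrossI) (use xy in simp_all)
next
  assume "hcross T c d a b S"
  then obtain x y where xy: "conn T (S \<inter> rbox c d a b) x y" "fst x = c" "fst y = d"
    by (auto simp: hcross_def)
  have "conn T (prod.swap ` (S \<inter> rbox c d a b)) (prod.swap x) (prod.swap y)"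
    by (rule conn_swap[OF m xy(1)])
  moreover have "prod.swap ` (S \<inter> rbox c d a b) \<subseteq> prod.swap ` S \<inter> rbox a b c d"
    by (auto simp: mem_rbox)
  ultimately have "conn T (prod.swap ` S \<inter> rbox a b c d) (prod.swap x) (prod.swap y)" by (rule conn_mono)
  then show "vcross T a b c d (prod.swap ` S)" by (rule vcrossI) (use xy in simp_all)
qed

definition hprob :: "(site \<Rightarrow> site \<Rightarrow> bool) \<Rightarrow> real \<Rightarrow> int \<Rightarrow> int \<Rightarrow> real" where
  "hprob T q w h = pr q (rbox 0 w 0 h) (hcross T 0 w 0 h)"

lemma pr_hcross:
  assumes m: "matching T T'" and L: "finite L" "rbox a b c d \<subseteq> L"
  shows "pr q L (hcross T a b c d) = hprob T q (b - a) (d - c)"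
proof -
  have "pr q L (hcross T a b c d) = pr q (rbox a b c d) (hcross T a b c d)"
    by (rule pr_window[OF L]) (simp add: hcross_Int)
  also have "rbox a b c d = shift a c ` rbox 0 (b - a) 0 (d - c)" by (simp add: shift_rbox)
  also have "pr q (shift a c ` rbox 0 (b - a) 0 (d - c)) (hcross T a b c d)
      = pr q (rbox 0 (b - a) 0 (d - c)) (\<lambda>S. hcross T a b c d (shift a c ` S))"
    by (rule pr_image) (use inj_shift inj_on_subset in blast)
  also have "\<dots> = hprob T q (b - a) (d - c)"
    unfolding hprob_def using hcross_shift[OF m, of 0 a "b - a" 0 c "d - c"]
    by (intro pr_cong) simp
  finally show ?thesis .
qed

lemma pr_vcross:
  assumes m: "matching T T'" and L: "finite L" "rbox a b c d \<subseteq> L"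
  shows "pr q L (vcross T a b c d) = hprob T q (d - c) (b - a)"
proof -
  have "pr q L (vcross T a b c d) = pr q (rbox a b c d) (vcross T a b c d)"
    by (rule pr_window[OF L]) (simp add: vcross_Int)
  also have "rbox a b c d = prod.swap ` rbox c d a b" by (simp add: swap_rbox)
  also have "pr q (prod.swap ` rbox c d a b) (vcross T a b c d)
      = pr q (rbox c d a b) (\<lambda>S. vcross T a b c d (prod.swap ` S))"
    by (rule pr_image) (auto simp: inj_on_def)
  also have "\<dots> = pr q (rbox c d a b) (hcross T c d a b)"
    using vcross_swap[OF m] by (intro pr_cong) simp
  also have "\<dots> = hprob T q (d - c) (b - a)" by (rule pr_hcross[OF m]) auto
  finally show ?thesis .
qed

lemma hprob_bounds: "0 \<le> q \<Longrightarrow> q \<le> 1 \<Longrightarrow> 0 \<le> hprob T q w h" "0 \<le> q \<Longrightarrow> q \<le> 1 \<Longrightarrow> hprob T q w h \<le> 1"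
  unfolding hprob_def by (auto intro: pr_nonneg pr_le_1)

lemma hprob_duality:
  assumes m: "matching T T'" and wh: "0 \<le> w" "0 \<le> h"
  shows "hprob T q w h = 1 - hprob T' (1 - q) h w"
proof -
  let ?L = "rbox 0 w 0 h"
  have eq: "hcross T 0 w 0 h S \<longleftrightarrow> \<not> vcross T' 0 w 0 h (?L - S)" for S
  proof
    assume "hcross T 0 w 0 h S"
    then obtain x y where xy: "conn T (S \<inter> ?L) x y" "fst x = 0" "fst y = w" by (auto simp: hcross_def)
    show "\<not> vcross T' 0 w 0 h (?L - S)"
    proof
      assume "vcross T' 0 w 0 h (?L - S)"
      then obtain u v where uv: "conn T' ((?L - S) \<inter> ?L) u v" "snd u = 0" "snd v = h" by (auto simp: vcross_def)
      have "(S \<inter> ?L) \<inter> ((?L - S) \<inter> ?L) \<noteq> {}"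
        by (rule crossing_meets[OF m _ xy _ uv]) auto
      then show False by blast
    qed
  next
    assume n: "\<not> vcross T' 0 w 0 h (?L - S)"
    show "hcross T 0 w 0 h S"
    proof (rule crossing_exists[OF m wh, of S])
      fix x y assume "conn T' (?L - S) x y" "snd x = 0" "snd y = h"
      moreover have "(?L - S) \<inter> ?L = ?L - S" by auto
      ultimately show ?thesis using n unfolding vcross_def by metis
    qed (rule hcrossI)
  qed
  have "hprob T q w h = 1 - pr q ?L (\<lambda>S. vcross T' 0 w 0 h (?L - S))"
    unfolding hprob_def by (subst pr_not[symmetric]) (auto intro: pr_cong simp: eq)
  also have "pr q ?L (\<lambda>S. vcross T' 0 w 0 h (?L - S)) = pr (1 - q) ?L (vcross T' 0 w 0 h)"
    by (rule pr_complement) simp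
  also have "\<dots> = hprob T' (1 - q) h w"
    using pr_vcross[OF matching_sym[OF m], of ?L 0 w 0 h] by simp
  finally show ?thesis .
qed

text \<open>Used with a reflection \<open>f\<close> of the window: \<open>E\<close> and its
  reflected copy are equally likely, and the crossing event \<open>H\<close> forces one of the
  two.\<close>

lemma square_root_symm:
  assumes L: "finite L" "f ` L = L" "inj_on f L" and q: "0 \<le> q" "q \<le> 1"
    and E: "incr_on L E" and H: "\<And>S. S \<subseteq> L \<Longrightarrow> H S \<Longrightarrow> E S \<or> E (f ` S)"
  shows "1 - sqrt (1 - pr q L H) \<le> pr q L E"
proof (rule square_root_trick[OF L(1) q E])
  show "incr_on L (\<lambda>S. E (f ` S))"
    unfolding incr_on_def
  proof (intro allI impI)
    fix S S' assume "S \<subseteq> S'" "S' \<subseteq> L" "E (f ` S)"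
    moreover from this have "f ` S \<subseteq> f ` S'" "f ` S' \<subseteq> L" using L(2) by blast+
    ultimately show "E (f ` S')" using incr_onD[OF E] by blast
  qed
  show "pr q L E = pr q L (\<lambda>S. E (f ` S))"
    using pr_image[OF L(3), of q E] L(2) by simp
  show "pr q L H \<le> pr q L (\<lambda>S. E S \<or> E (f ` S))"
    by (rule pr_mono[OF q H])
qed

section \<open>The Russo-Seymour-Welsh inequality\<close>

text \<open>The dual vacant cluster of the bottom side, together with its occupied boundary, takes
  the place of a lowest crossing. This avoids ordering the crossings, and the revealed region is
  determined by its own content.\<close>

definition explored :: "(site \<Rightarrow> site \<Rightarrow> bool) \<Rightarrow> int \<Rightarrow> site set \<Rightarrow> site set" where
  "explored T' l S = {v. \<exists>u. snd u = - l \<and> conn T' (rbox (-l) l (-l) l - S) u v}"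

definition shell :: "(site \<Rightarrow> site \<Rightarrow> bool) \<Rightarrow> int \<Rightarrow> site set \<Rightarrow> site set" where
  "shell T' l S = {g \<in> S \<inter> rbox (-l) l (-l) l. snd g = - l \<or> (\<exists>a\<in>explored T' l S. T' a g)}"

lemma explored_subset: "explored T' l S \<subseteq> rbox (-l) l (-l) l - S"
  unfolding explored_def using conn_mem(2) by blast

lemma shell_subset: "shell T' l S \<subseteq> S \<inter> rbox (-l) l (-l) l"
  unfolding shell_def by blast

lemma explored_bottom:
  assumes "u \<in> rbox (-l) l (-l) l - S" "snd u = - l" shows "u \<in> explored T' l S"
  unfolding explored_def using assms conn.start by blast

lemma explored_step:
  assumes "a \<in> explored T' l S" "T' a v" "v \<in> rbox (-l) l (-l) l - S" shows "v \<in> explored T' l S"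
  using assms unfolding explored_def by (blast intro: conn.step)

lemma explored_conn:
  assumes "a \<in> explored T' l S" shows "\<exists>u. snd u = - l \<and> conn T' (explored T' l S) u a"
proof -
  obtain u where u: "snd u = - l" "conn T' (rbox (-l) l (-l) l - S) u a"
    using assms by (auto simp: explored_def)
  from u(2) have "conn T' (explored T' l S) u a"
  proof induction
    case start
    then show ?case using u(1) by (intro conn.start explored_bottom)
  next
    case (step v v')
    then have "v \<in> explored T' l S" using conn_mem(2) by blast
    then have "v' \<in> explored T' l S" using explored_step step by blast
    then show ?case using step by (blast intro: conn.step)
  qed
  then show ?thesis using u(1) by blast
qed

text \<open>Growing the vacant cluster only inspects its own sites and the occupied sites next to it
  or in the bottom row, all of which lie in \<open>D\<close>.\<close>

lemma explored_stop:
  fixes S S' T' l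
  defines "D \<equiv> explored T' l S \<union> shell T' l S"
  assumes eq: "S \<inter> D = S' \<inter> D"
  shows "explored T' l S' = explored T' l S" "shell T' l S' = shell T' l S"
proof -
  let ?B = "rbox (-l) l (-l) l"
  have DS: "v \<in> S \<longleftrightarrow> v \<in> S'" if "v \<in> D" for v using eq that by blast
  have vac: "v \<notin> S" if v: "v \<in> ?B" "v \<notin> S'" "snd v = - l \<or> (\<exists>a\<in>explored T' l S. T' a v)" for v
  proof
    assume "v \<in> S"
    then have "v \<in> D" using v unfolding D_def shell_def by blast
    then show False using DS v \<open>v \<in> S\<close> by blast
  qed
  show *: "explored T' l S' = explored T' l S"
  proof
    show "explored T' l S \<subseteq> explored T' l S'"
    proof
      fix a assume "a \<in> explored T' l S"
      then obtain u where u: "snd u = - l" "conn T' (explored T' l S) u a" using explored_conn by blast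
      have "explored T' l S \<subseteq> ?B - S'"
        using explored_subset[of T' l S] DS unfolding D_def by blast
      then have "conn T' (?B - S') u a" using u(2) conn_mono by blast
      then show "a \<in> explored T' l S'" using u(1) unfolding explored_def by blast
    qed
    show "explored T' l S' \<subseteq> explored T' l S"
    proof
      fix a assume "a \<in> explored T' l S'"
      then obtain u where u: "snd u = - l" "conn T' (?B - S') u a" by (auto simp: explored_def)
      from u(2) show "a \<in> explored T' l S"
      proof induction
        case start
        then show ?case using u(1) vac[of u] by (intro explored_bottom) auto
      next
        case (step v v')
        then show ?case using vac[of v'] by (intro explored_step[of v T' l S v']) auto
      qed
    qed
  qed
  show "shell T' l S' = shell T' l S"
  proof
    show "shell T' l S \<subseteq> shell T' l S'"
    proof
      fix g assume g: "g \<in> shell T' l S"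
      then have "g \<in> S'" using DS[of g] shell_subset[of T' l S] unfolding D_def by blast
      then show "g \<in> shell T' l S'" using g * unfolding shell_def by blast
    qed
    show "shell T' l S' \<subseteq> shell T' l S"
    proof
      fix g assume g: "g \<in> shell T' l S'"
      then have g': "g \<in> ?B" "g \<in> S'" "snd g = - l \<or> (\<exists>a\<in>explored T' l S. T' a g)"
        using * unfolding shell_def by blast+
      have "g \<in> S"
      proof (rule ccontr)
        assume "g \<notin> S"
        then have "g \<in> explored T' l S" using g' explored_bottom explored_step by blast
        then show False using DS[of g] g' \<open>g \<notin> S\<close> unfolding D_def by blast
      qed
      then show "g \<in> shell T' l S" using g' unfolding shell_def by blast
    qed
  qed
qed

text \<open>Otherwise a dual path from bottom to top avoids the shell. Each of its sites in turn is
  explored, for an occupied one would belong to the shell; so the vacant cluster reaches the top,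
  which the crossing in \<open>S\<close> forbids.\<close>

lemma shell_crossing:
  assumes m: "matching T T'" and l: "0 < l"
    and h: "hcross T (-l) l (-l) l S"
  obtains u v where "conn T (shell T' l S) u v" "fst u = - l" "fst v = l"
proof (rule crossing_exists[OF m, of "-l" l "-l" l "shell T' l S"])
  let ?B = "rbox (-l) l (-l) l"
  fix x y assume xy: "conn T (shell T' l S \<inter> ?B) x y" "fst x = - l" "fst y = l"
  have "shell T' l S \<inter> ?B = shell T' l S" using shell_subset by blast
  then show thesis using that xy by simp
next
  let ?B = "rbox (-l) l (-l) l"
  fix x y assume xy: "conn T' (?B - shell T' l S) x y" "snd x = - l" "snd y = l"
  from xy(1) have "y \<in> explored T' l S"
  proof induction
    case start
    then show ?case using xy(2) unfolding shell_def by (intro explored_bottom) auto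
  next
    case (step v v')
    then show ?case unfolding shell_def by (intro explored_step[of v T' l S v']) auto
  qed
  then obtain u where u: "snd u = - l" "conn T' (?B - S) u y" by (auto simp: explored_def)
  obtain a b where ab: "conn T (S \<inter> ?B) a b" "fst a = - l" "fst b = l" using h by (auto simp: hcross_def)
  have "(S \<inter> ?B) \<inter> (?B - S) \<noteq> {}"
    by (rule crossing_meets[OF m _ ab _ u(2,1) xy(3)]) auto
  then show thesis by blast
qed (use l in auto)

definition flip :: "site \<Rightarrow> site" where
  "flip v = (fst v, - snd v)"

lemma flip_simps [simp]: "fst (flip v) = fst v" "snd (flip v) = - snd v" "flip (flip v) = v"
  by (simp_all add: flip_def)

lemma inj_flip: "inj_on flip S"
  by (metis flip_simps(3) inj_onI)

lemma inj_mirror: "inj_on (mirror k) S"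
  by (metis mirror_simps(3) inj_onI)

lemma matching_flip: "matching T T' \<Longrightarrow> T u v \<Longrightarrow> T (flip u) (flip v)"
  by (auto simp: matching_def site_adj_def star_adj_def flip_def prod_eq_iff)

lemma flip_rbox: "flip ` rbox a b (-c) c = rbox a b (-c) c"
proof -
  have "v \<in> flip ` rbox a b (-c) c" if "v \<in> rbox a b (-c) c" for v
    using that by (intro image_eqI[of _ _ "flip v"]) (auto simp: mem_rbox)
  then show ?thesis by (auto simp: mem_rbox)
qed

lemma mirror_rbox: "mirror k ` rbox 0 k c d = rbox 0 k c d"
proof -
  have "v \<in> mirror k ` rbox 0 k c d" if "v \<in> rbox 0 k c d" for v
    using that by (intro image_eqI[of _ _ "mirror k v"]) (auto simp: mem_rbox)
  then show ?thesis by (auto simp: mem_rbox)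
qed

lemma conn_flip: "matching T T' \<Longrightarrow> conn T S x y \<Longrightarrow> conn T (flip ` S) (flip x) (flip y)"
  by (rule conn_map) (auto intro: matching_flip)

lemma crossing_split_mono: "crossing_split T l S P Q w e \<Longrightarrow> S \<subseteq> S' \<Longrightarrow> crossing_split T l S' P Q w e"
  unfolding crossing_split_def by blast

lemma crossing_split_flip:
  assumes m: "matching T T'" and cs: "crossing_split T l S P Q w e"
  shows "crossing_split T l (flip ` S) (flip ` P) (flip ` Q) (flip w) (flip e)"
proof -
  obtain u where u: "fst u = - l" "conn T P u e" using cs by (auto simp: crossing_split_def)
  have "fst (flip u) = - l \<and> conn T (flip ` P) (flip u) (flip e)" using u conn_flip[OF m] by simp
  then have "\<exists>u. fst u = - l \<and> conn T (flip ` P) u (flip e)" by blast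
  moreover have "\<forall>v\<in>flip ` Q. conn T (flip ` Q) (flip w) v"
    using cs conn_flip[OF m] by (auto simp: crossing_split_def)
  moreover have "conn T (flip ` Q) (flip w) (flip e)"
    using cs conn_flip[OF m] by (auto simp: crossing_split_def)
  ultimately show ?thesis using cs unfolding crossing_split_def by auto
qed

section \<open>Increasing events bounded by reflection symmetry\<close>

text \<open>Any crossing of the configuration may serve as witness, which makes the event
  increasing. The crossing chosen in the shell may visit column \<open>0\<close> last at a different
  height; \<open>left_to_topI\<close> bridges the gap.\<close>

definition half_cross :: "(site \<Rightarrow> site \<Rightarrow> bool) \<Rightarrow> int \<Rightarrow> site set \<Rightarrow> bool" where
  "half_cross T l S \<longleftrightarrow> (\<exists>P Q w e. crossing_split T l (S \<inter> rbox (-l) l (-l) l) P Q w e \<and> snd w \<le> 0)"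

lemma half_cross_mono: "half_cross T l S \<Longrightarrow> S \<subseteq> S' \<Longrightarrow> half_cross T l S'"
  using crossing_split_mono[of T l "S \<inter> rbox (-l) l (-l) l" _ _ _ _ "S' \<inter> rbox (-l) l (-l) l"]
  unfolding half_cross_def by blast

lemma half_cross_cases:
  assumes m: "matching T T'" and l: "0 < l" and h: "hcross T (-l) l (-l) l S"
  shows "half_cross T l S \<or> half_cross T l (flip ` S)"
proof -
  let ?B = "rbox (-l) l (-l) l"
  obtain u v where uv: "conn T (S \<inter> ?B) u v" "fst u = - l" "fst v = l" using h by (auto simp: hcross_def)
  obtain P Q w e where cs: "crossing_split T l (S \<inter> ?B) P Q w e"
    by (rule crossing_split_exists[OF m l uv])
  show ?thesis
  proof (cases "snd w \<le> 0")
    case True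
    then show ?thesis using cs unfolding half_cross_def by blast
  next
    case False
    have "flip ` (S \<inter> ?B) \<subseteq> flip ` S \<inter> ?B" using flip_rbox by blast
    then have "crossing_split T l (flip ` S \<inter> ?B) (flip ` P) (flip ` Q) (flip w) (flip e)"
      by (rule crossing_split_mono[OF crossing_split_flip[OF m cs]])
    moreover have "snd (flip w) \<le> 0" using False by simp
    ultimately show ?thesis unfolding half_cross_def by blast
  qed
qed

lemma half_cross_hcross:
  assumes "half_cross T l S" shows "hcross T (-l) l (-l) l S"
proof -
  obtain P u e where "P \<subseteq> S \<inter> rbox (-l) l (-l) l" "conn T P u e" "fst u = - l" "fst e = l"
    using assms unfolding half_cross_def crossing_split_def by blast
  then show ?thesis using conn_mono by (intro hcrossI)
qed

text \<open>
  The first contact of the path with the neighbourhood of \<open>Q\<close> and its mirror image is a contact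
  with \<open>Q\<close>; by symmetry this is at least as likely as for the mirror image.
\<close>

definition top_hit :: "(site \<Rightarrow> site \<Rightarrow> bool) \<Rightarrow> int \<Rightarrow> site set \<Rightarrow> site set \<Rightarrow> bool" where
  "top_hit T l Q R \<longleftrightarrow> (\<exists>t z. snd t = l \<and> z \<in> nbhd T Q \<and>
     conn T (insert z {v \<in> R. v \<notin> nbhd T (Q \<union> mirror (2*l+1) ` Q)}) t z \<and> z \<in> R)"

lemma top_hit_mono: assumes "top_hit T l Q R" "R \<subseteq> R'" shows "top_hit T l Q R'"
proof -
  let ?N = "nbhd T (Q \<union> mirror (2*l+1) ` Q)"
  obtain t z where "snd t = l" "z \<in> nbhd T Q" "conn T (insert z {v \<in> R. v \<notin> ?N}) t z" "z \<in> R"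
    using assms(1) by (auto simp: top_hit_def)
  moreover have "insert z {v \<in> R. v \<notin> ?N} \<subseteq> insert z {v \<in> R'. v \<notin> ?N}" using assms(2) by blast
  ultimately show ?thesis unfolding top_hit_def using assms(2) conn_mono by blast
qed

text \<open>\<open>Q\<close> and its image form a barrier across the whole box, so a vertical
  crossing comes near it. The first contact from the top is near one of the two halves, and
  reflection exchanges them.\<close>

lemma top_hit_cases:
  assumes m: "matching T T'" and l: "0 < l"
    and cs: "crossing_split T l S P Q w e" and S: "S \<subseteq> rbox (-l) l (-l) l"
    and v: "vcross T 0 (2*l+1) (-l) l R" and R: "R \<subseteq> rbox 0 (2*l+1) (-l) l"
  shows "top_hit T l Q R \<or> top_hit T l Q (mirror (2*l+1) ` R)"
proof -
  let ?f = "mirror (2*l+1)"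
  let ?QM = "Q \<union> ?f ` Q"
  obtain x y where xy: "conn T (R \<inter> rbox 0 (2*l+1) (-l) l) x y" "snd x = - l" "snd y = l"
    using v by (auto simp: vcross_def)
  then have "conn T R x y" using R by (simp add: Int_absorb2)
  then have yx: "conn T R y x" using matching_conn_sym[OF m] by blast
  obtain X where X: "X \<subseteq> R" "conn T X y x" "\<And>z. z \<in> X \<Longrightarrow> conn T X y z"
    using conn_path_set[OF yx] by blast
  have w0: "fst w = 0" using cs by (simp add: crossing_split_def)
  have "nbhd T ?QM \<inter> X \<noteq> {}"
    using mirror_crossing[OF m cs S] X(1) R matching_conn_sym[OF m X(2)] xy w0
    by (intro crossing_near[OF m, of ?QM 0 "2*l+1" "-l" l w "?f w" X x y]) auto
  then obtain z0 where z0: "z0 \<in> X" "z0 \<in> nbhd T ?QM" by blast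
  obtain z where z: "z \<in> nbhd T ?QM" "z \<in> X" "conn T (insert z (X - nbhd T ?QM)) y z"
    by (rule conn_first_hit[OF X(3)[OF z0(1)] z0(2)])
  have zR: "z \<in> R" using z X by blast
  have "insert z (X - nbhd T ?QM) \<subseteq> insert z {v \<in> R. v \<notin> nbhd T ?QM}" using X by blast
  then have c: "conn T (insert z {v \<in> R. v \<notin> nbhd T ?QM}) y z" using z(3) conn_mono by blast
  have "z \<in> nbhd T Q \<or> z \<in> nbhd T (?f ` Q)" using z(1) by (auto simp: nbhd_def)
  then show ?thesis
  proof
    assume "z \<in> nbhd T Q"
    then show ?thesis using c xy zR unfolding top_hit_def by blast
  next
    assume "z \<in> nbhd T (?f ` Q)"
    then have zf: "?f z \<in> nbhd T Q" using nbhd_mirror[OF m] mirror_image_iff by metis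
    have inv: "?f ` ?QM = ?QM" by (auto simp: image_Un image_image)
    have "v \<in> nbhd T ?QM \<longleftrightarrow> ?f v \<in> nbhd T ?QM" for v
      using nbhd_mirror[OF m, of "2*l+1" ?QM] mirror_image_iff[of v "2*l+1" "nbhd T ?QM"] inv by simp
    then have "?f ` insert z {v \<in> R. v \<notin> nbhd T ?QM} \<subseteq> insert (?f z) {v \<in> ?f ` R. v \<notin> nbhd T ?QM}"
      by blast
    then have "conn T (insert (?f z) {v \<in> ?f ` R. v \<notin> nbhd T ?QM}) (?f y) (?f z)"
      using conn_mirror[OF m c] conn_mono by blast
    moreover have "snd (?f y) = l" "?f z \<in> ?f ` R" using xy zR by auto
    ultimately show ?thesis using zf unfolding top_hit_def by blast
  qed
qed

definition left_to_top :: "(site \<Rightarrow> site \<Rightarrow> bool) \<Rightarrow> int \<Rightarrow> site set \<Rightarrow> bool" where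
  "left_to_top T l S \<longleftrightarrow> (\<exists>u w t. fst u = - l \<and> conn T (S \<inter> rbox (-l) l (-l) l) u w \<and> fst w = 0 \<and>
     snd w \<le> 0 \<and> conn T (S \<inter> rbox 0 (2*l+1) (-l) l) w t \<and> snd t = l)"

lemma left_to_top_mono: "left_to_top T l S \<Longrightarrow> S \<subseteq> S' \<Longrightarrow> left_to_top T l S'"
  using conn_mono[of T "S \<inter> rbox (-l) l (-l) l" _ _ "S' \<inter> rbox (-l) l (-l) l"]
    conn_mono[of T "S \<inter> rbox 0 (2*l+1) (-l) l" _ _ "S' \<inter> rbox 0 (2*l+1) (-l) l"]
  unfolding left_to_top_def by blast

text \<open>
  If the crossing \<open>P\<close> of the shell has its last visit to the column \<open>0\<close> above the axis, then the
  crossing provided by \<open>half_cross\<close> must meet \<open>Q\<close>, because \<open>P\<close> borders the region explored from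
  below and so cannot end above it.
\<close>

lemma left_to_topI:
  assumes m: "matching T T'" and l: "0 < l"
    and h: "half_cross T l S"
    and cs: "crossing_split T l (shell T' l S) P Q w e"
    and t: "snd t = l" "g \<in> nbhd T Q" "conn T (S \<inter> rbox 0 (2*l+1) (-l) l) t g"
  shows "left_to_top T l S"
proof -
  let ?B = "rbox (-l) l (-l) l" and ?B' = "rbox 0 (2*l+1) (-l) l" and ?H = "rbox 0 l (-l) l"
  have HB: "?H \<subseteq> ?B" "?H \<subseteq> ?B'" using l by (auto simp: mem_rbox)
  have shB: "shell T' l S \<subseteq> ?B" using shell_subset by blast
  have QH: "Q \<subseteq> ?H" by (rule crossing_split_rbox[OF cs shB])
  obtain u where u: "fst u = - l" "conn T P u e" using cs by (auto simp: crossing_split_def)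
  have PS: "Q \<subseteq> P" "P \<subseteq> S \<inter> ?B" using cs shell_subset unfolding crossing_split_def by blast+
  have Q: "fst w = 0" "fst e = l" "conn T Q w e" "\<And>v. v \<in> Q \<Longrightarrow> conn T Q w v"
    using cs by (auto simp: crossing_split_def)
  have QS: "Q \<subseteq> S \<inter> ?H" using QH PS by blast
  then have QS': "Q \<subseteq> S \<inter> ?B'" using HB by blast
  have uw: "conn T (S \<inter> ?B) u w"
  proof -
    have "conn T P e w" using matching_conn_sym[OF m Q(3)] PS(1) conn_mono by blast
    then have "conn T P u w" using u(2) conn_trans' by metis
    then show ?thesis using PS(2) conn_mono by blast
  qed
  have wt: "conn T (S \<inter> ?B') w t"
  proof -
    obtain v where v: "v \<in> Q" "v = g \<or> T v g" using t(2) by (auto simp: nbhd_def)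
    have "g \<in> S \<inter> ?B'" using conn_mem(2)[OF t(3)] .
    then have "conn T (S \<inter> ?B') v g" using v QS' by (auto intro: conn_edge conn.start)
    moreover have "conn T (S \<inter> ?B') w v" using Q(4)[OF v(1)] QS' conn_mono by blast
    moreover have "conn T (S \<inter> ?B') g t" using matching_conn_sym[OF m t(3)] .
    ultimately show ?thesis using conn_trans' by metis
  qed
  show ?thesis
  proof (cases "snd w \<le> 0")
    case True
    then show ?thesis using u(1) uw Q(1) wt t(1) unfolding left_to_top_def by blast
  next
    case False
    obtain P' Q' w' e' where cs': "crossing_split T l (S \<inter> ?B) P' Q' w' e'" "snd w' \<le> 0"
      using h unfolding half_cross_def by blast
    obtain u' where u': "fst u' = - l" "conn T P' u' e'" using cs' by (auto simp: crossing_split_def)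
    have PS': "Q' \<subseteq> P'" "P' \<subseteq> S \<inter> ?B" "\<And>v. v \<in> P' \<Longrightarrow> fst v = l \<Longrightarrow> v = e'"
      and Q': "fst w' = 0" "fst e' = l" "conn T Q' w' e'"
      using cs' by (auto simp: crossing_split_def)
    have QH': "Q' \<subseteq> S \<inter> ?H" using crossing_split_rbox[OF cs'(1)] PS' by blast
    have eG: "e \<in> shell T' l S" using cs conn_mem(2)[OF Q(3)] unfolding crossing_split_def by blast
    have "snd e \<le> snd e'"
    proof (rule ccontr)
      assume lt: "\<not> snd e \<le> snd e'"
      let ?A = "explored T' l S"
      have "\<exists>u0. snd u0 = - l \<and> conn T' (insert e ?A) u0 e"
      proof (cases "snd e = - l")
        case True
        then show ?thesis using conn.start[of e "insert e ?A" T'] by blast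
      next
        case False
        then obtain a where a: "a \<in> ?A" "T' a e" using eG unfolding shell_def by blast
        then obtain u0 where "snd u0 = - l" "conn T' ?A u0 a" using explored_conn by blast
        moreover from this(2) have "conn T' (insert e ?A) u0 a" by (rule conn_mono) blast
        ultimately show ?thesis using a by (blast intro: conn.step)
      qed
      then obtain u0 where u0: "snd u0 = - l" "conn T' (insert e ?A) u0 e" by blast
      have "insert e ?A \<subseteq> ?B" "P' \<subseteq> ?B" using eG shB explored_subset[of T' l S] PS'(2) by blast+
      then have "P' \<inter> insert e ?A \<noteq> {}"
        using u' Q' u0 Q(2) lt
        by (intro crossing_meets_ends[OF m, of P' "-l" l "-l" l u' e' "insert e ?A" u0 e]) simp_all
      moreover have "P' \<inter> ?A = {}" using PS'(2) explored_subset[of T' l S] by blast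
      ultimately have "e \<in> P'" by blast
      then show False using PS'(3) Q(2) lt by blast
    qed
    have ww: "conn T (S \<inter> ?H) w w'"
    proof (cases "snd e = snd e'")
      case True
      then have "e = e'" using Q(2) Q'(2) by (simp add: prod_eq_iff)
      then have "conn T (S \<inter> ?H) e w'"
        using matching_conn_sym[OF m Q'(3)] QH' conn_mono by blast
      moreover have "conn T (S \<inter> ?H) w e" using Q(3) QS conn_mono by blast
      ultimately show ?thesis using conn_trans' by metis
    next
      \<comment> \<open>In the right half, \<open>w\<close> is above \<open>w'\<close> on the left
        side while \<open>e\<close> is below \<open>e'\<close> on the right side, so
        \<open>Q\<close> and \<open>Q'\<close> have to cross.\<close>
      case ne: False
      have "conn T (Q \<union> Q') w w'"
        using Q Q' QS QH' False cs'(2) \<open>snd e \<le> snd e'\<close> ne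
        by (intro crossing_conn[OF m, of Q 0 l "-l" l w e Q' w' e']) auto
      then show ?thesis using QS QH' conn_mono by (metis Un_least)
    qed
    have "conn T (S \<inter> ?B) w w'" using ww HB conn_mono by (meson Int_mono order_refl)
    then have "conn T (S \<inter> ?B) u w'" using uw conn_trans' by metis
    moreover have "conn T (S \<inter> ?B') w' w"
      using matching_conn_sym[OF m ww] HB conn_mono by (meson Int_mono order_refl)
    then have "conn T (S \<inter> ?B') w' t" using wt conn_trans' by metis
    ultimately show ?thesis using u(1) Q'(1) cs'(2) t(1) unfolding left_to_top_def by blast
  qed
qed

definition upper_cross :: "(site \<Rightarrow> site \<Rightarrow> bool) \<Rightarrow> int \<Rightarrow> site set \<Rightarrow> bool" where
  "upper_cross T l S \<longleftrightarrow> (\<exists>x y. conn T (S \<inter> rbox 0 (2*l) (-l) l) x y \<and> fst x = 0 \<and> 0 \<le> snd x \<and> fst y = 2*l)"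

lemma upper_cross_mono: "upper_cross T l S \<Longrightarrow> S \<subseteq> S' \<Longrightarrow> upper_cross T l S'"
  using conn_mono[of T "S \<inter> rbox 0 (2*l) (-l) l" _ _ "S' \<inter> rbox 0 (2*l) (-l) l"]
  unfolding upper_cross_def by blast

lemma upper_cross_cases:
  assumes m: "matching T T'" and h: "hcross T 0 (2*l) (-l) l S"
  shows "upper_cross T l S \<or> upper_cross T l (flip ` S)"
proof -
  let ?B = "rbox 0 (2*l) (-l) l"
  obtain x y where xy: "conn T (S \<inter> ?B) x y" "fst x = 0" "fst y = 2*l" using h by (auto simp: hcross_def)
  show ?thesis
  proof (cases "0 \<le> snd x")
    case True
    then show ?thesis using xy unfolding upper_cross_def by blast
  next
    case False
    have "flip ` (S \<inter> ?B) \<subseteq> flip ` S \<inter> ?B" using flip_rbox by blast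
    then have "conn T (flip ` S \<inter> ?B) (flip x) (flip y)" using conn_flip[OF m xy(1)] conn_mono by blast
    moreover have "0 \<le> snd (flip x)" "fst (flip x) = 0" "fst (flip y) = 2*l" using False xy by auto
    ultimately show ?thesis unfolding upper_cross_def by blast
  qed
qed

text \<open>In column \<open>0\<close> the path to the top starts on or below the axis and the
  crossing to the right on or above it, so they are forced to connect unless the first one leaves
  the box of width \<open>2*l\<close>.\<close>

lemma join_crossings:
  assumes m: "matching T T'" and l: "0 < l" and lt: "left_to_top T l S" and up: "upper_cross T l S"
  shows "hcross T (-l) (2*l) (-l) l S"
proof -
  let ?C = "rbox (-l) (2*l) (-l) l" and ?H = "rbox 0 (2*l) (-l) l"
  obtain u w t where u: "fst u = - l" "conn T (S \<inter> rbox (-l) l (-l) l) u w" "fst w = 0" "snd w \<le> 0"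
    "conn T (S \<inter> rbox 0 (2*l+1) (-l) l) w t" "snd t = l"
    using lt unfolding left_to_top_def by blast
  obtain x y where xy: "conn T (S \<inter> ?H) x y" "fst x = 0" "0 \<le> snd x" "fst y = 2*l"
    using up unfolding upper_cross_def by blast
  have sub: "S \<inter> rbox (-l) l (-l) l \<subseteq> S \<inter> ?C" "S \<inter> ?H \<subseteq> S \<inter> ?C" using l by (auto simp: mem_rbox)
  have uw: "conn T (S \<inter> ?C) u w" using u(2) sub conn_mono by blast
  obtain P where P: "P \<subseteq> S \<inter> rbox 0 (2*l+1) (-l) l" "conn T P w t" "\<And>z. z \<in> P \<Longrightarrow> conn T P w z"
    using conn_path_set[OF u(5)] by blast
  have "\<exists>z. fst z = 2*l \<and> conn T (S \<inter> ?H) w z"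
  \<comment> \<open>The path to the top lives in a box that is one column wider. If it reaches
    column \<open>2*l\<close>, it provides the crossing by itself.\<close>
  proof (cases "\<exists>z\<in>P. 2*l \<le> fst z")
    case True
    then obtain z where z: "z \<in> P" "2*l \<le> fst z" by blast
    have st: "\<And>u v. T u v \<Longrightarrow> fst v \<le> fst u + 1" using matching_steps(1)[OF m] by fastforce
    have le: "fst w \<le> 2*l" using u l by simp
    obtain z' where z': "z' \<in> P" "fst z' = 2*l" "conn T (insert z' {v \<in> P. fst v < 2*l}) w z'"
      by (rule conn_first_level[of T fst, OF st P(3)[OF z(1)] le z(2)])
    have "insert z' {v \<in> P. fst v < 2*l} \<subseteq> S \<inter> ?H" using z' P(1) by (auto simp: mem_rbox)
    then show ?thesis using z' conn_mono by blast
  next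
    case False
    then have PH: "P \<subseteq> S \<inter> ?H" using P(1) by (force simp: mem_rbox)
    have "conn T (S \<inter> ?H) x w"
    proof (cases "snd w < snd x")
      case True
      have "conn T (S \<inter> ?H \<union> P) x w"
        using xy P(2) True u PH
        by (intro crossing_conn[OF m, of "S \<inter> ?H" 0 "2*l" "-l" l x y P w t]) auto
      then show ?thesis using PH by (simp add: Un_absorb2)
    next
      case False
      then have "x = w" using xy u by (simp add: prod_eq_iff)
      then show ?thesis using xy conn_mem conn.start by metis
    qed
    then have "conn T (S \<inter> ?H) w y" using xy matching_conn_sym[OF m] conn_trans' by metis
    then show ?thesis using xy by blast
  qed
  then obtain z where z: "fst z = 2*l" "conn T (S \<inter> ?H) w z" by blast
  have "conn T (S \<inter> ?C) u z" by (rule conn_trans'[OF uw conn_mono[OF z(2) sub(2)]])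
  then show ?thesis using u(1) z(1) by (rule hcrossI)
qed

lemma rbox_mono: "a' \<le> a \<Longrightarrow> b \<le> b' \<Longrightarrow> c' \<le> c \<Longrightarrow> d \<le> d' \<Longrightarrow> rbox a b c d \<subseteq> rbox a' b' c' d'"
  by (auto simp: mem_rbox)

lemma hcross_sub:
  assumes m: "matching T T'" and le: "a \<le> a'" "a' \<le> b'" "b' \<le> b" "c' \<le> c" "d \<le> d'"
    and h: "hcross T a b c d S"
  shows "hcross T a' b' c' d' S"
proof -
  have st: "\<And>u v. T u v \<Longrightarrow> T v u" "\<And>u v. T u v \<Longrightarrow> fst v \<le> fst u + 1"
    using matching_symp[OF m] matching_steps(1)[OF m] by (blast, fastforce)
  let ?S = "S \<inter> rbox a b c d"
  obtain x y where xy: "conn T ?S x y" "fst x = a" "fst y = b" using h by (auto simp: hcross_def)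
  have le1: "fst x \<le> b'" "b' \<le> fst y" "fst x \<le> a'" using xy le by auto
  obtain z where z: "z \<in> ?S" "fst z = b'" "conn T (insert z {u \<in> ?S. fst u < b'}) x z"
    by (rule conn_first_level[of T fst, OF st(2) xy(1) le1(1,2)])
  have le2: "a' \<le> fst z" using z le by simp
  let ?S' = "insert z {u \<in> ?S. fst u < b'}"
  obtain w where w: "w \<in> ?S'" "fst w = a'" "conn T (insert w {u \<in> ?S'. a' < fst u}) w z"
    by (rule conn_last_level[of T fst, OF st z(3) le1(3) le2])
  have "insert w {u \<in> ?S'. a' < fst u} \<subseteq> S \<inter> rbox a' b' c' d'"
    using w z le by (auto simp: mem_rbox)
  then show ?thesis using conn_mono[OF w(3)] w(2) z(2) by (intro hcrossI[of T S a' b' c' d' w z])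
qed

lemma hprob_mono:
  assumes m: "matching T T'" and q: "0 \<le> q" "q \<le> 1" and le: "0 \<le> w'" "w' \<le> w" "h \<le> h'"
  shows "hprob T q w h \<le> hprob T q w' h'"
proof -
  let ?L = "rbox 0 w 0 h'"
  have "hprob T q w h = pr q ?L (hcross T 0 w 0 h)"
    using pr_hcross[OF m, of ?L 0 w 0 h q] le by (simp add: rbox_mono)
  also have "\<dots> \<le> pr q ?L (hcross T 0 w' 0 h')"
    using hcross_sub[OF m _ _ _ _ _, of 0 0 w' w 0 0 h h'] le by (intro pr_mono[OF q]) simp
  also have "\<dots> = hprob T q w' h'"
    using pr_hcross[OF m, of ?L 0 w' 0 h' q] le by (simp add: rbox_mono)
  finally show ?thesis .
qed

text \<open>One factor each for \<open>half_cross\<close>, for the contact with \<open>Q\<close>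
  after the exploration, and for \<open>upper_cross\<close>. The first two are multiplied by
  \<open>pr_explore\<close>, as the contact event depends on unrevealed sites once the exploration
  is fixed; the third by Harris' inequality.\<close>

lemma rsw:
  assumes m: "matching T T'" and l: "0 < l" and q: "0 \<le> q" "q \<le> 1"
  shows "(1 - sqrt (1 - hprob T q (2*l) (2*l))) ^ 3 \<le> hprob T q (3*l) (2*l)"
proof -
  define r where "r = 1 - sqrt (1 - hprob T q (2*l) (2*l))"
  define L where "L = rbox (-l) (2*l+1) (-l) l"
  define B' where "B' = rbox 0 (2*l+1) (-l) l"
  have finL: "finite L" by (simp add: L_def)
  have B'L: "B' \<subseteq> L" using l by (auto simp: B'_def L_def mem_rbox)
  have r0: "0 \<le> r" using hprob_bounds[OF q, of T "2*l" "2*l"] by (auto simp: r_def)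
  have flipL: "flip ` L = L" unfolding L_def by (rule flip_rbox)
  define D where "D S = explored T' l S \<union> shell T' l S" for S
  have inter: "S \<inter> D S = shell T' l S" for S
    using explored_subset[of T' l S] shell_subset[of T' l S] unfolding D_def by blast
  \<comment> \<open>The split is chosen as a function of the shell alone, so that it is known once
    the exploration is over.\<close>
  define Qof where "Qof \<eta> = (SOME Q. \<exists>P w e. crossing_split T l \<eta> P Q w e)" for \<eta>
  define F where "F d \<eta> R \<longleftrightarrow> (\<exists>t g. snd t = l \<and> g \<in> nbhd T (Qof \<eta>) \<and> conn T ((\<eta> \<union> R) \<inter> B') t g)"
    for d \<eta> R :: "site set"
  have F_mono: "F d \<eta> R'" if "F d \<eta> R" "R \<subseteq> R'" for d \<eta> R R'
  proof -
    have "(\<eta> \<union> R) \<inter> B' \<subseteq> (\<eta> \<union> R') \<inter> B'" using that by blast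
    then show ?thesis using that(1) conn_mono unfolding F_def by blast
  qed
  have split: "\<exists>P w e. crossing_split T l (shell T' l S) P (Qof (shell T' l S)) w e"
    if h: "half_cross T l S" for S
  proof -
    obtain u v where uv: "conn T (shell T' l S) u v" "fst u = - l" "fst v = l"
      by (rule shell_crossing[OF m l half_cross_hcross[OF h]])
    obtain P Q w e where "crossing_split T l (shell T' l S) P Q w e"
      by (rule crossing_split_exists[OF m l uv])
    then have "\<exists>Q P w e. crossing_split T l (shell T' l S) P Q w e" by blast
    then show ?thesis unfolding Qof_def by (rule someI_ex)
  qed
  \<comment> \<open>The auxiliary configuration \<open>R\<close> is sampled on the whole of
    \<open>B'\<close>, revealed sites included, which keeps the symmetry under
    \<open>mirror\<close>. By \<open>explored_path\<close> its unrevealed part already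
    suffices.\<close>
  have pr_F: "r \<le> pr q (L - D S) (F (D S) (S \<inter> D S))" if h: "half_cross T l S" for S
  proof -
    let ?G = "shell T' l S" and ?A = "explored T' l S"
    let ?Q = "Qof ?G"
    obtain P w e where cs: "crossing_split T l ?G P ?Q w e" using split[OF h] by blast
    have PG: "P \<subseteq> ?G" using cs by (simp add: crossing_split_def)
    have GB: "?G \<subseteq> rbox (-l) l (-l) l" using shell_subset by blast
    have hit: "F (D S) (S \<inter> D S) (R - D S)" if R: "R \<subseteq> B'" "top_hit T l ?Q R" for R
    proof -
      obtain t z where tz: "snd t = l" "z \<in> nbhd T ?Q" "z \<in> R"
        "conn T (insert z {v \<in> R. v \<notin> nbhd T (?Q \<union> mirror (2*l+1) ` ?Q)}) t z"
        using R(2) unfolding top_hit_def by blast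
      have "\<exists>t g. snd t = l \<and> g \<in> nbhd T ?Q \<and> conn T ((P \<union> (R - (?A \<union> ?G))) \<inter> rbox 0 (2*l+1) (-l) l) t g"
      proof (rule explored_path[OF m l _ _ GB _ _ cs _ tz(3,2,1,4)])
        show "?A \<subseteq> rbox (-l) l (-l) l" "?A \<inter> ?G = {}"
          using explored_subset[of T' l S] shell_subset[of T' l S] by blast+
        show "\<exists>u. snd u = - l \<and> conn T' ?A u a" if "a \<in> ?A" for a by (rule explored_conn[OF that])
        show "snd g = - l \<or> (\<exists>a\<in>?A. T' a g)" if "g \<in> ?G" for g using that unfolding shell_def by blast
        show "R \<subseteq> rbox 0 (2*l+1) (-l) l" using R(1) by (simp add: B'_def)
      qed
      moreover have "(P \<union> (R - (?A \<union> ?G))) \<inter> B' \<subseteq> (?G \<union> (R - D S)) \<inter> B'"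
        using PG by (auto simp: D_def)
      ultimately show ?thesis unfolding F_def inter B'_def using conn_mono by blast
    qed
    have "r \<le> 1 - sqrt (1 - pr q B' (vcross T 0 (2*l+1) (-l) l))"
    proof -
      \<comment> \<open>The box has the odd width \<open>2*l+1\<close> because of the position of
        the axis; extra width only helps a vertical crossing.\<close>
      have "pr q B' (vcross T 0 (2*l+1) (-l) l) = hprob T q (2*l) (2*l+1)"
        using pr_vcross[OF m, of B' 0 "2*l+1" "-l" l q] by (simp add: B'_def)
      moreover have "hprob T q (2*l) (2*l) \<le> hprob T q (2*l) (2*l+1)"
        using l by (intro hprob_mono[OF m q]) auto
      ultimately show ?thesis by (simp add: r_def)
    qed
    also have "\<dots> \<le> pr q B' (top_hit T l ?Q)"
    proof (rule square_root_symm[where f = "mirror (2*l+1)"])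
      show "incr_on B' (top_hit T l ?Q)" unfolding incr_on_def using top_hit_mono by blast
      show "top_hit T l ?Q R \<or> top_hit T l ?Q (mirror (2*l+1) ` R)"
        if "R \<subseteq> B'" "vcross T 0 (2*l+1) (-l) l R" for R
        using top_hit_cases[OF m l cs GB that(2)] that(1) by (simp add: B'_def)
    qed (use q in \<open>auto simp: B'_def mirror_rbox inj_mirror\<close>)
    also have "\<dots> \<le> pr q B' (\<lambda>R. F (D S) (S \<inter> D S) ((R \<inter> B') - D S))"
    proof (rule pr_mono[OF q])
      fix R assume "R \<subseteq> B'" "top_hit T l ?Q R"
      moreover from this have "R \<inter> B' = R" by blast
      ultimately show "F (D S) (S \<inter> D S) ((R \<inter> B') - D S)" using hit by simp
    qed
    also have "\<dots> = pr q L (\<lambda>R. F (D S) (S \<inter> D S) ((R \<inter> B') - D S))"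
      using pr_window[OF finL B'L, of "\<lambda>R. F (D S) (S \<inter> D S) ((R \<inter> B') - D S)" q] by simp
    also have "\<dots> \<le> pr q L (\<lambda>R. F (D S) (S \<inter> D S) (R - D S))"
      by (rule pr_mono[OF q]) (rule F_mono, auto)
    also have "\<dots> = pr q (L - D S) (\<lambda>R. F (D S) (S \<inter> D S) (R - D S))"
    proof (rule pr_window[OF finL])
      fix R assume "R \<subseteq> L"
      then have "R \<inter> (L - D S) - D S = R - D S" by blast
      then show "F (D S) (S \<inter> D S) (R - D S) = F (D S) (S \<inter> D S) (R \<inter> (L - D S) - D S)" by simp
    qed auto
    also have "\<dots> = pr q (L - D S) (F (D S) (S \<inter> D S))"
    proof (rule pr_cong)
      fix R assume "R \<subseteq> L - D S"
      then have "R - D S = R" by blast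
      then show "F (D S) (S \<inter> D S) (R - D S) = F (D S) (S \<inter> D S) R" by simp
    qed
    finally show ?thesis .
  qed
  have half: "r \<le> pr q L (half_cross T l)"
  proof -
    have "pr q L (hcross T (-l) l (-l) l) = hprob T q (2*l) (2*l)"
      using pr_hcross[OF m finL, of "-l" l "-l" l q] l by (simp add: L_def rbox_mono)
    then have "r = 1 - sqrt (1 - pr q L (hcross T (-l) l (-l) l))" by (simp add: r_def)
    also have "\<dots> \<le> pr q L (half_cross T l)"
    proof (rule square_root_symm[OF finL flipL inj_flip q])
      show "incr_on L (half_cross T l)" unfolding incr_on_def using half_cross_mono by blast
    qed (rule half_cross_cases[OF m l])
    finally show ?thesis .
  qed
  have upper: "r \<le> pr q L (upper_cross T l)"
  proof -
    have "pr q L (hcross T 0 (2*l) (-l) l) = hprob T q (2*l) (2*l)"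
      using pr_hcross[OF m finL, of 0 "2*l" "-l" l q] l by (simp add: L_def rbox_mono)
    then have "r = 1 - sqrt (1 - pr q L (hcross T 0 (2*l) (-l) l))" by (simp add: r_def)
    also have "\<dots> \<le> pr q L (upper_cross T l)"
    proof (rule square_root_symm[OF finL flipL inj_flip q])
      show "incr_on L (upper_cross T l)" unfolding incr_on_def using upper_cross_mono by blast
    qed (rule upper_cross_cases[OF m])
    finally show ?thesis .
  qed
  have "r * r \<le> pr q L (half_cross T l) * r"
    using half r0 by (rule mult_right_mono)
  also have "\<dots> \<le> pr q L (\<lambda>S. half_cross T l S \<and> F (D S) (S \<inter> D S) (S - D S))"
  proof (rule pr_explore[OF finL q])
    show "D S \<subseteq> L" for S
      using explored_subset[of T' l S] shell_subset[of T' l S] l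
      by (force simp: D_def L_def mem_rbox)
    show "D S' = D S" if "S \<inter> D S = S' \<inter> D S" for S S'
      using explored_stop[of S T' l S'] that unfolding D_def by simp
    show "incr_on L (half_cross T l)" unfolding incr_on_def using half_cross_mono by blast
    show "incr_on (L - D S) (F (D S) (S \<inter> D S))" for S unfolding incr_on_def using F_mono by blast
    show "r \<le> pr q (L - D S) (F (D S) (S \<inter> D S))" if "half_cross T l S" for S
      by (rule pr_F[OF that])
  qed
  also have "\<dots> \<le> pr q L (left_to_top T l)"
  proof (rule pr_mono[OF q])
    fix S assume h: "half_cross T l S \<and> F (D S) (S \<inter> D S) (S - D S)"
    have "S \<inter> D S \<union> (S - D S) = S" by blast
    then obtain t g where tg: "snd t = l" "g \<in> nbhd T (Qof (shell T' l S))" "conn T (S \<inter> B') t g"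
      using h unfolding F_def by (auto simp: inter)
    obtain P w e where cs: "crossing_split T l (shell T' l S) P (Qof (shell T' l S)) w e"
      using split h by blast
    show "left_to_top T l S"
      using left_to_topI[OF m l _ cs tg(1,2)] h tg(3) unfolding B'_def by blast
  qed
  finally have lt: "r * r \<le> pr q L (left_to_top T l)" .
  have "r ^ 3 = (r * r) * r" by (simp add: power3_eq_cube)
  also have "\<dots> \<le> pr q L (left_to_top T l) * pr q L (upper_cross T l)"
    using lt upper r0 pr_nonneg[OF q] by (intro mult_mono) auto
  also have "\<dots> \<le> pr q L (\<lambda>S. left_to_top T l S \<and> upper_cross T l S)"
    by (rule harris[OF finL q]) (use left_to_top_mono upper_cross_mono in \<open>unfold incr_on_def, blast+\<close>)
  also have "\<dots> \<le> pr q L (hcross T (-l) (2*l) (-l) l)"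
    by (rule pr_mono[OF q]) (use join_crossings[OF m l] in blast)
  also have "\<dots> = hprob T q (3*l) (2*l)"
    using pr_hcross[OF m finL, of "-l" "2*l" "-l" l q] by (simp add: L_def rbox_mono)
  finally show ?thesis by (simp add: r_def)
qed

section \<open>Long rectangles and renormalisation\<close>

lemma level_crossing:
  fixes f :: "site \<Rightarrow> int"
  assumes st: "\<And>u v. T u v \<Longrightarrow> T v u" "\<And>u v. T u v \<Longrightarrow> f v \<le> f u + 1"
    and c: "conn T S x y" "f x \<le> i" "i \<le> j" "j \<le> f y"
  obtains u v where "conn T {z \<in> S. i \<le> f z \<and> f z \<le> j} u v" "f u = i" "f v = j"
proof -
  have le: "f x \<le> j" using c by simp
  obtain v where v: "v \<in> S" "f v = j" "conn T (insert v {z \<in> S. f z < j}) x v"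
    by (rule conn_first_level[of T f, OF st(2) c(1) le c(4)])
  have le': "i \<le> f v" using v c by simp
  let ?S = "insert v {z \<in> S. f z < j}"
  obtain u where u: "u \<in> ?S" "f u = i" "conn T (insert u {z \<in> ?S. i < f z}) u v"
    by (rule conn_last_level[of T f, OF st v(3) c(2) le'])
  have "insert u {z \<in> ?S. i < f z} \<subseteq> {z \<in> S. i \<le> f z \<and> f z \<le> j}" using u v c(3) by auto
  then have "conn T {z \<in> S. i \<le> f z \<and> f z \<le> j} u v" using u(3) conn_mono by blast
  then show thesis using that u v by blast
qed

text \<open>The vertical crossing of the overlap connects to both horizontal ones, each cut down to
  a crossing of the overlap.\<close>

lemma hcross_glue:
  assumes m: "matching T T'" and le: "a \<le> b" "b \<le> c" "c \<le> d"
    and h: "hcross T a c i j S" "hcross T b d i j S" and v: "vcross T b c i j S"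
  shows "hcross T a d i j S"
proof -
  have st: "\<And>u v. T u v \<Longrightarrow> T v u" "\<And>u v. T u v \<Longrightarrow> fst v \<le> fst u + 1"
    using matching_symp[OF m] matching_steps(1)[OF m] by (blast, fastforce)
  let ?S = "S \<inter> rbox a d i j" and ?M = "S \<inter> rbox b c i j"
  obtain x1 y1 where 1: "conn T (S \<inter> rbox a c i j) x1 y1" "fst x1 = a" "fst y1 = c"
    using h(1) by (auto simp: hcross_def)
  obtain x2 y2 where 2: "conn T (S \<inter> rbox b d i j) x2 y2" "fst x2 = b" "fst y2 = d"
    using h(2) by (auto simp: hcross_def)
  obtain x3 y3 where 3: "conn T ?M x3 y3" "snd x3 = i" "snd y3 = j"
    using v by (auto simp: vcross_def)
  have sub: "S \<inter> rbox a c i j \<subseteq> ?S" "S \<inter> rbox b d i j \<subseteq> ?S" "?M \<subseteq> ?S"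
    using le by (auto simp: mem_rbox)
  have le1: "fst x1 \<le> b" "b \<le> fst y1" using 1 le by auto
  obtain z1 where z1: "z1 \<in> S \<inter> rbox a c i j" "fst z1 = b" "conn T (S \<inter> rbox a c i j) x1 z1"
    "conn T (insert z1 {u \<in> S \<inter> rbox a c i j. b < fst u}) z1 y1"
    by (rule conn_last_level[of T fst, OF st 1(1) le1])
  have "insert z1 {u \<in> S \<inter> rbox a c i j. b < fst u} \<subseteq> ?M" using z1 le by (auto simp: mem_rbox)
  then have c1: "conn T ?M z1 y1" using z1(4) conn_mono by blast
  have le2: "fst x2 \<le> c" "c \<le> fst y2" using 2 le by auto
  obtain z2 where z2: "z2 \<in> S \<inter> rbox b d i j" "fst z2 = c"
    "conn T (insert z2 {u \<in> S \<inter> rbox b d i j. fst u < c}) x2 z2"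
    by (rule conn_first_level[of T fst, OF st(2) 2(1) le2])
  have "insert z2 {u \<in> S \<inter> rbox b d i j. fst u < c} \<subseteq> ?M" using z2 le by (auto simp: mem_rbox)
  then have c2: "conn T ?M x2 z2" using z2(3) conn_mono by blast
  have "conn T (?M \<union> ?M) z1 x3"
    using 1 3 z1 by (intro crossing_conn[OF m _ c1 _ _ _ 3(1), of b c i j]) auto
  moreover have "conn T (?M \<union> ?M) x2 x3"
    using 2 3 z2 by (intro crossing_conn[OF m _ c2 _ _ _ 3(1), of b c i j]) auto
  ultimately have "conn T ?M z1 x2" using matching_conn_sym[OF m] conn_trans'[of T ?M z1 x3 x2] by simp
  then have "conn T ?S z1 x2" using sub(3) conn_mono by blast
  moreover have "conn T ?S x1 z1" using z1(3) sub(1) conn_mono by blast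
  moreover have "conn T ?S x2 y2" using 2(1) sub(2) conn_mono by blast
  ultimately have "conn T ?S x1 y2" using conn_trans'[of T ?S x1 z1 x2] conn_trans'[of T ?S x1 x2 y2] by blast
  then show ?thesis using 1 2 by (intro hcrossI)
qed

text \<open>Each step gains length \<open>l\<close> for two factors \<open>c\<close>: one for a
  further rectangle of length \<open>3*l\<close>, one for a vertical crossing of its overlap with
  the old one. The overlap is a square of side \<open>2*l\<close>, which is at least as easy to
  cross.\<close>

lemma hprob_chain:
  assumes m: "matching T T'" and l: "0 < l" and q: "0 \<le> q" "q \<le> 1"
    and c: "0 \<le> c" "c \<le> hprob T q (3*l) (2*l)"
  shows "c ^ (1 + 2 * k) \<le> hprob T q ((3 + int k) * l) (2*l)"
proof (induction k)
  case (Suc k)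
  define w where "w = (3 + int k) * l"
  have w: "2*l \<le> w" using l mult_right_mono[of 2 "3 + int k" l] by (simp add: w_def)
  let ?L = "rbox 0 (w + l) 0 (2*l)"
  have fin: "finite ?L" by simp
  have p1: "pr q ?L (hcross T 0 w 0 (2*l)) = hprob T q w (2*l)"
    using pr_hcross[OF m fin, of 0 w 0 "2*l" q] l by (simp add: rbox_mono)
  have p2: "pr q ?L (hcross T (w - 2*l) (w + l) 0 (2*l)) = hprob T q (3*l) (2*l)"
    using pr_hcross[OF m fin, of "w - 2*l" "w + l" 0 "2*l" q] w by (simp add: rbox_mono)
  have p3: "pr q ?L (vcross T (w - 2*l) w 0 (2*l)) = hprob T q (2*l) (2*l)"
    using pr_vcross[OF m fin, of "w - 2*l" w 0 "2*l" q] w l by (simp add: rbox_mono)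
  have "c ^ (1 + 2 * Suc k) = c ^ (1 + 2 * k) * c * c" by simp
  also have "\<dots> \<le> hprob T q w (2*l) * hprob T q (3*l) (2*l) * hprob T q (2*l) (2*l)"
  proof (intro mult_mono)
    show "c ^ (1 + 2 * k) \<le> hprob T q w (2*l)" using Suc by (simp add: w_def)
    have "hprob T q (3*l) (2*l) \<le> hprob T q (2*l) (2*l)"
      using l by (intro hprob_mono[OF m q]) auto
    then show "c \<le> hprob T q (2*l) (2*l)" using c by simp
  qed (use c hprob_bounds[OF q] in \<open>auto intro: mult_nonneg_nonneg\<close>)
  also have "\<dots> \<le> pr q ?L (\<lambda>S. hcross T 0 w 0 (2*l) S \<and> hcross T (w - 2*l) (w + l) 0 (2*l) S \<and> vcross T (w - 2*l) w 0 (2*l) S)"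
    unfolding p1[symmetric] p2[symmetric] p3[symmetric]
    by (rule harris3[OF fin q incr_on_hcross incr_on_hcross incr_on_vcross])
  also have "\<dots> \<le> pr q ?L (hcross T 0 (w + l) 0 (2*l))"
  proof (rule pr_mono[OF q])
    fix S assume "hcross T 0 w 0 (2*l) S \<and> hcross T (w - 2*l) (w + l) 0 (2*l) S \<and> vcross T (w - 2*l) w 0 (2*l) S"
    then show "hcross T 0 (w + l) 0 (2*l) S"
      using w l by (intro hcross_glue[OF m, of 0 "w - 2*l" w "w + l"]) auto
  qed
  also have "\<dots> = hprob T q ((3 + int (Suc k)) * l) (2*l)"
    by (simp add: hprob_def w_def algebra_simps)
  finally show ?case .
qed (use c in simp)

section \<open>The renormalisation inequality\<close>

text \<open>The strip is cut into nine squares. A crossing that starts in square \<open>i\<close>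
  either stays within the squares \<open>i - 1\<close> to \<open>i + 1\<close>, or traverses one of
  the two adjacent squares vertically.\<close>

lemma strip_crossing_cases:
  assumes m: "matching T T'" and n: "0 < n" and h: "hcross T 0 n 0 (9*n) S"
  shows "(\<exists>i\<in>{0..6}. hcross T 0 n (i*n) ((i+3)*n) S) \<or> (\<exists>i\<in>{0..8}. vcross T 0 n (i*n) ((i+1)*n) S)"
proof -
  have st: "\<And>u v. T u v \<Longrightarrow> T v u" "\<And>u v. T u v \<Longrightarrow> snd v \<le> snd u + 1"
    using matching_symp[OF m] matching_steps(2)[OF m] by (blast, fastforce)
  obtain x y where xy: "conn T (S \<inter> rbox 0 n 0 (9*n)) x y" "fst x = 0" "fst y = n"
    using h by (auto simp: hcross_def)
  obtain P where P: "P \<subseteq> S \<inter> rbox 0 n 0 (9*n)" "conn T P x y" "\<And>z. z \<in> P \<Longrightarrow> conn T P x z"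
    using conn_path_set[OF xy(1)] by blast
  have Pb: "0 \<le> fst v" "fst v \<le> n" "0 \<le> snd v" "snd v \<le> 9*n" "v \<in> S" if "v \<in> P" for v
    using subsetD[OF P(1) that] by (auto simp: mem_rbox)
  have xP: "x \<in> P" using P(2) conn_mem by blast
  define i where "i = snd x div n"
  have i: "i * n \<le> snd x" "snd x < (i + 1) * n"
  proof -
    have "snd x = i * n + snd x mod n" "(i + 1) * n = i * n + n" by (simp_all add: i_def distrib_right)
    then show "i * n \<le> snd x" "snd x < (i + 1) * n"
      using pos_mod_bound[OF n, of "snd x"] pos_mod_sign[OF n, of "snd x"] by linarith+
  qed
  have vc: "vcross T 0 n (k*n) ((k+1)*n) S" if k: "conn T P u v" "snd u \<le> k*n" "(k+1)*n \<le> snd v" for k u v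
  proof -
    have le: "k*n \<le> (k+1)*n" using n by simp
    obtain a b where ab: "conn T {z \<in> P. k*n \<le> snd z \<and> snd z \<le> (k+1)*n} a b" "snd a = k*n" "snd b = (k+1)*n"
      by (rule level_crossing[of T snd, OF st k(1,2) le k(3)])
    have "{z \<in> P. k*n \<le> snd z \<and> snd z \<le> (k+1)*n} \<subseteq> S \<inter> rbox 0 n (k*n) ((k+1)*n)"
      using Pb by (auto simp: mem_rbox)
    then show ?thesis using conn_mono[OF ab(1)] ab(2,3) by (intro vcrossI[of T S _ _ _ _ a b])
  qed
  have i0: "0 \<le> i" using n Pb(3)[OF xP] by (simp add: i_def pos_imp_zdiv_nonneg_iff)
  have lt: "a < b" if "a * n < b * n" for a b using that n by (simp add: mult_less_cancel_right)
  have le: "a \<le> b" if "a * n \<le> b * n" for a b using that n by simp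
  consider (up) v where "v \<in> P" "(i + 2) * n \<le> snd v" | (down) v where "v \<in> P" "snd v < (i - 1) * n"
    | (mid) "\<And>v. v \<in> P \<Longrightarrow> (i - 1) * n \<le> snd v \<and> snd v \<le> (i + 2) * n"
    by force
  then show ?thesis
  proof cases
    case up
    have "vcross T 0 n ((i+1)*n) ((i+1+1)*n) S"
      using vc[OF P(3)[OF up(1)], of "i+1"] up(2) i(2) by (simp add: add.commute)
    moreover have "i + 2 \<le> 9" using le[of "i + 2" 9] up Pb(4)[OF up(1)] by linarith
    then have "i + 1 \<in> {0..8}" using i0 by simp
    ultimately show ?thesis by blast
  next
    case down
    have "conn T P v x" using matching_conn_sym[OF m P(3)[OF down(1)]] .
    then have "vcross T 0 n ((i-1)*n) ((i-1+1)*n) S"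
      using vc[of v x "i-1"] down(2) i(1) by simp
    moreover have "0 < i - 1" using lt[of 0 "i - 1"] down Pb(3)[OF down(1)] by linarith
    moreover have "i \<le> 9" using le[of i 9] i(1) Pb(4)[OF xP] by linarith
    ultimately have "i - 1 \<in> {0..8}" "vcross T 0 n ((i-1)*n) ((i-1+1)*n) S" by simp_all
    then show ?thesis by blast
  next
    case mid
    \<comment> \<open>Clamped at both ends of the strip. The value \<open>i = 9\<close> also occurs,
      when the crossing starts in the topmost row.\<close>
    define j where "j = max 0 (min 6 (i - 1))"
    have "j * n \<le> snd v \<and> snd v \<le> (j + 3) * n" if v: "v \<in> P" for v
    proof -
      consider "i = 0" | "1 \<le> i" "i \<le> 7" | "7 \<le> i - 1" using i0 by linarith
      then show ?thesis
      proof cases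
        case 1
        then show ?thesis using mid[OF v] Pb(3)[OF v] n by (simp add: j_def)
      next
        case 2
        then have "j = i - 1" by (simp add: j_def)
        then show ?thesis using mid[OF v] by (simp add: add.commute)
      next
        case 3
        have "7 * n \<le> (i - 1) * n" using 3 n by (intro mult_right_mono) auto
        moreover have "j = 6" using 3 by (simp add: j_def)
        ultimately show ?thesis using mid[OF v] Pb(4)[OF v] n by (simp, linarith)
      qed
    qed
    then have "P \<subseteq> S \<inter> rbox 0 n (j*n) ((j+3)*n)" using Pb by (auto simp: mem_rbox)
    then have "hcross T 0 n (j*n) ((j+3)*n) S"
      using conn_mono[OF P(2)] xy(2,3) by (intro hcrossI[of T S _ _ _ _ x y])
    moreover have "j \<in> {0..6}" by (auto simp: j_def)
    ultimately show ?thesis by blast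
  qed
qed

text \<open>The factor counts 7 positions of three consecutive squares and 9 single squares;
  crossing a square is no more likely than crossing a rectangle three times as high.\<close>

lemma hprob_strip:
  assumes m: "matching T T'" and n: "0 < n" and q: "0 \<le> q" "q \<le> 1"
  shows "hprob T q n (9*n) \<le> 16 * hprob T q n (3*n)"
proof -
  let ?L = "rbox 0 n 0 (9*n)" and ?e = "hprob T q n (3*n)"
  let ?H = "\<lambda>i S. hcross T 0 n (i*n) ((i+3)*n) S" and ?V = "\<lambda>i S. vcross T 0 n (i*n) ((i+1)*n) S"
  have fin: "finite ?L" by simp
  have mul: "a * n \<le> b * n" if "a \<le> b" for a b using that n by simp
  have H: "pr q ?L (?H i) = ?e" if "i \<in> {0..6}" for i
  proof -
    have "rbox 0 n (i*n) ((i+3)*n) \<subseteq> ?L" using that mul[of 0 i] mul[of "i+3" 9] by (intro rbox_mono) auto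
    then show ?thesis using pr_hcross[OF m fin] by (simp add: algebra_simps)
  qed
  have V: "pr q ?L (?V i) \<le> ?e" if "i \<in> {0..8}" for i
  proof -
    have "rbox 0 n (i*n) ((i+1)*n) \<subseteq> ?L" using that mul[of 0 i] mul[of "i+1" 9] by (intro rbox_mono) auto
    then have "pr q ?L (?V i) = hprob T q n n" using pr_vcross[OF m fin] by (simp add: algebra_simps)
    also have "\<dots> \<le> ?e" using n by (intro hprob_mono[OF m q]) auto
    finally show ?thesis .
  qed
  have "hprob T q n (9*n) \<le> pr q ?L (\<lambda>S. (\<exists>i\<in>{0..6}. ?H i S) \<or> (\<exists>i\<in>{0..8}. ?V i S))"
    unfolding hprob_def by (intro pr_mono[OF q] strip_crossing_cases[OF m n])
  also have "\<dots> \<le> pr q ?L (\<lambda>S. \<exists>i\<in>{0..6::int}. ?H i S) + pr q ?L (\<lambda>S. \<exists>i\<in>{0..8::int}. ?V i S)"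
    by (rule pr_disj_le[OF q])
  also have "\<dots> \<le> (\<Sum>i\<in>{0..6::int}. pr q ?L (?H i)) + (\<Sum>i\<in>{0..8::int}. pr q ?L (?V i))"
    by (intro add_mono pr_Bex_le q) auto
  also have "\<dots> \<le> (\<Sum>i\<in>{0..6::int}. ?e) + (\<Sum>i\<in>{0..8::int}. ?e)"
    by (intro add_mono sum_mono) (use H V in auto)
  finally show ?thesis by simp
qed

text \<open>A crossing of the long rectangle crosses its first and its last third, and these have no
  site in common.\<close>

lemma hprob_triple:
  assumes m: "matching T T'" and n: "0 < n" and q: "0 \<le> q" "q \<le> 1"
  shows "hprob T q (3*n) (9*n) \<le> (hprob T q n (9*n))\<^sup>2"
proof -
  let ?L = "rbox 0 (3*n) 0 (9*n)"
  let ?E = "hcross T 0 n 0 (9*n)" and ?F = "hcross T (2*n) (3*n) 0 (9*n)"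
  have fin: "finite ?L" by simp
  have sub: "rbox 0 n 0 (9*n) \<subseteq> ?L" "rbox (2*n) (3*n) 0 (9*n) \<subseteq> ?L" using n by (simp_all add: rbox_mono)
  have "hprob T q (3*n) (9*n) \<le> pr q ?L (\<lambda>S. ?E S \<and> ?F S)"
    unfolding hprob_def
    using hcross_sub[OF m _ _ _ _ _, of 0 0 n "3*n" 0 0 "9*n" "9*n"]
      hcross_sub[OF m _ _ _ _ _, of 0 "2*n" "3*n" "3*n" 0 0 "9*n" "9*n"] n
    by (intro pr_mono[OF q]) auto
  also have "\<dots> = pr q ?L ?E * pr q ?L ?F"
  proof (rule pr_indep[OF fin sub])
    show "rbox 0 n 0 (9*n) \<inter> rbox (2*n) (3*n) 0 (9*n) = {}" using n by (auto simp: mem_rbox)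
  qed (simp_all add: hcross_Int)
  also have "\<dots> = (hprob T q n (9*n))\<^sup>2"
    using pr_hcross[OF m fin sub(1), of q] pr_hcross[OF m fin sub(2), of q] by (simp add: power2_eq_square)
  finally show ?thesis .
qed

text \<open>Multiplying by \<open>256 = 16\<^sup>2\<close> absorbs the constant of the
  renormalisation inequality, which becomes plain squaring. The true decay is much faster; a
  geometric rate suffices for both applications.\<close>

lemma hprob_decay:
  assumes m: "matching T T'" and n: "0 < n" and q: "0 \<le> q" "q \<le> 1"
    and small: "hprob T q n (3*n) \<le> 1/512"
  shows "256 * hprob T q (3^k * n) (3 * (3^k * n)) \<le> (1/2) ^ (k + 1)"
proof (induction k)
  case (Suc k)
  let ?n = "3^k * n"
  have n': "0 < ?n" using n by simp
  have e: "0 \<le> hprob T q ?n (3 * ?n)" "0 \<le> hprob T q ?n (9 * ?n)" using hprob_bounds[OF q] by auto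
  have "hprob T q (3 * ?n) (9 * ?n) \<le> (16 * hprob T q ?n (3 * ?n))\<^sup>2"
    using hprob_triple[OF m n' q] power_mono[OF hprob_strip[OF m n' q] e(2), of 2] by linarith
  then have "256 * hprob T q (3 * ?n) (9 * ?n) \<le> (256 * hprob T q ?n (3 * ?n))\<^sup>2"
    by (simp add: power2_eq_square)
  also have "\<dots> \<le> ((1/2) ^ (k + 1))\<^sup>2" using Suc e by (intro power_mono) auto
  also have "\<dots> = (1/2) ^ (2 * (k + 1))" by (rule power_even_eq[symmetric])
  also have "\<dots> \<le> (1/2) ^ (Suc k + 1)" by (rule power_decreasing) auto
  finally show ?case by (simp add: mult.assoc)
qed (use small in simp)

section \<open>The infinite product measure\<close>

lemma product_prob_space_bernoulli: "product_prob_space (\<lambda>_. measure_pmf (bernoulli_pmf p))"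
  by (rule product_prob_spaceI) (rule prob_space_measure_pmf)

lemma space_site_percolation [simp]: "space (site_percolation p) = UNIV"
  by (simp add: site_percolation_def space_PiM)

lemma prob_space_site_percolation: "prob_space (site_percolation p)"
  unfolding site_percolation_def by (rule prob_space_PiM) (rule prob_space_measure_pmf)

lemma measurable_occupied: "{\<omega>. \<omega> x} \<in> sets (site_percolation p)"
proof -
  have "(\<lambda>\<omega>. \<omega> x) \<in> measurable (site_percolation p) (measure_pmf (bernoulli_pmf p))"
    unfolding site_percolation_def by (rule measurable_component_singleton) simp
  then have "(\<lambda>\<omega>. \<omega> x) -` {True} \<inter> space (site_percolation p) \<in> sets (site_percolation p)"
    by (rule measurable_sets) simp
  moreover have "(\<lambda>\<omega>. \<omega> x) -` {True} \<inter> space (site_percolation p) = {\<omega>. \<omega> x}" by auto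
  ultimately show ?thesis by simp
qed

lemma measure_cylinder:
  assumes p: "0 \<le> p" "p \<le> 1" and L: "finite L" "S \<subseteq> L"
  shows "{\<omega>. {x \<in> L. \<omega> x} = S} \<in> sets (site_percolation p)"
    "measure (site_percolation p) {\<omega>. {x \<in> L. \<omega> x} = S} = weight p L S"
proof -
  interpret product_prob_space "\<lambda>_. measure_pmf (bernoulli_pmf p)" UNIV
    by (rule product_prob_space_bernoulli)
  define X where "X i = {i \<in> S}" for i
  have eq: "{\<omega>. {x \<in> L. \<omega> x} = S} = prod_emb UNIV (\<lambda>_. measure_pmf (bernoulli_pmf p)) L (Pi\<^sub>E L X)"
    using L by (auto simp: prod_emb_def X_def space_PiM PiE_def Pi_def)
  show "{\<omega>. {x \<in> L. \<omega> x} = S} \<in> sets (site_percolation p)"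
    unfolding eq site_percolation_def using L by (intro sets_PiM_I) auto
  have "measure (site_percolation p) {\<omega>. {x \<in> L. \<omega> x} = S}
      = (\<Prod>i\<in>L. measure (measure_pmf (bernoulli_pmf p)) (X i))"
    unfolding eq site_percolation_def using L by (intro measure_PiM_emb) auto
  also have "\<dots> = (\<Prod>i\<in>L. if i \<in> S then p else 1 - p)"
    using p by (intro prod.cong) (auto simp: X_def measure_pmf_single)
  also have "\<dots> = (\<Prod>i\<in>S. p) * (\<Prod>i\<in>L - S. 1 - p)"
    using L by (subst prod.subset_diff[of S L]) (auto simp: mult.commute)
  finally show "measure (site_percolation p) {\<omega>. {x \<in> L. \<omega> x} = S} = weight p L S"
    by (simp add: weight_def)
qed

lemma measure_window:
  assumes p: "0 \<le> p" "p \<le> 1" and L: "finite L"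
  shows "{\<omega>. E {x \<in> L. \<omega> x}} \<in> sets (site_percolation p)"
    "measure (site_percolation p) {\<omega>. E {x \<in> L. \<omega> x}} = pr p L E"
proof -
  interpret prob_space "site_percolation p" by (rule prob_space_site_percolation)
  let ?I = "{S \<in> Pow L. E S}" and ?C = "\<lambda>S. {\<omega>. {x \<in> L. \<omega> x} = S}"
  have eq: "{\<omega>. E {x \<in> L. \<omega> x}} = (\<Union>S\<in>?I. ?C S)" by auto
  have fin: "finite ?I" using L by simp
  have C: "?C ` ?I \<subseteq> sets (site_percolation p)" using measure_cylinder(1)[OF p L] by auto
  show "{\<omega>. E {x \<in> L. \<omega> x}} \<in> sets (site_percolation p)"
    unfolding eq using fin C by (intro sets.finite_UN) auto
  have "measure (site_percolation p) {\<omega>. E {x \<in> L. \<omega> x}} = (\<Sum>S\<in>?I. measure (site_percolation p) (?C S))"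
    unfolding eq by (rule finite_measure_finite_Union[OF fin C]) (auto simp: disjoint_family_on_def)
  also have "\<dots> = (\<Sum>S\<in>?I. weight p L S)"
    by (intro sum.cong) (use measure_cylinder(2)[OF p L] in auto)
  also have "\<dots> = pr p L E"
    unfolding pr_def using L by (intro sum.mono_neutral_cong_left) auto
  finally show "measure (site_percolation p) {\<omega>. E {x \<in> L. \<omega> x}} = pr p L E" .
qed

text \<open>Only lattice sites count, so a real height may be replaced by its integer part.\<close>

lemma crossing_event_eq:
  defines "B v n h \<equiv> rbox (fst v) (fst v + n) (snd v) (snd v + \<lfloor>h\<rfloor>)"
  shows "crossing_event v n h =
    {\<omega>. hcross site_adj (fst v) (fst v + n) (snd v) (snd v + \<lfloor>h\<rfloor>) {x \<in> B v n h. \<omega> x}}"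
proof -
  have rect: "rect v n h = B v n h"
  proof -
    have "real_of_int y \<le> real_of_int b + h \<longleftrightarrow> y \<le> b + \<lfloor>h\<rfloor>" for y b
      using le_floor_iff[of "y - b" h] by auto
    then show ?thesis by (auto simp: rect_def B_def mem_rbox)
  qed
  have "(\<exists>xs. horizontal_crossing \<omega> v n h xs) \<longleftrightarrow>
      hcross site_adj (fst v) (fst v + n) (snd v) (snd v + \<lfloor>h\<rfloor>) {x \<in> B v n h. \<omega> x}" for \<omega>
  proof -
    have sub: "set xs \<subseteq> {x \<in> B v n h. \<omega> x} \<inter> B v n h \<longleftrightarrow> (\<forall>x\<in>set xs. \<omega> x) \<and> set xs \<subseteq> B v n h" for xs
      by blast
    show ?thesis
      unfolding horizontal_crossing_def occupied_path_def hcross_def conn_iff_walk rect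
        B_def[of v n h, symmetric] sub by blast
  qed
  then show ?thesis unfolding crossing_event_def by blast
qed

lemma measure_crossing_event:
  assumes "0 \<le> p" "p \<le> 1"
  shows "measure (site_percolation p) (crossing_event v n h) = hprob site_adj p n \<lfloor>h\<rfloor>"
proof -
  have m: "matching site_adj star_adj" by (simp add: matching_def)
  show ?thesis
    unfolding crossing_event_eq measure_window(2)[OF assms finite_rbox]
    using pr_hcross[OF m finite_rbox order_refl, of p "fst v" "fst v + n" "snd v" "snd v + \<lfloor>h\<rfloor>"] by simp
qed

section \<open>Infinite clusters\<close>

lemma occupied_cluster_conn: "occupied_cluster \<omega> x = {y. conn site_adj {v. \<omega> v} x y}"
  unfolding occupied_cluster_def occupied_path_def conn_iff_walk by auto

lemma infinite_iff_unbounded: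
  "infinite C \<longleftrightarrow> (\<forall>N::nat. \<exists>y\<in>C. y \<notin> rbox (- int N) (int N) (- int N) (int N))"
proof
  assume "infinite C"
  then show "\<forall>N::nat. \<exists>y\<in>C. y \<notin> rbox (- int N) (int N) (- int N) (int N)"
    by (meson finite_rbox finite_subset subsetI)
next
  assume unb: "\<forall>N::nat. \<exists>y\<in>C. y \<notin> rbox (- int N) (int N) (- int N) (int N)"
  show "infinite C"
  proof
    assume fin: "finite C"
    define N where "N = (\<Sum>y\<in>C. nat \<bar>fst y\<bar> + nat \<bar>snd y\<bar>)"
    obtain y where y: "y \<in> C" "y \<notin> rbox (- int N) (int N) (- int N) (int N)" using unb by blast
    have "nat \<bar>fst y\<bar> + nat \<bar>snd y\<bar> \<le> N" unfolding N_def by (rule member_le_sum[OF y(1)]) (use fin in auto)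
    then show False using y(2) by (auto simp: mem_rbox)
  qed
qed

definition perc_event :: "config set" where
  "perc_event = {\<omega>. infinite (occupied_cluster \<omega> (0, 0))}"

lemma percolation_prob_eq: "percolation_prob p = measure (site_percolation p) perc_event"
  by (simp add: percolation_prob_def perc_event_def)

text \<open>There are countably many lattice walks, so leaving every box is a countable combination
  of conditions on single sites.\<close>

lemma measurable_perc_event: "perc_event \<in> sets (site_percolation p)"
proof -
  define W where "W N = {xs. xs \<noteq> [] \<and> successively site_adj xs \<and> hd xs = (0, 0) \<and>
    last xs \<notin> rbox (- int N) (int N) (- int N) (int N)}" for N :: nat
  have *: "(\<exists>y\<in>occupied_cluster \<omega> (0, 0). y \<notin> rbox (- int N) (int N) (- int N) (int N)) \<longleftrightarrow>
      (\<exists>xs\<in>W N. \<forall>x\<in>set xs. \<omega> x)" for \<omega> N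
    unfolding occupied_cluster_def occupied_path_def W_def by blast
  have "\<omega> \<in> perc_event \<longleftrightarrow> (\<forall>N. \<exists>xs\<in>W N. \<forall>x\<in>set xs. \<omega> x)" for \<omega>
    unfolding perc_event_def mem_Collect_eq infinite_iff_unbounded * ..
  then have eq: "perc_event = (\<Inter>N. \<Union>xs\<in>W N. \<Inter>x\<in>set xs. {\<omega>. \<omega> x})"
    by auto
  have "(\<Inter>x\<in>set xs. {\<omega>. \<omega> x}) \<in> sets (site_percolation p)" if "xs \<in> W N" for xs N
    using that measurable_occupied by (intro sets.finite_INT) (auto simp: W_def)
  then have "(\<Union>xs\<in>W N. \<Inter>x\<in>set xs. {\<omega>. \<omega> x}) \<in> sets (site_percolation p)" for N
    by (intro sets.countable_UN'') auto
  then show ?thesis unfolding eq by (intro sets.countable_INT) auto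
qed

text \<open>The connection from the origin is stopped when it first reaches the boundary of the box.
  The side reached there determines a half-box that is crossed in its short direction.\<close>

lemma infinite_cluster_crosses:
  assumes inf: "infinite (occupied_cluster \<omega> (0, 0))" and N: "0 < N"
  defines "S \<equiv> {v \<in> rbox (-N) N (-N) N. \<omega> v}"
  shows "hcross site_adj 0 N (-N) N S \<or> hcross site_adj (-N) 0 (-N) N S \<or>
    vcross site_adj (-N) N 0 N S \<or> vcross site_adj (-N) N (-N) 0 S"
proof -
  have m: "matching site_adj star_adj" by (simp add: matching_def)
  define f where "f v = max \<bar>fst v\<bar> \<bar>snd v\<bar>" for v :: site
  have st: "site_adj u v \<Longrightarrow> site_adj v u" "site_adj u v \<Longrightarrow> fst v \<le> fst u + 1"
    "site_adj u v \<Longrightarrow> snd v \<le> snd u + 1" "site_adj u v \<Longrightarrow> f v \<le> f u + 1" for u v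
    by (auto simp: site_adj_def f_def)
  obtain y where y: "y \<in> occupied_cluster \<omega> (0, 0)" "y \<notin> rbox (- int (nat N)) (int (nat N)) (- int (nat N)) (int (nat N))"
    using inf unfolding infinite_iff_unbounded by blast
  have c: "conn site_adj {v. \<omega> v} (0, 0) y" using y(1) by (simp add: occupied_cluster_conn)
  have le: "f (0, 0) \<le> N" "N \<le> f y" using y(2) N by (auto simp: f_def mem_rbox)
  obtain z where z: "z \<in> {v. \<omega> v}" "f z = N" "conn site_adj (insert z {u \<in> {v. \<omega> v}. f u < N}) (0, 0) z"
    by (rule conn_first_level[of site_adj f, OF st(4) c le])
  have fb: "v \<in> rbox (-N) N (-N) N" if "f v \<le> N" for v
    using that unfolding f_def mem_rbox by linarith
  have "insert z {u \<in> {v. \<omega> v}. f u < N} \<subseteq> S"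
  proof
    fix v assume v: "v \<in> insert z {u \<in> {v. \<omega> v}. f u < N}"
    then have "f v \<le> N" "\<omega> v" using z(1,2) by auto
    then show "v \<in> S" using fb by (simp add: S_def)
  qed
  then have cz: "conn site_adj S (0, 0) z" by (rule conn_mono[OF z(3)])
  then have zc: "conn site_adj S z (0, 0)" by (rule matching_conn_sym[OF m])
  have Sb: "- N \<le> fst v \<and> fst v \<le> N \<and> - N \<le> snd v \<and> snd v \<le> N" if "v \<in> S" for v
    using that by (auto simp: S_def mem_rbox)
  consider "fst z = N" | "fst z = - N" | "snd z = N" | "snd z = - N" using z(2) unfolding f_def by linarith
  then show ?thesis
  proof cases
    case 1
    have "fst (0::int, 0::int) \<le> 0" "0 \<le> N" "N \<le> fst z" using 1 N by auto
    from level_crossing[of site_adj fst, OF st(1,2) cz this] obtain u v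
      where uv: "conn site_adj {w \<in> S. 0 \<le> fst w \<and> fst w \<le> N} u v" "fst u = 0" "fst v = N" by blast
    have "{w \<in> S. 0 \<le> fst w \<and> fst w \<le> N} \<subseteq> S \<inter> rbox 0 N (-N) N" using Sb by (auto simp: mem_rbox)
    then show ?thesis using hcrossI[OF conn_mono[OF uv(1)] uv(2,3)] by blast
  next
    case 2
    have "fst z \<le> - N" "- N \<le> 0" "0 \<le> fst (0::int, 0::int)" using 2 N by auto
    from level_crossing[of site_adj fst, OF st(1,2) zc this] obtain u v
      where uv: "conn site_adj {w \<in> S. - N \<le> fst w \<and> fst w \<le> 0} u v" "fst u = - N" "fst v = 0" by blast
    have "{w \<in> S. - N \<le> fst w \<and> fst w \<le> 0} \<subseteq> S \<inter> rbox (-N) 0 (-N) N" using Sb by (auto simp: mem_rbox)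
    then show ?thesis using hcrossI[OF conn_mono[OF uv(1)] uv(2,3)] by blast
  next
    case 3
    have "snd (0::int, 0::int) \<le> 0" "0 \<le> N" "N \<le> snd z" using 3 N by auto
    from level_crossing[of site_adj snd, OF st(1,3) cz this] obtain u v
      where uv: "conn site_adj {w \<in> S. 0 \<le> snd w \<and> snd w \<le> N} u v" "snd u = 0" "snd v = N" by blast
    have "{w \<in> S. 0 \<le> snd w \<and> snd w \<le> N} \<subseteq> S \<inter> rbox (-N) N 0 N" using Sb by (auto simp: mem_rbox)
    then show ?thesis using vcrossI[OF conn_mono[OF uv(1)] uv(2,3)] by blast
  next
    case 4
    have "snd z \<le> - N" "- N \<le> 0" "0 \<le> snd (0::int, 0::int)" using 4 N by auto
    from level_crossing[of site_adj snd, OF st(1,3) zc this] obtain u v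
      where uv: "conn site_adj {w \<in> S. - N \<le> snd w \<and> snd w \<le> 0} u v" "snd u = - N" "snd v = 0" by blast
    have "{w \<in> S. - N \<le> snd w \<and> snd w \<le> 0} \<subseteq> S \<inter> rbox (-N) N (-N) 0" using Sb by (auto simp: mem_rbox)
    then show ?thesis using vcrossI[OF conn_mono[OF uv(1)] uv(2,3)] by blast
  qed
qed

lemma percolation_prob_le:
  assumes p: "0 \<le> p" "p \<le> 1" and N: "0 < N"
  shows "percolation_prob p \<le> 4 * hprob site_adj p N (3*N)"
proof -
  have m: "matching site_adj star_adj" by (simp add: matching_def)
  interpret prob_space "site_percolation p" by (rule prob_space_site_percolation)
  let ?L = "rbox (-N) N (-N) N"
  let ?E = "\<lambda>S. hcross site_adj 0 N (-N) N S \<or> hcross site_adj (-N) 0 (-N) N S \<or>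
    vcross site_adj (-N) N 0 N S \<or> vcross site_adj (-N) N (-N) 0 S"
  have fin: "finite ?L" by simp
  have "percolation_prob p \<le> prob {\<omega>. ?E {x \<in> ?L. \<omega> x}}"
    unfolding percolation_prob_eq
  proof (rule finite_measure_mono)
    show "perc_event \<subseteq> {\<omega>. ?E {x \<in> ?L. \<omega> x}}"
      using infinite_cluster_crosses[OF _ N] unfolding perc_event_def by blast
    show "{\<omega>. ?E {x \<in> ?L. \<omega> x}} \<in> events" using measure_window(1)[OF p fin, of ?E] .
  qed
  also have "\<dots> = pr p ?L ?E" by (rule measure_window(2)[OF p fin, of ?E])
  also have "\<dots> \<le> pr p ?L (hcross site_adj 0 N (-N) N) + (pr p ?L (hcross site_adj (-N) 0 (-N) N) +
      (pr p ?L (vcross site_adj (-N) N 0 N) + pr p ?L (vcross site_adj (-N) N (-N) 0)))"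
    by (intro order_trans[OF pr_disj_le[OF p]] add_left_mono) simp
  also have "\<dots> = 4 * hprob site_adj p N (2*N)"
    using N by (simp add: pr_hcross[OF m fin] pr_vcross[OF m fin] rbox_mono)
  also have "\<dots> \<le> 4 * hprob site_adj p N (3*N)"
    using hprob_mono[OF m p, of N N "2*N" "3*N"] N by simp
  finally show ?thesis .
qed

lemma percolation_prob_zero:
  assumes p: "0 \<le> p" "p \<le> 1" and n: "0 < n" and small: "hprob site_adj p n (3*n) \<le> 1/512"
  shows "percolation_prob p = 0"
proof -
  have m: "matching site_adj star_adj" by (simp add: matching_def)
  have "percolation_prob p \<le> (1/2) ^ k" for k
  proof -
    have "percolation_prob p \<le> 4 * hprob site_adj p (3^k * n) (3 * (3^k * n))"
      using n by (intro percolation_prob_le[OF p]) simp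
    also have "\<dots> \<le> 256 * hprob site_adj p (3^k * n) (3 * (3^k * n))"
      using hprob_bounds(1)[OF p] by (intro mult_right_mono) auto
    also have "\<dots> \<le> (1/2) ^ (k + 1)" by (rule hprob_decay[OF m n p small])
    also have "\<dots> \<le> (1/2) ^ k" by (rule power_decreasing) auto
    finally show ?thesis .
  qed
  moreover have "(\<lambda>k. (1/2::real) ^ k) \<longlonglongrightarrow> 0" by (rule LIMSEQ_power_zero) simp
  ultimately have "percolation_prob p \<le> 0" by (intro LIMSEQ_le_const) auto
  then show ?thesis by (simp add: percolation_prob_def measure_le_0_iff)
qed

text \<open>Both paths are cut down to crossings of the common rectangle of width \<open>w'\<close>
  and height \<open>h\<close>, where they have to connect.\<close>

lemma link_crossings:
  assumes m: "matching T T'" and le: "0 \<le> w'" "w' \<le> w" "0 \<le> h" "h \<le> h'"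
    and xy: "conn T (S \<inter> rbox 0 w 0 h) x y" "fst x = 0" "fst y = w"
    and uv: "conn T (S \<inter> rbox 0 w' 0 h') u v" "snd u = 0" "snd v = h'"
  shows "conn T S x u"
proof -
  have st: "\<And>u v. T u v \<Longrightarrow> T v u" "\<And>u v. T u v \<Longrightarrow> fst v \<le> fst u + 1" "\<And>u v. T u v \<Longrightarrow> snd v \<le> snd u + 1"
    using matching_symp[OF m] matching_steps[OF m] by (blast, fastforce, fastforce)
  obtain P where P: "P \<subseteq> S \<inter> rbox 0 w 0 h" "conn T P x y" "\<And>z. z \<in> P \<Longrightarrow> conn T P x z"
    using conn_path_set[OF xy(1)] by blast
  obtain Q where Q: "Q \<subseteq> S \<inter> rbox 0 w' 0 h'" "conn T Q u v" "\<And>z. z \<in> Q \<Longrightarrow> conn T Q u z"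
    using conn_path_set[OF uv(1)] by blast
  let ?P = "{z \<in> P. 0 \<le> fst z \<and> fst z \<le> w'}" and ?Q = "{z \<in> Q. 0 \<le> snd z \<and> snd z \<le> h}"
  have le1: "fst x \<le> 0" "w' \<le> fst y" using xy le by auto
  obtain a b where ab: "conn T ?P a b" "fst a = 0" "fst b = w'"
    by (rule level_crossing[of T fst, OF st(1,2) P(2) le1(1) le(1) le1(2)])
  have le2: "snd u \<le> 0" "h \<le> snd v" using uv le by auto
  obtain c d where cd: "conn T ?Q c d" "snd c = 0" "snd d = h"
    by (rule level_crossing[of T snd, OF st(1,3) Q(2) le2(1) le(3) le2(2)])
  have "?P \<subseteq> rbox 0 w' 0 h" "?Q \<subseteq> rbox 0 w' 0 h" using P(1) Q(1) by (auto simp: mem_rbox)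
  then have "conn T (?P \<union> ?Q) a c"
    using crossing_conn[OF m _ ab(1) ab(2,3) _ cd(1)] cd by blast
  then have ac: "conn T S a c" by (rule conn_mono) (use P Q in auto)
  have "a \<in> P" "c \<in> Q" using conn_mem(1)[OF ab(1)] conn_mem(1)[OF cd(1)] by auto
  have xa: "conn T S x a" by (rule conn_mono[OF P(3)[OF \<open>a \<in> P\<close>]]) (use P in auto)
  have uc: "conn T S u c" by (rule conn_mono[OF Q(3)[OF \<open>c \<in> Q\<close>]]) (use Q in auto)
  show ?thesis
    by (rule conn_trans'[OF conn_trans'[OF xa ac] matching_conn_sym[OF m uc]])
qed

text \<open>
  The rectangles alternate between horizontal and vertical and triple in size, so that consecutive
  crossings intersect.
\<close>

definition ladder :: "(site \<Rightarrow> site \<Rightarrow> bool) \<Rightarrow> int \<Rightarrow> nat \<Rightarrow> site set \<Rightarrow> bool" where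
  "ladder T n k S \<longleftrightarrow> (let m = 3 ^ k * n in
     if even k then hcross T 0 (3*m) 0 m S else vcross T 0 m 0 (3*m) S)"

lemma ladder_mono: "ladder T n k S \<Longrightarrow> S \<subseteq> S' \<Longrightarrow> ladder T n k S'"
  unfolding ladder_def Let_def using hcross_mono vcross_mono by (auto split: if_splits)

text \<open>The occupied base attaches the origin to the ladder. The crossing of rung
  \<open>k\<close> and that of rung \<open>k + 1\<close> traverse the whole rectangle of rung
  \<open>k\<close> in perpendicular directions.\<close>

lemma ladder_connected:
  assumes m: "matching T T'" and n: "0 < n" and base: "rbox 0 (3*n) 0 n \<subseteq> S"
    and R: "\<And>k. 1 \<le> k \<Longrightarrow> ladder T n k S"
  shows "\<exists>x y. conn T S (0, 0) x \<and> (if even k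
      then conn T (S \<inter> rbox 0 (3 * (3^k * n)) 0 (3^k * n)) x y \<and> fst x = 0 \<and> fst y = 3 * (3^k * n)
      else conn T (S \<inter> rbox 0 (3^k * n) 0 (3 * (3^k * n))) x y \<and> snd x = 0 \<and> snd y = 3 * (3^k * n))"
proof (induction k)
  case 0
  have "conn T (rbox 0 n 0 (3*n)) (0, 0) (0, 3*n)"
    using n by (intro conn_column[OF m]) (auto simp: mem_rbox)
  then have "conn T (rbox 0 (3*n) 0 n) (0, 0) (3*n, 0)"
    using conn_swap[OF m, of "rbox 0 n 0 (3*n)" "(0, 0)" "(0, 3*n)"] by (simp add: swap_rbox)
  then have "conn T (S \<inter> rbox 0 (3*n) 0 n) (0, 0) (3*n, 0)" using base by (simp add: Int_absorb1)
  moreover have "conn T S (0, 0) (0, 0)" using base n by (intro conn.start) (auto simp: mem_rbox)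
  ultimately show ?case by (intro exI[of _ "(0, 0)"] exI[of _ "(3*n, 0)"]) simp
next
  case (Suc k)
  define q where "q = 3^k * n"
  have q: "0 < q" "3 ^ Suc k * n = 3 * q" using n by (auto simp: q_def)
  obtain x y where x: "conn T S (0, 0) x"
    and xy: "if even k then conn T (S \<inter> rbox 0 (3*q) 0 q) x y \<and> fst x = 0 \<and> fst y = 3*q
      else conn T (S \<inter> rbox 0 q 0 (3*q)) x y \<and> snd x = 0 \<and> snd y = 3*q"
    using Suc unfolding q_def by blast
  have L: "ladder T n (Suc k) S" by (rule R) simp
  show ?case
  proof (cases "even k")
    case True
    have "vcross T 0 (3*q) 0 (3*(3*q)) S" using L True unfolding ladder_def Let_def q(2) by simp
    then obtain u v where uv: "conn T (S \<inter> rbox 0 (3*q) 0 (3*(3*q))) u v" "snd u = 0" "snd v = 3*(3*q)"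
      by (auto simp: vcross_def)
    have "conn T S x u"
      using xy True q by (intro link_crossings[OF m _ _ _ _ _ _ _ uv, of "3*q" q x y]) auto
    then have "conn T S (0, 0) u" using x conn_trans' by metis
    then show ?thesis unfolding q(2) using uv True by (intro exI[of _ u] exI[of _ v]) simp
  next
    case False
    have "hcross T 0 (3*(3*q)) 0 (3*q) S" using L False unfolding ladder_def Let_def q(2) by simp
    then obtain u v where uv: "conn T (S \<inter> rbox 0 (3*(3*q)) 0 (3*q)) u v" "fst u = 0" "fst v = 3*(3*q)"
      by (auto simp: hcross_def)
    have "conn T S u x"
      using xy False q by (intro link_crossings[OF m _ _ _ _ uv, of q "3*q" x y]) auto
    then have "conn T S (0, 0) u" using x conn_trans' matching_conn_sym[OF m] by metis
    then show ?thesis unfolding q(2) using uv False by (intro exI[of _ u] exI[of _ v]) simp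
  qed
qed

lemma ladder_perc:
  assumes n: "0 < n" and base: "rbox 0 (3*n) 0 n \<subseteq> {v. \<omega> v}"
    and R: "\<And>k. 1 \<le> k \<Longrightarrow> ladder site_adj n k {v. \<omega> v}"
  shows "\<omega> \<in> perc_event"
proof -
  have m: "matching site_adj star_adj" by (simp add: matching_def)
  have "\<exists>y\<in>occupied_cluster \<omega> (0, 0). y \<notin> rbox (- int N) (int N) (- int N) (int N)" for N :: nat
  proof -
    let ?S = "{v. \<omega> v}"
    have N: "int N < 3 * (3 ^ N * n)"
    proof -
      have "1 + int N \<le> 3 ^ N" by (induction N) auto
      moreover have "1 * 1 \<le> 3 ^ N * n" using n by (intro mult_mono) auto
      moreover have "3 ^ N * 1 \<le> 3 ^ N * n" using n by (intro mult_left_mono) auto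
      ultimately show ?thesis by linarith
    qed
    obtain x y where x: "conn site_adj ?S (0, 0) x"
      and xy: "if even N
      then conn site_adj (?S \<inter> rbox 0 (3 * (3^N * n)) 0 (3^N * n)) x y \<and> fst x = 0 \<and> fst y = 3 * (3^N * n)
      else conn site_adj (?S \<inter> rbox 0 (3^N * n) 0 (3 * (3^N * n))) x y \<and> snd x = 0 \<and> snd y = 3 * (3^N * n)"
      using ladder_connected[OF m n base R, of N] by blast
    have "conn site_adj ?S x y"
      using xy conn_mono[of site_adj "?S \<inter> _" x y ?S] by (cases "even N") (auto)
    then have "conn site_adj ?S (0, 0) y" using x conn_trans' by metis
    moreover have "y \<notin> rbox (- int N) (int N) (- int N) (int N)"
      using xy N by (auto simp: mem_rbox split: if_splits)
    ultimately show ?thesis unfolding occupied_cluster_conn by blast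
  qed
  then show ?thesis unfolding perc_event_def mem_Collect_eq infinite_iff_unbounded by blast
qed

lemma pr_subset:
  assumes "finite L" "B \<subseteq> L"
  shows "pr q L (\<lambda>S. B \<subseteq> S) = q ^ card B"
proof -
  have "pr q L (\<lambda>S. B \<subseteq> S) = pr q B (\<lambda>S. B \<subseteq> S)" by (rule pr_window[OF assms]) auto
  also have "\<dots> = (\<Sum>S\<in>{B}. weight q B S * of_bool (B \<subseteq> S))"
    unfolding pr_def using assms finite_subset by (intro sum.mono_neutral_right) auto
  finally show ?thesis by (simp add: weight_def)
qed

lemma pr_0: "finite L \<Longrightarrow> pr 0 L E = of_bool (E {})"
  by (induction L arbitrary: E rule: finite_induct) (auto simp: pr_insert)

lemma hprob_0: "hprob T 0 w h = 0"
proof -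
  have "\<not> hcross T 0 w 0 h {}"
    using conn_mem(1)[of T "{}"] by (auto simp: hcross_def)
  then show ?thesis by (simp add: hprob_def pr_0)
qed

text \<open>Failures of rungs are dual crossings, whose probabilities sum to at most 1/2 over
  \<open>k \<ge> 1\<close>. Requiring the base to be occupied costs a positive factor independent of
  the number of rungs, and positive association combines the two.\<close>

lemma percolation_prob_pos:
  assumes p: "0 \<le> p" "p \<le> 1" and n: "0 < n" and small: "hprob star_adj (1 - p) n (3*n) \<le> 1/512"
  shows "0 < percolation_prob p"
proof -
  have m: "matching site_adj star_adj" by (simp add: matching_def)
  have m': "matching star_adj site_adj" by (simp add: matching_def)
  have dual: "hprob site_adj p (3*k) k = 1 - hprob star_adj (1 - p) k (3*k)" if "0 \<le> k" for k
    using that by (intro hprob_duality[OF m]) auto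
  \<comment> \<open>At parameter 0 nothing is crossed, so the dual crossing would be
    certain.\<close>
  have "p \<noteq> 0" using dual[of n] small n hprob_0[of site_adj] by auto
  then have p0: "0 < p" using p by simp
  interpret prob_space "site_percolation p" by (rule prob_space_site_percolation)
  define q where "q k = 3 ^ k * n" for k :: nat
  have q0: "0 < q k" for k using n by (simp add: q_def)
  have q_mono: "q j \<le> q k" if "j \<le> k" for j k
    unfolding q_def using n that by (intro mult_right_mono power_increasing) auto
  define B where "B = rbox 0 (3*n) 0 n"
  define L where "L K = rbox 0 (3 * q K) 0 (3 * q K)" for K
  define E where "E K S \<longleftrightarrow> B \<subseteq> S \<and> (\<forall>k\<in>{1..K}. ladder site_adj n k S)" for K S
  define A where "A K = {\<omega>. E K {v. \<omega> v}}" for K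
  define c where "c = p ^ card B * (1/2)"
  have finL: "finite (L K)" for K by (simp add: L_def)
  have BL: "B \<subseteq> L K" for K
  proof -
    have "n \<le> q K" using q_mono[of 0 K] by (simp add: q_def[of 0])
    then show ?thesis using n unfolding B_def L_def by (intro rbox_mono) auto
  qed
  have boxL: "rbox 0 (3 * q k) 0 (q k) \<subseteq> L K" "rbox 0 (q k) 0 (3 * q k) \<subseteq> L K" if "k \<le> K" for k K
    using q_mono[OF that] q0[of k] unfolding L_def by (simp_all add: rbox_mono)
  have lad: "ladder site_adj n k S \<longleftrightarrow> (if even k then hcross site_adj 0 (3 * q k) 0 (q k) S else vcross site_adj 0 (q k) 0 (3 * q k) S)" for k S
    by (simp add: ladder_def q_def Let_def)
  have A_eq: "A K = {\<omega>. E K {x \<in> L K. \<omega> x}}" for K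
  proof -
    have "E K {v. \<omega> v} \<longleftrightarrow> E K {x \<in> L K. \<omega> x}" for \<omega>
    proof -
      have eq: "{x \<in> L K. \<omega> x} = {v. \<omega> v} \<inter> L K" by blast
      have "ladder site_adj n k ({v. \<omega> v} \<inter> L K) \<longleftrightarrow> ladder site_adj n k {v. \<omega> v}" if "k \<in> {1..K}" for k
        using that boxL[of k K] by (simp add: lad hcross_Int vcross_Int)
      then show ?thesis unfolding E_def eq using BL by blast
    qed
    then show ?thesis unfolding A_def by blast
  qed
  have A_meas: "A K \<in> events" for K unfolding A_eq by (rule measure_window(1)[OF p finL, of "E K"])
  have "c \<le> prob (A K)" for K
  proof -
    have lad_pr: "pr p (L K) (\<lambda>S. \<not> ladder site_adj n k S) \<le> (1/2) ^ (k + 1)" if "k \<in> {1..K}" for k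
    proof -
      have "pr p (L K) (ladder site_adj n k) = hprob site_adj p (3 * q k) (q k)"
      proof (cases "even k")
        case True
        then have "ladder site_adj n k = hcross site_adj 0 (3 * q k) 0 (q k)" by (simp add: lad fun_eq_iff)
        then show ?thesis using that boxL(1)[of k K] pr_hcross[OF m finL, of 0 "3 * q k" 0 "q k" K p] by simp
      next
        case False
        then have "ladder site_adj n k = vcross site_adj 0 (q k) 0 (3 * q k)" by (simp add: lad fun_eq_iff)
        then show ?thesis using that boxL(2)[of k K] pr_vcross[OF m finL, of 0 "q k" 0 "3 * q k" K p] by simp
      qed
      then have "pr p (L K) (\<lambda>S. \<not> ladder site_adj n k S) = hprob star_adj (1 - p) (q k) (3 * q k)"
        using dual[of "q k"] q0[of k] pr_not[OF finL, of p K "ladder site_adj n k"] by simp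
      moreover have "256 * hprob star_adj (1 - p) (q k) (3 * q k) \<le> (1/2) ^ (k + 1)"
        unfolding q_def using p small by (intro hprob_decay[OF m' n]) auto
      moreover have "0 \<le> hprob star_adj (1 - p) (q k) (3 * q k)" using p by (intro hprob_bounds) auto
      ultimately show ?thesis by linarith
    qed
    have geo: "(\<Sum>k\<in>{1..K}. (1/2::real) ^ (k + 1)) \<le> 1/2"
    proof -
      have "(\<Sum>k\<in>{1..K}. (1/2::real) ^ (k + 1)) = 1/2 - (1/2) ^ (K + 1)" by (induction K) auto
      then show ?thesis by simp
    qed
    have "pr p (L K) (\<lambda>S. \<not> (\<forall>k\<in>{1..K}. ladder site_adj n k S)) \<le> (\<Sum>k\<in>{1..K}. pr p (L K) (\<lambda>S. \<not> ladder site_adj n k S))"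
      using pr_Bex_le[OF _ p, of "{1..K}" "L K" "\<lambda>k S. \<not> ladder site_adj n k S"] by simp
    also have "\<dots> \<le> (\<Sum>k\<in>{1..K}. (1/2) ^ (k + 1))" by (intro sum_mono lad_pr)
    finally have "pr p (L K) (\<lambda>S. \<not> (\<forall>k\<in>{1..K}. ladder site_adj n k S)) \<le> 1/2" using geo by linarith
    then have half: "1/2 \<le> pr p (L K) (\<lambda>S. \<forall>k\<in>{1..K}. ladder site_adj n k S)"
      using pr_not[OF finL, of p K "\<lambda>S. \<forall>k\<in>{1..K}. ladder site_adj n k S"] by linarith
    have "c \<le> pr p (L K) (\<lambda>S. B \<subseteq> S) * pr p (L K) (\<lambda>S. \<forall>k\<in>{1..K}. ladder site_adj n k S)"
      unfolding c_def pr_subset[OF finL BL] using half p by (intro mult_left_mono) auto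
    also have "\<dots> \<le> pr p (L K) (E K)"
      unfolding E_def
    proof (rule harris[OF finL p])
      show "incr_on (L K) ((\<subseteq>) B)" unfolding incr_on_def by blast
      show "incr_on (L K) (\<lambda>S. \<forall>k\<in>{1..K}. ladder site_adj n k S)"
        unfolding incr_on_def using ladder_mono by blast
    qed
    also have "\<dots> = prob (A K)" unfolding A_eq by (rule measure_window(2)[OF p finL, of "E K", symmetric])
    finally show ?thesis .
  qed
  \<comment> \<open>The estimates for finitely many rungs are uniform in \<open>K\<close>, so they
    pass to the decreasing limit.\<close>
  moreover have "(\<lambda>K. prob (A K)) \<longlonglongrightarrow> prob (\<Inter>K. A K)"
  proof (rule finite_Lim_measure_decseq)
    show "range A \<subseteq> events" using A_meas by blast
    show "decseq A" unfolding decseq_def A_def E_def by auto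
  qed
  ultimately have "c \<le> prob (\<Inter>K. A K)" by (intro LIMSEQ_le_const) auto
  also have "\<dots> \<le> prob perc_event"
  proof (rule finite_measure_mono[OF _ measurable_perc_event])
    show "(\<Inter>K. A K) \<subseteq> perc_event"
    proof
      fix \<omega> assume \<omega>: "\<omega> \<in> (\<Inter>K. A K)"
      show "\<omega> \<in> perc_event"
      proof (rule ladder_perc[OF n])
        show "rbox 0 (3*n) 0 n \<subseteq> {v. \<omega> v}" using \<omega> unfolding A_def E_def B_def by blast
        show "ladder site_adj n k {v. \<omega> v}" if "1 \<le> k" for k
          using \<omega> that unfolding A_def E_def by (auto dest!: spec[of _ k])
      qed
    qed
  qed
  finally have "c \<le> percolation_prob p" unfolding percolation_prob_eq .
  moreover have "0 < c" using p0 by (simp add: c_def)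
  ultimately show ?thesis by linarith
qed

lemma zero_percolation: "percolation_prob 0 = 0"
  by (rule percolation_prob_zero[of 0 1]) (auto simp: hprob_0)

section \<open>The critical point\<close>

lemma p_crit_bounds: "0 \<le> p_crit" "p_crit \<le> 1"
proof -
  let ?X = "{p \<in> {0..1}. percolation_prob p = 0}"
  have X: "0 \<in> ?X" using zero_percolation by simp
  have bdd: "bdd_above ?X" by (rule bdd_aboveI[of _ 1]) auto
  show "0 \<le> p_crit" unfolding p_crit_def by (rule cSup_upper[OF X bdd])
  show "p_crit \<le> 1" unfolding p_crit_def by (rule cSup_least) (use X in blast, auto)
qed

lemma continuous_hprob: "isCont (\<lambda>q. hprob T q w h) q"
  unfolding hprob_def by (rule continuous_pr)

text \<open>A small value would persist slightly above \<open>p_crit\<close> by continuity and give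
  \<open>\<theta> = 0\<close> there, against the supremum.\<close>

lemma hprob_site_critical:
  assumes n: "0 < n" shows "1/512 \<le> hprob site_adj p_crit n (3*n)"
proof (rule ccontr)
  assume small: "\<not> ?thesis"
  let ?X = "{p \<in> {0..1}. percolation_prob p = 0}"
  have m': "matching star_adj site_adj" by (simp add: matching_def)
  have "hprob site_adj 1 n (3*n) = 1"
    using hprob_duality[OF matching_sym[OF m'], of n "3*n" 1] n hprob_0 by simp
  \<comment> \<open>There has to be room above \<open>p_crit\<close> within the unit interval; at
    parameter 1 every crossing exists.\<close>
  then have lt1: "p_crit < 1" using small p_crit_bounds by (cases "p_crit = 1") auto
  have "eventually (\<lambda>p. hprob site_adj p n (3*n) < 1/512) (at p_crit)"
    using continuous_hprob[where T = site_adj and w = n and h = "3*n" and q = p_crit] small unfolding isCont_def by (intro order_tendstoD) auto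
  then obtain d where d: "0 < d" "\<And>p. p \<noteq> p_crit \<Longrightarrow> dist p p_crit < d \<Longrightarrow> hprob site_adj p n (3*n) < 1/512"
    unfolding eventually_at by auto
  define p where "p = min 1 (p_crit + d/2)"
  have p: "p_crit < p" "p \<le> 1" "dist p p_crit < d" using d lt1 by (auto simp: p_def dist_real_def min_def)
  have "percolation_prob p = 0"
    using p d(2)[of p] p_crit_bounds by (intro percolation_prob_zero[OF _ _ n]) auto
  then have "p \<in> ?X" using p p_crit_bounds by auto
  moreover have "bdd_above ?X" by (rule bdd_aboveI[of _ 1]) auto
  ultimately have "p \<le> p_crit" unfolding p_crit_def by (rule cSup_upper)
  then show False using p by simp
qed

text \<open>Here the contradiction comes from below: parameters with \<open>\<theta> = 0\<close>
  approach the supremum, and they would lie in the range where \<open>\<theta> > 0\<close>.\<close>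

lemma hprob_star_critical:
  assumes n: "0 < n" shows "1/512 \<le> hprob star_adj (1 - p_crit) n (3*n)"
proof (rule ccontr)
  assume small: "\<not> ?thesis"
  let ?X = "{p \<in> {0..1}. percolation_prob p = 0}"
  let ?f = "\<lambda>p. hprob star_adj (1 - p) n (3*n)"
  have "isCont ?f p_crit"
    by (rule isCont_o2[where g = "\<lambda>q. hprob star_adj q n (3*n)" and f = "\<lambda>p. 1 - p"])
      (auto intro: continuous_hprob)
  then have "eventually (\<lambda>p. ?f p < 1/512) (at p_crit)"
    using small unfolding isCont_def by (intro order_tendstoD) auto
  then obtain d where d: "0 < d" "\<And>p. p \<noteq> p_crit \<Longrightarrow> dist p p_crit < d \<Longrightarrow> ?f p < 1/512"
    unfolding eventually_at by auto
  have bdd: "bdd_above ?X" by (rule bdd_aboveI[of _ 1]) auto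
  have ne: "?X \<noteq> {}" using zero_percolation by force
  have "p_crit - d < Sup ?X" using d(1) unfolding p_crit_def by simp
  then obtain p where p: "p \<in> ?X" "p_crit - d < p" using less_cSup_iff[OF ne bdd] by blast
  have le: "p \<le> p_crit" unfolding p_crit_def by (rule cSup_upper[OF p(1) bdd])
  have "?f p \<le> 1/512"
  proof (cases "p = p_crit")
    case True
    then show ?thesis using small by simp
  next
    case False
    then show ?thesis using d(2)[of p] p le by (auto simp: dist_real_def)
  qed
  then have "0 < percolation_prob p" using p by (intro percolation_prob_pos[OF _ _ n]) auto
  then show False using p by simp
qed

text \<open>
  If square crossings are very unlikely, then the dual squares are crossed with probability close
  to one, hence by \<open>rsw\<close> so are long dual rectangles, which contradicts \<open>easy\<close>.
\<close>

lemma hprob_long: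
  assumes m: "matching T T'" and q: "0 \<le> q" "q \<le> 1"
    and easy: "\<And>n. 0 < n \<Longrightarrow> 1/512 \<le> hprob T q n (3*n)"
  shows "\<exists>c>0. \<forall>l>0. c \<le> hprob T q (3*l) (2*l)"
proof -
  \<comment> \<open>The bound below only needs \<open>(1 - \<surd>c0) ^ 21 > 1 - 1/512\<close>: exponent 3 from \<open>rsw\<close>, 7 from chaining to length \<open>6l\<close>.\<close>
  define c0 :: real where "c0 = (1/20000)\<^sup>2"
  define c where "c = (1 - sqrt (1 - c0)) ^ 3"
  have c0: "0 < c0" "c0 < 1" by (auto simp: c0_def power2_eq_square)
  have "sqrt (1 - c0) < sqrt 1" using c0 by (intro real_sqrt_less_mono) auto
  then have "0 < c" by (simp add: c_def)
  moreover have "c \<le> hprob T q (3*l) (2*l)" if l: "0 < l" for l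
  proof (cases "c0 \<le> hprob T q (2*l) (2*l)")
    case True
    have "sqrt (1 - hprob T q (2*l) (2*l)) \<le> sqrt (1 - c0)" using True by simp
    moreover have "sqrt (1 - c0) \<le> 1" using c0 by simp
    ultimately have "c \<le> (1 - sqrt (1 - hprob T q (2*l) (2*l))) ^ 3"
      unfolding c_def by (intro power_mono) auto
    also have "\<dots> \<le> hprob T q (3*l) (2*l)" by (rule rsw[OF m l q])
    finally show ?thesis .
  next
    case False
    let ?T = "\<lambda>w h. hprob T' (1 - q) w h"
    have m': "matching T' T" using m matching_sym by blast
    have q': "0 \<le> 1 - q" "1 - q \<le> 1" using q by auto
    have dual: "?T w h = 1 - hprob T q h w" if "0 \<le> w" "0 \<le> h" for w h
      using hprob_duality[OF m', of w h "1 - q"] that by simp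
    have "sqrt (1 - ?T (2*l) (2*l)) \<le> sqrt c0" using False dual[of "2*l" "2*l"] l by simp
    also have "sqrt c0 = 1/20000" by (simp add: c0_def)
    finally have "(1 - 1/20000) ^ 3 \<le> (1 - sqrt (1 - ?T (2*l) (2*l))) ^ 3" by (intro power_mono) auto
    also have "\<dots> \<le> ?T (3*l) (2*l)" by (rule rsw[OF m' l q'])
    finally have "((1 - 1/20000) ^ 3) ^ (1 + 2 * 3) \<le> ?T ((3 + int 3) * l) (2*l)"
      by (intro hprob_chain[OF m' l q']) auto
    also have "\<dots> = 1 - hprob T q (2*l) (3*(2*l))" using dual[of "6*l" "2*l"] l by simp
    also have "\<dots> \<le> 1 - 1/512" using easy[of "2*l"] l by simp
    finally have "((1 - 1/20000::real) ^ 3) ^ 7 \<le> 1 - 1/512" by simp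
    moreover have "1 + real 21 * (-1/20000) \<le> (1 + (-1/20000)) ^ 21" by (rule Bernoulli_inequality) simp
    moreover have "((1 - 1/20000::real) ^ 3) ^ 7 = (1 + (-1/20000)) ^ 21" by (simp add: power_mult[symmetric])
    ultimately show ?thesis by simp
  qed
  ultimately show ?thesis by blast
qed

section \<open>All aspect ratios\<close>

text \<open>The bound on \<open>w\<close> involves \<open>h + 1\<close> so that it can be applied to
  a height rounded down to an integer. Heights 0 and 1 are too small for rectangles of height
  \<open>2*l\<close> with \<open>l > 0\<close>; there a fully occupied row is used.\<close>

lemma hprob_aspect:
  assumes m: "matching T T'" and q: "0 < q" "q \<le> 1"
    and easy: "\<And>n. 0 < n \<Longrightarrow> 1/512 \<le> hprob T q n (3*n)"
  shows "\<exists>c>0. \<forall>w h. 0 \<le> w \<longrightarrow> 0 \<le> h \<longrightarrow> real_of_int w \<le> a * (real_of_int h + 1) \<longrightarrow> c \<le> hprob T q w h"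
proof -
  have q': "0 \<le> q" "q \<le> 1" using q by auto
  obtain c where c: "0 < c" "\<And>l. 0 < l \<Longrightarrow> c \<le> hprob T q (3*l) (2*l)"
    using hprob_long[OF m q' easy] by blast
  \<comment> \<open>With \<open>l = h div 2\<close> one has \<open>h + 1 \<le> 4*l\<close>, hence
    \<open>w \<le> 4*a*l\<close>.\<close>
  define k where "k = nat \<lceil>4 * a\<rceil>"
  \<comment> \<open>For \<open>h \<le> 1\<close> one has \<open>w \<le> 2*a\<close>, so a row has at
    most \<open>j\<close> sites.\<close>
  define j where "j = nat \<lceil>2 * a\<rceil> + 1"
  have "min (c ^ (1 + 2 * k)) (q ^ j) \<le> hprob T q w h"
    if w: "0 \<le> w" and h: "0 \<le> h" and wh: "real_of_int w \<le> a * (real_of_int h + 1)" for w h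
  proof (cases "2 \<le> h")
    case True
    define l where "l = h div 2"
    have l: "0 < l" "2*l \<le> h" "h \<le> 2*l + 1" using True by (auto simp: l_def)
    have "0 \<le> a"
    proof (rule ccontr)
      assume "\<not> 0 \<le> a"
      then have "a * (real_of_int h + 1) < 0" using h by (intro mult_neg_pos) auto
      then show False using w wh by simp
    qed
    then have "real_of_int w \<le> a * (4 * real_of_int l)"
      using wh l by (intro order_trans[OF wh] mult_left_mono) auto
    also have "\<dots> = (4 * a) * real_of_int l" by simp
    also have "4 * a \<le> real_of_int (3 + int k)" unfolding k_def by linarith
    then have "(4 * a) * real_of_int l \<le> real_of_int (3 + int k) * real_of_int l"
      using l by (intro mult_right_mono) auto
    finally have wl: "w \<le> (3 + int k) * l" by (metis of_int_le_iff of_int_mult)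
    have "c ^ (1 + 2 * k) \<le> hprob T q ((3 + int k) * l) (2*l)"
      using c(1) c(2)[OF l(1)] by (intro hprob_chain[OF m l(1) q']) auto
    also have "\<dots> \<le> hprob T q w h" using w wl l by (intro hprob_mono[OF m q'])
    finally show ?thesis by simp
  next
    case False
    have "0 \<le> a \<Longrightarrow> a * (real_of_int h + 1) \<le> a * 2" using False by (intro mult_left_mono) auto
    moreover have "\<not> 0 \<le> a \<Longrightarrow> a * (real_of_int h + 1) < 0" using h by (intro mult_neg_pos) auto
    ultimately have "real_of_int w \<le> 2 * a" using wh w by (cases "0 \<le> a") auto
    then have wj: "nat w + 1 \<le> j" using w unfolding j_def by linarith
    have "q ^ j \<le> q ^ (nat w + 1)" using q wj by (intro power_decreasing) auto
    also have "\<dots> = q ^ card (rbox 0 w 0 0)" using w by (simp add: rbox_def card_cartesian_product nat_add_distrib add.commute)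
    also have "\<dots> = pr q (rbox 0 w 0 0) (\<lambda>S. rbox 0 w 0 0 \<subseteq> S)" by (simp add: pr_subset)
    also have "\<dots> \<le> hprob T q w 0"
      unfolding hprob_def
    proof (rule pr_mono[OF q'])
      fix S assume S: "rbox 0 w 0 0 \<subseteq> S"
      have "conn T (rbox 0 0 0 w) (0, 0) (0, w)"
        using w by (intro conn_column[OF m]) (auto simp: mem_rbox)
      then have "conn T (rbox 0 w 0 0) (0, 0) (w, 0)"
        using conn_swap[OF m, of "rbox 0 0 0 w" "(0, 0)" "(0, w)"] by (simp add: swap_rbox)
      then have "conn T (S \<inter> rbox 0 w 0 0) (0, 0) (w, 0)" using S by (simp add: Int_absorb1)
      then show "hcross T 0 w 0 0 S" by (rule hcrossI) auto
    qed
    also have "\<dots> \<le> hprob T q w h" using w h by (intro hprob_mono[OF m q']) auto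
    finally show ?thesis by simp
  qed
  moreover have "0 < min (c ^ (1 + 2 * k)) (q ^ j)" using c q by simp
  ultimately show ?thesis by blast
qed

theorem theorem1p1:
  fixes lam :: real
  assumes "lam > 0"
  shows "\<exists>c::real. c > 0 \<and>
    (\<forall>n::int. n \<ge> 1 \<longrightarrow> (\<forall>v::site.
      c \<le> measure (site_percolation p_crit) (crossing_event v n (lam * real_of_int n)) \<and>
      measure (site_percolation p_crit) (crossing_event v n (lam * real_of_int n)) \<le> 1 - c))"
proof -
  have m: "matching site_adj star_adj" "matching star_adj site_adj" by (simp_all add: matching_def)
  \<comment> \<open>Crossing probabilities vanish at parameter 0, so the uniform lower bounds
    exclude both trivial values of \<open>p_crit\<close>.\<close>
  have "p_crit \<noteq> 0" "1 - p_crit \<noteq> 0"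
    using hprob_site_critical[of 1] hprob_star_critical[of 1] hprob_0 by auto
  then have pc: "0 < p_crit" "p_crit \<le> 1" "0 < 1 - p_crit" "1 - p_crit \<le> 1"
    using p_crit_bounds by auto
  obtain c1 where c1: "0 < c1" "\<And>w h. 0 \<le> w \<Longrightarrow> 0 \<le> h \<Longrightarrow>
      real_of_int w \<le> (1 / lam) * (real_of_int h + 1) \<Longrightarrow> c1 \<le> hprob site_adj p_crit w h"
    using hprob_aspect[OF m(1) pc(1,2) hprob_site_critical, of "1 / lam"] by blast
  obtain c2 where c2: "0 < c2" "\<And>w h. 0 \<le> w \<Longrightarrow> 0 \<le> h \<Longrightarrow>
      real_of_int w \<le> lam * (real_of_int h + 1) \<Longrightarrow> c2 \<le> hprob star_adj (1 - p_crit) w h"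
    using hprob_aspect[OF m(2) pc(3,4) hprob_star_critical, of lam] by blast
  have "min c1 c2 \<le> measure (site_percolation p_crit) (crossing_event v n (lam * real_of_int n)) \<and>
      measure (site_percolation p_crit) (crossing_event v n (lam * real_of_int n)) \<le> 1 - min c1 c2"
    if n: "1 \<le> n" for n v
  proof -
    define h where "h = \<lfloor>lam * real_of_int n\<rfloor>"
    have h: "0 \<le> h" "real_of_int h \<le> lam * real_of_int n" "lam * real_of_int n \<le> real_of_int h + 1"
      using assms n by (auto simp: h_def)
    have "real_of_int n \<le> (1 / lam) * (real_of_int h + 1)"
      using h(3) assms by (simp add: field_simps)
    then have 1: "c1 \<le> hprob site_adj p_crit n h" using n h by (intro c1(2)) auto
    have "real_of_int h \<le> lam * (real_of_int n + 1)"
      using h(2) assms by (simp add: distrib_left)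
    \<comment> \<open>The dual rectangle has its sides exchanged, so it has the reciprocal aspect
      ratio \<open>lam\<close>.\<close>
    then have "c2 \<le> hprob star_adj (1 - p_crit) h n" using n h by (intro c2(2)) auto
    then have 2: "hprob site_adj p_crit n h \<le> 1 - c2"
      using hprob_duality[OF m(1), of n h p_crit] n h by simp
    show ?thesis using 1 2 measure_crossing_event[OF p_crit_bounds] unfolding h_def by auto
  qed
  moreover have "0 < min c1 c2" using c1 c2 by simp
  ultimately show ?thesis by blast
qed

end
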